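(* There exists a $\frac{3}{2}$-tough plane triangulation that has no 2-factor.
   Context: All graphs are finite and simple. A plane triangulation is a simple graph embedded in the plane such that every face (including the outer face) is bounded by a triangle, i.e. a maximal planar graph with a fixed plane embedding. For a graph $G$ and $S\subseteq V(G)$, $c(G-S)$ denotes the number of connected components of $G-S$. For a real number $t\ge 0$, $G$ is $t$-tough if $|S|\ge t\cdot c(G-S)$ for every $S\subseteq V(G)$ with $c(G-S)\ge 2$. A 2-factor of $G$ is a spanning subgraph of $G$ in which every vertex has degree exactly 2. *)

theory Defs
  imports "HOL-Analysis.Analysis"
begin

record 'v ugraph =
  verts :: "'v set"
  edges :: "'v set set"

definition simple_graph :: "'v ugraph \<Rightarrow> bool" where
  "simple_graph G \<longleftrightarrow>
     finite (verts G) \<and> (\<forall>e \<in> edges G. e \<subseteq> verts G \<and> card e = 2)"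

definition delete_verts :: "'v ugraph \<Rightarrow> 'v set \<Rightarrow> 'v ugraph" where
  "delete_verts G S =
     \<lparr> verts = verts G - S, edges = {e \<in> edges G. e \<inter> S = {}} \<rparr>"

definition joined :: "'v ugraph \<Rightarrow> ('v \<times> 'v) set" where
  "joined G = {(u, v). u \<in> verts G \<and> v \<in> verts G \<and> (u, v) \<in> {(x, y). {x, y} \<in> edges G}\<^sup>*}"

text \<open>Connected components are represented by their vertex sets.\<close>

definition graph_components :: "'v ugraph \<Rightarrow> 'v set set" where
  "graph_components G = verts G // joined G"

definition num_components :: "'v ugraph \<Rightarrow> nat" where
  "num_components G = card (graph_components G)"

definition tough :: "real \<Rightarrow> 'v ugraph \<Rightarrow> bool" where
  "tough t G \<longleftrightarrow>
     (\<forall>S \<subseteq> verts G. num_components (delete_verts G S) \<ge> 2 \<longrightarrow>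
        real (card S) \<ge> t * real (num_components (delete_verts G S)))"

definition degree_in :: "'v ugraph \<Rightarrow> 'v \<Rightarrow> nat" where
  "degree_in G v = card {e \<in> edges G. v \<in> e}"

definition two_factor :: "'v ugraph \<Rightarrow> 'v ugraph \<Rightarrow> bool" where
  "two_factor H G \<longleftrightarrow>
     simple_graph H \<and> verts H = verts G \<and> edges H \<subseteq> edges G \<and>
     (\<forall>v \<in> verts H. degree_in H v = 2)"

text \<open>
  The plane is the type of complex numbers. In an embedding, \<open>p\<close> places the vertices and
  \<open>\<gamma> e\<close> parametrizes the Jordan arc that draws the edge \<open>e\<close>; an arc meets the
  vertices only in its own endpoints, and two arcs meet only in common endpoints.
\<close>

definition plane_embedding ::
    "'v ugraph \<Rightarrow> ('v \<Rightarrow> complex) \<Rightarrow> ('v set \<Rightarrow> real \<Rightarrow> complex) \<Rightarrow> bool" where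
  "plane_embedding G p \<gamma> \<longleftrightarrow>
     inj_on p (verts G) \<and>
     (\<forall>e \<in> edges G. arc (\<gamma> e) \<and> {pathstart (\<gamma> e), pathfinish (\<gamma> e)} = p ` e) \<and>
     (\<forall>e \<in> edges G. \<forall>v \<in> verts G. p v \<in> path_image (\<gamma> e) \<longrightarrow> v \<in> e) \<and>
     (\<forall>e \<in> edges G. \<forall>f \<in> edges G. e \<noteq> f \<longrightarrow>
        path_image (\<gamma> e) \<inter> path_image (\<gamma> f) \<subseteq> p ` (e \<inter> f))"

definition drawing ::
    "'v ugraph \<Rightarrow> ('v \<Rightarrow> complex) \<Rightarrow> ('v set \<Rightarrow> real \<Rightarrow> complex) \<Rightarrow> complex set" where
  "drawing G p \<gamma> = p ` verts G \<union> (\<Union>e \<in> edges G. path_image (\<gamma> e))"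

text \<open>The faces include the unbounded one.\<close>

definition plane_faces ::
    "'v ugraph \<Rightarrow> ('v \<Rightarrow> complex) \<Rightarrow> ('v set \<Rightarrow> real \<Rightarrow> complex) \<Rightarrow> complex set set" where
  "plane_faces G p \<gamma> = components (- drawing G p \<gamma>)"

definition bounded_by_triangle ::
    "'v ugraph \<Rightarrow> ('v set \<Rightarrow> real \<Rightarrow> complex) \<Rightarrow> complex set \<Rightarrow> bool" where
  "bounded_by_triangle G \<gamma> F \<longleftrightarrow>
     (\<exists>a b c. a \<noteq> b \<and> b \<noteq> c \<and> a \<noteq> c \<and>
        {a, b} \<in> edges G \<and> {b, c} \<in> edges G \<and> {a, c} \<in> edges G \<and>
        frontier F = path_image (\<gamma> {a, b}) \<union> path_image (\<gamma> {b, c}) \<union> path_image (\<gamma> {a, c}))"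

definition plane_triangulation ::
    "'v ugraph \<Rightarrow> ('v \<Rightarrow> complex) \<Rightarrow> ('v set \<Rightarrow> real \<Rightarrow> complex) \<Rightarrow> bool" where
  "plane_triangulation G p \<gamma> \<longleftrightarrow>
     simple_graph G \<and> plane_embedding G p \<gamma> \<and>
     (\<forall>F \<in> plane_faces G p \<gamma>. bounded_by_triangle G \<gamma> F)"

end

(*
  The graph has 429 vertices. Three paths of five hubs each are tied together at both ends to a
  theta graph; consecutive hubs are joined by two ears and every hub carries a pendant. The three
  faces of the theta graph, and the twelve regions between the two ears of a pair, are filled with
  cut vertices. For the set S of the 51 cut vertices and an independent set T of three vertices per
  ear and pendant, the remaining vertices form 50 components each joined to T by an odd number of
  edges, and the parity obstruction of Tutte's f-factor theorem rules out a 2-factor: a spanning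
  2-regular subgraph has 2 * 117 edges at T, but S and the components can absorb only 2 * 51 + 130.

  For toughness, a deleted set W is charged locally. Enumerating the possible traces of W on one ear,
  one pendant and one hub bounds the components that the gadget can cut off in terms of the deleted
  vertices inside it. The label sets of the hubs are then merged along the theta graph, where every
  pair of hubs with a surviving ear saves one component unless it closes a cycle.

  Planarity is certified by integer coordinates: if all inner triangles are positively oriented, their
  sides match up, and their areas add up to at most the area of the outer triangle, then they tile it.
*)

theory Submission
  imports Defs "HOL-Library.Code_Binary_Nat"
begin

section \<open>Straight-line triangulations\<close>

text \<open>Toughness is counted in one currency: a component costs 3, a deleted vertex pays 2. A
  component that meets cut vertices but no hub is paid 2 by every gadget whose cut list it meets;
  each cut vertex lies in two lists, so 4 is paid where 3 is due. Components inside one gadget are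
  settled there, those at hubs by the union bound on the theta graph, where a broken link loses a
  saving of 3. This is affordable: a link breaks only if both ears of a pair stop conducting, and
  each of them pays towards the two regions it borders, unless the cut vertices there are already
  dead. The obstacle is the unbroken theta graph. The general estimate then misses by 3, and some
  failure is unavoidable, since deleting nothing leaves one component; only here does it matter that
  at least two components remain. Components that are separate inside a gadget may meet outside it,
  so local labels are only required to be at least as fine as the true components, and all local
  figures are upper bounds. In the geometry no pair of edges is tested for crossing; this follows
  from covering without spare area.\<close>

definition cross :: "complex \<Rightarrow> complex \<Rightarrow> complex \<Rightarrow> real" where
  "cross p q r = (Re q - Re p) * (Im r - Im p) - (Im q - Im p) * (Re r - Re p)"

abbreviation triangle :: "complex \<Rightarrow> complex \<Rightarrow> complex \<Rightarrow> complex set" where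
  "triangle a b c \<equiv> convex hull {a, b, c}"

lemma cross_rotate:
  fixes a b c
  shows "cross b c a = cross a b c" and "cross c a b = cross a b c"
  by (simp_all add: cross_def algebra_simps)

lemma cross_swap: "cross b a w = - cross a b w"
  by (simp add: cross_def algebra_simps)

lemma cross_sum: "cross a b w + cross b c w + cross c a w = cross a b c"
  by (simp add: cross_def algebra_simps)

text \<open>Cramer's rule: \<open>cross\<close> is twice a signed area, and the coefficients are
  barycentric coordinates cleared of their denominator. The descriptions of triangles by signs rest
  on this identity.\<close>

lemma cross_barycentric:
  "cross a b c *\<^sub>R w = cross b c w *\<^sub>R a + cross c a w *\<^sub>R b + cross a b w *\<^sub>R c"
  by (simp add: cross_def complex_eq_iff algebra_simps)

lemma cross_combination:
  assumes "u + v + w = 1"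
  shows "cross p q (u *\<^sub>R a + v *\<^sub>R b + w *\<^sub>R c) = u * cross p q a + v * cross p q b + w * cross p q c"
proof -
  have w: "w = 1 - u - v" using assms by simp
  show ?thesis unfolding w by (simp add: cross_def algebra_simps)
qed

lemma cross_degenerate [simp]: "cross a b a = 0" "cross a b b = 0" "cross a a b = 0"
  by (simp_all add: cross_def)

lemma continuous_on_cross [continuous_intros]: "continuous_on S (cross p q)"
  unfolding cross_def[abs_def] by (intro continuous_intros)

lemma cross_coordinates:
  assumes D: "cross a b c > 0"
  obtains x y z where "w = x *\<^sub>R a + y *\<^sub>R b + z *\<^sub>R c" "x + y + z = 1"
    "cross b c w = x * cross a b c" "cross c a w = y * cross a b c" "cross a b w = z * cross a b c"
proof
  let ?D = "cross a b c"
  have "w = inverse ?D *\<^sub>R (?D *\<^sub>R w)" using D by simp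
  also have "\<dots> = (cross b c w / ?D) *\<^sub>R a + (cross c a w / ?D) *\<^sub>R b + (cross a b w / ?D) *\<^sub>R c"
    by (subst cross_barycentric) (simp add: scaleR_add_right divide_inverse mult.commute)
  finally show "w = (cross b c w / ?D) *\<^sub>R a + (cross c a w / ?D) *\<^sub>R b + (cross a b w / ?D) *\<^sub>R c" .
  show "cross b c w / ?D + cross c a w / ?D + cross a b w / ?D = 1"
    using D cross_sum[of a b w c] by (simp flip: add_divide_distrib add: add.commute add.left_commute)
qed (use D in auto)

lemma triangle_eq:
  assumes D: "cross a b c > 0"
  shows "triangle a b c = {w. 0 \<le> cross a b w \<and> 0 \<le> cross b c w \<and> 0 \<le> cross c a w}"
proof (intro equalityI subsetI)
  fix w assume "w \<in> triangle a b c"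
  then obtain u v t where *: "w = u *\<^sub>R a + v *\<^sub>R b + t *\<^sub>R c" "0 \<le> u" "0 \<le> v" "0 \<le> t" "u + v + t = 1"
    by (auto simp: convex_hull_3)
  then show "w \<in> {w. 0 \<le> cross a b w \<and> 0 \<le> cross b c w \<and> 0 \<le> cross c a w}"
    using D cross_rotate[of a b c] by (simp add: cross_combination)
next
  fix w assume w: "w \<in> {w. 0 \<le> cross a b w \<and> 0 \<le> cross b c w \<and> 0 \<le> cross c a w}"
  obtain x y z where *: "w = x *\<^sub>R a + y *\<^sub>R b + z *\<^sub>R c" "x + y + z = 1"
    and xyz: "cross b c w = x * cross a b c" "cross c a w = y * cross a b c" "cross a b w = z * cross a b c"
    by (rule cross_coordinates[OF D])
  have "0 \<le> x * cross a b c" "0 \<le> y * cross a b c" "0 \<le> z * cross a b c"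
    using w unfolding xyz[symmetric] by simp_all
  then have "0 \<le> x" "0 \<le> y" "0 \<le> z" using D by (simp_all add: zero_le_mult_iff)
  then show "w \<in> triangle a b c" unfolding convex_hull_3 using * by blast
qed

lemma not_collinear_cross:
  assumes D: "cross a b c > 0"
  shows "\<not> collinear {a, b, c}"
proof
  assume "collinear {a, b, c}"
  then obtain u where u: "\<forall>x\<in>{a, b, c}. \<forall>y\<in>{a, b, c}. \<exists>k. x - y = k *\<^sub>R u"
    unfolding collinear_def by blast
  obtain k where "b - a = k *\<^sub>R u" using u by blast
  moreover obtain l where "c - a = l *\<^sub>R u" using u by blast
  ultimately have "Re b - Re a = k * Re u" "Im b - Im a = k * Im u" "Re c - Re a = l * Re u" "Im c - Im a = l * Im u"
    by (simp_all add: complex_eq_iff)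
  then show False using D by (simp add: cross_def)
qed

lemma interior_triangle:
  assumes D: "cross a b c > 0"
  shows "interior (triangle a b c) = {w. 0 < cross a b w \<and> 0 < cross b c w \<and> 0 < cross c a w}"
proof -
  have "interior (triangle a b c) = {w. \<exists>x y z. 0 < x \<and> 0 < y \<and> 0 < z \<and> x + y + z = 1 \<and> x *\<^sub>R a + y *\<^sub>R b + z *\<^sub>R c = w}"
    using not_collinear_cross[OF D] by (intro interior_convex_hull_3_minimal) auto
  also have "\<dots> = {w. 0 < cross a b w \<and> 0 < cross b c w \<and> 0 < cross c a w}"
  proof (intro equalityI subsetI)
    fix w assume "w \<in> {w. \<exists>x y z. 0 < x \<and> 0 < y \<and> 0 < z \<and> x + y + z = 1 \<and> x *\<^sub>R a + y *\<^sub>R b + z *\<^sub>R c = w}"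
    then show "w \<in> {w. 0 < cross a b w \<and> 0 < cross b c w \<and> 0 < cross c a w}"
      using D cross_rotate[of a b c] by (auto simp: cross_combination)
  next
    fix w assume w: "w \<in> {w. 0 < cross a b w \<and> 0 < cross b c w \<and> 0 < cross c a w}"
    obtain x y z where *: "w = x *\<^sub>R a + y *\<^sub>R b + z *\<^sub>R c" "x + y + z = 1"
      and xyz: "cross b c w = x * cross a b c" "cross c a w = y * cross a b c" "cross a b w = z * cross a b c"
      by (rule cross_coordinates[OF D])
    have "0 < x * cross a b c" "0 < y * cross a b c" "0 < z * cross a b c"
      using w unfolding xyz[symmetric] by simp_all
    then have "0 < x" "0 < y" "0 < z" using D by (simp_all add: zero_less_mult_iff)
    then show "w \<in> {w. \<exists>x y z. 0 < x \<and> 0 < y \<and> 0 < z \<and> x + y + z = 1 \<and> x *\<^sub>R a + y *\<^sub>R b + z *\<^sub>R c = w}"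
      using * by blast
  qed
  finally show ?thesis .
qed

lemma frontier_triangle:
  fixes a b c :: complex
  shows "frontier (triangle a b c) = closed_segment a b \<union> closed_segment b c \<union> closed_segment c a"
  by (rule frontier_of_triangle) simp

lemma closed_triangle: "closed (triangle a b (c::complex))"
  by (simp add: compact_imp_closed finite_imp_compact_convex_hull)

lemma triangle_interior_Un_segments:
  fixes a b c :: complex
  shows "triangle a b c = interior (triangle a b c) \<union> (closed_segment a b \<union> closed_segment b c \<union> closed_segment c a)"
proof -
  have "triangle a b c = interior (triangle a b c) \<union> frontier (triangle a b c)"
    using closed_triangle[of a b c] interior_subset[of "triangle a b c"]
    by (auto simp: frontier_def closure_closed)
  then show ?thesis unfolding frontier_triangle .
qed

lemma interior_triangle_nonempty:
  assumes "cross a b c > 0"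
  shows "interior (triangle a b c) \<noteq> {}"
  using not_collinear_cross[OF assms] interior_convex_hull_3_minimal[of a b c]
proof -
  have "(1/3) *\<^sub>R a + (1/3) *\<^sub>R b + (1/3) *\<^sub>R c \<in> interior (triangle a b c)"
    using not_collinear_cross[OF assms] by (subst interior_convex_hull_3_minimal) (auto intro!: exI[of _ "1/3"])
  then show ?thesis by auto
qed

lemma closure_interior_triangle:
  assumes "cross a b c > 0"
  shows "closure (interior (triangle a b c)) = triangle a b c"
  using convex_closure_interior[OF convex_convex_hull interior_triangle_nonempty[OF assms]] closed_triangle
  by simp

lemma frontier_interior_triangle:
  assumes "cross a b c > 0"
  shows "frontier (interior (triangle a b c)) = closed_segment a b \<union> closed_segment b c \<union> closed_segment c a"
  unfolding frontier_triangle[symmetric]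
  by (simp add: frontier_def closure_interior_triangle[OF assms] closure_closed[OF closed_triangle])

lemma cross_closed_segment:
  assumes "z \<in> closed_segment a b"
  shows "cross a b z = 0"
proof -
  obtain u where u: "z = (1 - u) *\<^sub>R a + u *\<^sub>R b"
    using assms by (auto simp: in_segment)
  show ?thesis
    using cross_combination[of "1 - u" u 0 a b a b 0] by (simp add: u)
qed

lemma cross_open_segment:
  assumes D: "cross a b c > 0" and z: "z \<in> open_segment a b"
  shows "0 < cross b c z" "0 < cross c a z"
proof -
  obtain u where u: "0 < u" "u < 1" "z = (1 - u) *\<^sub>R a + u *\<^sub>R b"
    using z by (auto simp: in_segment)
  have "cross b c z = (1 - u) * cross b c a" "cross c a z = u * cross c a b"
    using cross_combination[of "1 - u" u 0 b c a b 0] cross_combination[of "1 - u" u 0 c a a b 0] u(3) by auto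
  then show "0 < cross b c z" "0 < cross c a z"
    using u D cross_rotate[of a b c] by simp_all
qed

text \<open>Strictly inside the side from \<open>a\<close> to \<open>b\<close> the other two side
  conditions hold strictly, hence in a whole disc, where only the sign of \<open>cross a b\<close>
  is left to decide.\<close>

lemma half_disc_subset_triangle:
  assumes D: "cross a b c > 0" and z: "z \<in> open_segment a b"
  obtains r where "r > 0" "\<And>w. w \<in> ball z r \<Longrightarrow> 0 \<le> cross a b w \<Longrightarrow> w \<in> triangle a b c"
    "\<And>w. w \<in> ball z r \<Longrightarrow> 0 < cross a b w \<Longrightarrow> w \<in> interior (triangle a b c)"
proof -
  have "open {w. 0 < cross b c w \<and> 0 < cross c a w}"
    by (intro open_Collect_conj open_Collect_less continuous_intros)
  then obtain r where r: "r > 0" "ball z r \<subseteq> {w. 0 < cross b c w \<and> 0 < cross c a w}"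
    using cross_open_segment[OF D z] by (metis (mono_tags, lifting) mem_Collect_eq open_contains_ball)
  show thesis
    using r D by (intro that[of r]) (auto simp: triangle_eq[OF D] interior_triangle[OF D, unfolded triangle_eq[OF D]] subset_iff less_imp_le)
qed

text \<open>The formula for the area of a triangle is available in \<open>real ^ 2\<close> only, so measures are
  taken there.\<close>

definition to_plane :: "complex \<Rightarrow> real ^ 2" where
  "to_plane z = vector [Re z, Im z]"

lemma linear_to_plane: "linear to_plane"
  by (rule linearI) (simp_all add: to_plane_def vec_eq_iff forall_2)

lemma surj_to_plane: "surj to_plane"
  by (rule surjI[of _ "\<lambda>v. Complex (v $ 1) (v $ 2)"]) (simp add: to_plane_def vec_eq_iff forall_2)

lemma measure_to_plane_triangle:
  assumes "cross a b c > 0"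
  shows "measure lebesgue (to_plane ` triangle a b c) = cross a b c / 2"
proof -
  have *: "to_plane ` triangle a b c = convex hull {to_plane a, to_plane b, to_plane c}"
    by (simp add: convex_hull_linear_image[OF linear_to_plane])
  have "measure lebesgue (to_plane ` triangle a b c) = measure lborel (convex hull {to_plane a, to_plane b, to_plane c})"
    unfolding * by (intro measure_completion) (simp add: compact_imp_closed finite_imp_compact_convex_hull borel_closed)
  also have "\<dots> = \<bar>cross a b c\<bar> / 2"
    unfolding content_triangle by (simp add: to_plane_def cross_def abs_minus_commute algebra_simps)
  finally have "measure lebesgue (to_plane ` triangle a b c) = \<bar>cross a b c\<bar> / 2" .
  with assms show ?thesis by simp
qed

lemma lmeasurable_to_plane_triangle: "to_plane ` triangle a b c \<in> lmeasurable"
proof -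
  have "compact (convex hull (to_plane ` {a, b, c}))"
    by (rule finite_imp_compact_convex_hull) simp
  then show ?thesis
    using lmeasurable_compact convex_hull_linear_image[OF linear_to_plane] by metis
qed

text \<open>Inclusion-exclusion for the one pair and subadditivity for the rest: an overlap of
  positive measure would push the sum strictly above the measure of the union.\<close>

lemma finite_cover_sum_measure_imp_null:
  assumes fin: "finite I" and m: "\<And>i. i \<in> I \<Longrightarrow> S i \<in> lmeasurable"
    and sum: "(\<Sum>i\<in>I. measure lebesgue (S i)) \<le> measure lebesgue (\<Union>i\<in>I. S i)"
    and ij: "i \<in> I" "j \<in> I" "i \<noteq> j"
  shows "measure lebesgue (S i \<inter> S j) = 0"
proof -
  let ?R = "\<Union>k\<in>I - {i, j}. S k"
  have R: "?R \<in> sets lebesgue" using m fin by (intro sets.finite_UN) (auto simp: fmeasurableD)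
  have "(\<Union>i\<in>I. S i) = (S i \<union> S j) \<union> ?R" using ij by auto
  then have "measure lebesgue (\<Union>i\<in>I. S i) \<le> measure lebesgue (S i \<union> S j) + measure lebesgue ?R"
    using measure_Un_le[OF _ R, of "S i \<union> S j"] m ij by (simp add: fmeasurableD)
  also have "measure lebesgue (S i \<union> S j) = measure lebesgue (S i) + measure lebesgue (S j) - measure lebesgue (S i \<inter> S j)"
    using m ij by (intro measure_Un3) auto
  also have "measure lebesgue ?R \<le> (\<Sum>k\<in>I - {i, j}. measure lebesgue (S k))"
    using m fin by (intro measure_UNION_le) (auto simp: fmeasurableD)
  finally have "measure lebesgue (\<Union>i\<in>I. S i) + measure lebesgue (S i \<inter> S j)
      \<le> measure lebesgue (S i) + measure lebesgue (S j) + (\<Sum>k\<in>I - {i, j}. measure lebesgue (S k))"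
    by simp
  also have "\<dots> = (\<Sum>k\<in>I. measure lebesgue (S k))"
    using sum.subset_diff[of "{i, j}" I "\<lambda>k. measure lebesgue (S k)"] fin ij by simp
  finally have "measure lebesgue (S i \<inter> S j) \<le> 0" using sum by linarith
  then show ?thesis by (simp add: measure_le_0_iff)
qed


section \<open>Tilings certified by orientation, matching sides and area\<close>

definition sides :: "'v \<times> 'v \<times> 'v \<Rightarrow> ('v \<times> 'v) set" where
  "sides t = (case t of (a, b, c) \<Rightarrow> {(a, b), (b, c), (c, a)})"

text \<open>\<open>twin\<close> lets every inner side be flanked by triangles on both of its sides,
  which forces a covering of the outer triangle; \<open>area\<close> then leaves no room for
  overlaps. All conditions are finite checks on integers once coordinates are given.\<close>

locale straight_triangulation =
  fixes P :: "'v \<Rightarrow> complex" and T :: "('v \<times> 'v \<times> 'v) set" and A B C :: 'v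
  assumes finite_T: "finite T"
    and positive: "(a, b, c) \<in> T \<Longrightarrow> cross (P a) (P b) (P c) > 0"
    and outer_positive: "cross (P A) (P B) (P C) > 0"
    and twin: "(a, b) \<in> \<Union> (sides ` T) \<Longrightarrow> (b, a) \<in> \<Union> (sides ` T) \<or> (a, b) \<in> sides (A, B, C)"
    and outer_sides: "sides (A, B, C) \<subseteq> \<Union> (sides ` T)"
    and area: "(\<Sum>(a, b, c)\<in>T. cross (P a) (P b) (P c)) \<le> cross (P A) (P B) (P C)"
    and inj_P: "inj_on P (fst ` \<Union> (sides ` T))"
begin

definition K :: "'v \<times> 'v \<times> 'v \<Rightarrow> complex set" where
  "K t = (case t of (a, b, c) \<Rightarrow> triangle (P a) (P b) (P c))"

abbreviation "Out \<equiv> K (A, B, C)"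
abbreviation "DS \<equiv> \<Union> (sides ` T)"
abbreviation "VS \<equiv> fst ` DS"

lemma K_simp [simp]: "K (a, b, c) = triangle (P a) (P b) (P c)"
  by (simp add: K_def)

lemma closed_K: "closed (K t)"
  by (cases t) (simp add: closed_triangle)

text \<open>Rotates a triple so that a given side comes first; later arguments then treat one side
  instead of three, for inner triangles and the outer one alike.\<close>

lemma third_vertex:
  assumes "(a, b) \<in> sides t" "t \<in> insert (A, B, C) T"
  obtains c where "cross (P a) (P b) (P c) > 0" "K t = triangle (P a) (P b) (P c)"
    "sides t = {(a, b), (b, c), (c, a)}"
    "frontier (K t) = closed_segment (P a) (P b) \<union> closed_segment (P b) (P c) \<union> closed_segment (P c) (P a)"
proof -
  obtain x y z where t: "t = (x, y, z)" by (cases t)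
  have pos: "cross (P x) (P y) (P z) > 0" using assms(2) positive outer_positive t by auto
  have K: "K t = triangle (P x) (P y) (P z)" by (simp add: t)
  have rot: "triangle (P x) (P y) (P z) = triangle (P y) (P z) (P x)" "triangle (P x) (P y) (P z) = triangle (P z) (P x) (P y)"
    by (metis insert_commute)+
  have pos': "cross (P y) (P z) (P x) > 0" "cross (P z) (P x) (P y) > 0"
    using pos cross_rotate[of "P x" "P y" "P z"] by simp_all
  from assms(1) consider "a = x" "b = y" | "a = y" "b = z" | "a = z" "b = x" by (auto simp: sides_def t)
  then show thesis
  proof cases
    case 1 show ?thesis by (rule that[of z]) (use pos K in \<open>simp_all only: 1 frontier_triangle, simp add: t sides_def\<close>)
  next
    case 2 show ?thesis by (rule that[of x]) (use pos' K[unfolded rot(1)] in \<open>simp_all only: 2 frontier_triangle, simp add: t sides_def insert_commute\<close>)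
  next
    case 3 show ?thesis by (rule that[of y]) (use pos' K[unfolded rot(2)] in \<open>simp_all only: 3 frontier_triangle, simp add: t sides_def insert_commute\<close>)
  qed
qed

lemma finite_VS: "finite VS"
  using finite_T by (auto simp: sides_def split: prod.splits)

lemma fst_in_VS: "(a, b) \<in> DS \<Longrightarrow> a \<in> VS"
  by (metis fst_conv imageI)

lemma snd_in_VS: "(a, b) \<in> DS \<Longrightarrow> b \<in> VS"
  by (force simp: sides_def)

lemma ends_in_VS: "(a, b) \<in> DS \<Longrightarrow> u \<in> {a, b} \<Longrightarrow> u \<in> VS"
  using fst_in_VS snd_in_VS by (metis insertE singletonD)

lemma VS_side: "v \<in> VS \<Longrightarrow> \<exists>w. (v, w) \<in> DS"
  by (metis imageE prod.collapse)

lemma K_frontier_point: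
  assumes "t \<in> T" "z \<in> K t" "z \<notin> interior (K t)"
  obtains a b where "(a, b) \<in> sides t" "z \<in> closed_segment (P a) (P b)"
proof -
  obtain a b c where t: "t = (a, b, c)" by (cases t)
  have "z \<in> closed_segment (P a) (P b) \<union> closed_segment (P b) (P c) \<union> closed_segment (P c) (P a)"
    using assms triangle_interior_Un_segments[of "P a" "P b" "P c"] by (auto simp: t)
  then show thesis using that by (auto simp: t sides_def)
qed

lemma interior_K_nonempty: "t \<in> T \<Longrightarrow> interior (K t) \<noteq> {}"
  by (cases t) (simp add: interior_triangle_nonempty positive)

lemma closure_interior_K: "t \<in> insert (A, B, C) T \<Longrightarrow> closure (interior (K t)) = K t"
  by (cases t) (auto simp: closure_interior_triangle positive outer_positive)

lemma side_half_disc: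
  assumes "(a, b) \<in> sides t" "t \<in> insert (A, B, C) T" "z \<in> open_segment (P a) (P b)"
  obtains r where "r > 0" "\<And>w. w \<in> ball z r \<Longrightarrow> 0 \<le> cross (P a) (P b) w \<Longrightarrow> w \<in> K t"
    "\<And>w. w \<in> ball z r \<Longrightarrow> 0 < cross (P a) (P b) w \<Longrightarrow> w \<in> interior (K t)"
proof -
  obtain c where c: "cross (P a) (P b) (P c) > 0" "K t = triangle (P a) (P b) (P c)"
    using third_vertex[OF assms(1,2)] by metis
  show thesis
    by (rule half_disc_subset_triangle[OF c(1) assms(3)]) (metis that c(2))
qed

text \<open>The triangles at a side and at its converse each contain a half disc, and the two half
  discs lie on opposite sides of the common line.\<close>

lemma inner_side_disc:
  assumes ab: "(a, b) \<in> DS" and z: "z \<in> open_segment (P a) (P b)" and out: "(a, b) \<notin> sides (A, B, C)"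
  obtains r t t' where "r > 0" "t \<in> T" "t' \<in> T" "(a, b) \<in> sides t" "(b, a) \<in> sides t'" "ball z r \<subseteq> K t \<union> K t'"
proof -
  obtain t where t: "t \<in> T" "(a, b) \<in> sides t" using ab by auto
  obtain t' where t': "t' \<in> T" "(b, a) \<in> sides t'" using twin[OF ab] out by auto
  obtain r where r: "r > 0" "\<And>w. w \<in> ball z r \<Longrightarrow> 0 \<le> cross (P a) (P b) w \<Longrightarrow> w \<in> K t"
    using side_half_disc[OF t(2) _ z] t(1) by (metis insertI2)
  have z': "z \<in> open_segment (P b) (P a)" using z by (simp add: open_segment_commute)
  obtain r' where r': "r' > 0" "\<And>w. w \<in> ball z r' \<Longrightarrow> 0 \<le> cross (P b) (P a) w \<Longrightarrow> w \<in> K t'"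
    using side_half_disc[OF t'(2) _ z'] t'(1) by (metis insertI2)
  have "ball z (min r r') \<subseteq> K t \<union> K t'"
  proof
    fix w assume "w \<in> ball z (min r r')"
    then have "w \<in> ball z r" "w \<in> ball z r'" by auto
    then show "w \<in> K t \<union> K t'"
      using r(2)[of w] r'(2)[of w] cross_swap[of "P b" "P a" w] by fastforce
  qed
  then show thesis using that[of "min r r'" t t'] r r' t t' by auto
qed

lemma open_segment_outer_not_interior:
  assumes "(a, b) \<in> sides (A, B, C)" "z \<in> closed_segment (P a) (P b)"
  shows "z \<notin> interior Out"
proof -
  obtain c where "frontier Out = closed_segment (P a) (P b) \<union> closed_segment (P b) (P c) \<union> closed_segment (P c) (P a)"
    using third_vertex[OF assms(1)] by (metis insertI1)
  then show ?thesis using assms(2) by (auto simp: frontier_def)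
qed

lemma side_not_interior:
  assumes "(a, b) \<in> sides t" "t \<in> T" "z \<in> closed_segment (P a) (P b)"
  shows "z \<notin> interior (K t)"
proof -
  obtain c where "frontier (K t) = closed_segment (P a) (P b) \<union> closed_segment (P b) (P c) \<union> closed_segment (P c) (P a)"
    using third_vertex[OF assms(1)] assms(2) by (metis insertI2)
  then show ?thesis using assms(3) by (auto simp: frontier_def)
qed

text \<open>Removing the finitely many vertices keeps the interior of the outer triangle connected, and
  what remains meets the union of the inner triangles in an open and closed set.\<close>

lemma outer_subset_Union: "Out \<subseteq> \<Union> (K ` T)"
proof -
  let ?U = "\<Union> (K ` T)"
  let ?X = "interior Out - P ` VS"
  have closedU: "closed ?U" using finite_T closed_K by auto
  have conv: "convex (interior Out)" by (simp add: convex_interior)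
  have con: "connected ?X"
    by (intro connected_open_delete_finite) (use conv finite_VS in \<open>auto intro: convex_connected\<close>)
  have sub: "?X \<subseteq> interior ?U \<union> - ?U"
  proof
    fix z assume z: "z \<in> ?X"
    show "z \<in> interior ?U \<union> - ?U"
    proof (cases "z \<in> ?U")
      case True
      then obtain t where t: "t \<in> T" "z \<in> K t" by auto
      show ?thesis
      proof (cases "z \<in> interior (K t)")
        case True
        then show ?thesis using t interior_mono[of "K t" ?U] by auto
      next
        case False
        then obtain a b where ab: "(a, b) \<in> sides t" "z \<in> closed_segment (P a) (P b)"
          using K_frontier_point[OF t] by metis
        have abD: "(a, b) \<in> DS" using ab t by auto
        have "a \<in> VS" "b \<in> VS" using fst_in_VS[OF abD] snd_in_VS[OF abD] .
        then have "z \<in> open_segment (P a) (P b)" using ab(2) z by (auto simp: open_segment_def)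
        moreover have "(a, b) \<notin> sides (A, B, C)"
          using open_segment_outer_not_interior ab(2) z by blast
        ultimately obtain r t t' where "r > 0" "t \<in> T" "t' \<in> T" "ball z r \<subseteq> K t \<union> K t'"
          using inner_side_disc[OF abD] by metis
        then have "ball z r \<subseteq> ?U" by auto
        then show ?thesis using \<open>r > 0\<close> by (auto simp: mem_interior)
      qed
    qed auto
  qed
  \<comment> \<open>Near an inner point of the outer side from \<open>A\<close> to \<open>B\<close>,
    the outer triangle and the inner triangle on that side fill the same half disc. The overlap is
    open, hence infinite, and so is not exhausted by the removed vertices.\<close>
  have nonempty: "?X \<inter> interior ?U \<noteq> {}"
  proof -
    have AB: "(A, B) \<in> sides (A, B, C)" by (simp add: sides_def)
    then obtain t where t: "t \<in> T" "(A, B) \<in> sides t" using outer_sides by auto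
    obtain z where z: "z \<in> open_segment (P A) (P B)"
      using outer_positive by (metis all_not_in_conv cross_degenerate(3) less_irrefl open_segment_eq_empty)
    obtain r where r: "r > 0" "\<And>w. w \<in> ball z r \<Longrightarrow> 0 < cross (P A) (P B) w \<Longrightarrow> w \<in> interior (K t)"
      using side_half_disc[OF t(2) _ z] t(1) by (metis insertI2)
    obtain r' where r': "r' > 0" "\<And>w. w \<in> ball z r' \<Longrightarrow> 0 < cross (P A) (P B) w \<Longrightarrow> w \<in> interior Out"
      using side_half_disc[OF AB _ z] by (metis insertI1)
    have "z \<in> closure (interior Out)"
      using open_closed_segment[OF z] triangle_interior_Un_segments[of "P A" "P B" "P C"]
      by (auto simp: closure_interior_triangle[OF outer_positive])
    then have ne: "ball z (min r r') \<inter> interior Out \<noteq> {}"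
      using r(1) r'(1) by (metis centre_in_ball disjoint_iff closure_iff_nhds_not_empty min_less_iff_conj open_ball subset_refl)
    let ?Y = "ball z (min r r') \<inter> interior Out"
    have pos: "0 < cross (P A) (P B) w" if "w \<in> interior Out" for w
      using that interior_triangle[OF outer_positive] by simp
    have Y: "?Y \<subseteq> interior (K t)" using r(2) pos by auto
    have "open ?Y" by auto
    with ne have "infinite ?Y" using finite_imp_not_open by blast
    then have "\<not> ?Y \<subseteq> P ` VS" using finite_VS finite_subset by blast
    then show ?thesis using Y t(1) interior_mono[of "K t" ?U] by blast
  qed
  have "interior ?U \<inter> ?X = {} \<or> (- ?U) \<inter> ?X = {}"
  proof (rule connectedD[OF con _ _ _ sub])
    show "open (- ?U)" by (rule open_Compl[OF closedU])
    show "interior ?U \<inter> - ?U \<inter> ?X = {}" using interior_subset[of ?U] by blast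
  qed auto
  then have "?X \<subseteq> ?U"
    using nonempty unfolding Int_commute[of _ ?X] by (metis disjoint_eq_subset_Compl double_complement)
  moreover have "P ` VS \<subseteq> ?U"
  proof
    fix z assume "z \<in> P ` VS"
    then obtain t a b where "t \<in> T" "(a, b) \<in> sides t" "z = P a" by force
    then show "z \<in> ?U" by (cases t) (auto simp: sides_def intro!: bexI[of _ t] hull_inc)
  qed
  ultimately have "interior Out \<subseteq> ?U" by (meson DiffI subset_iff)
  then show ?thesis using closure_minimal[OF _ closedU] closure_interior_K[of "(A, B, C)"] by blast
qed

lemma lmeasurable_K: "to_plane ` K t \<in> lmeasurable"
  by (cases t) (simp add: lmeasurable_to_plane_triangle)

lemma image_outer_subset: "to_plane ` Out \<subseteq> (\<Union>t\<in>T. to_plane ` K t)"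
  using image_mono[OF outer_subset_Union, of to_plane] by (simp only: image_Union image_image)

lemma sum_measure_K: "(\<Sum>t\<in>T. measure lebesgue (to_plane ` K t)) \<le> measure lebesgue (to_plane ` Out)"
proof -
  have val: "measure lebesgue (to_plane ` K t) = (case t of (a, b, c) \<Rightarrow> cross (P a) (P b) (P c)) / 2" if "t \<in> T" for t
    using that by (cases t) (simp add: measure_to_plane_triangle positive)
  have "(\<Sum>t\<in>T. measure lebesgue (to_plane ` K t)) = (\<Sum>t\<in>T. (case t of (a, b, c) \<Rightarrow> cross (P a) (P b) (P c)) / 2)"
    by (intro sum.cong) (simp_all add: val)
  then show ?thesis
    using area by (simp add: measure_to_plane_triangle[OF outer_positive] flip: sum_divide_distrib)
qed

lemma open_null_empty:
  assumes "open G" "G \<subseteq> H" "to_plane ` H \<in> lmeasurable" "measure lebesgue (to_plane ` H) = 0"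
  shows "G = {}"
proof (rule ccontr)
  assume "G \<noteq> {}"
  have "open (to_plane ` G)"
    using assms(1) by (intro open_surjective_linear_image linear_to_plane surj_to_plane)
  moreover have "negligible (to_plane ` G)"
    by (rule negligible_subset[OF _ image_mono[OF assms(2)]]) (simp add: negligible_iff_measure assms(3,4))
  ultimately show False using open_not_negligible[of "to_plane ` G"] \<open>G \<noteq> {}\<close> by blast
qed

lemma inj_to_plane: "inj to_plane"
  by (rule injI) (simp add: to_plane_def vec_eq_iff forall_2 complex_eq_iff)

text \<open>The area of the outer triangle is squeezed: it is at most the area of the union by
  covering, and at least the sum of the areas by the certificate. Overlaps are therefore null sets,
  and a nonempty open set is not null.\<close>

lemma disjoint_interiors:
  assumes "t \<in> T" "t' \<in> T" "t \<noteq> t'"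
  shows "interior (K t) \<inter> interior (K t') = {}"
proof -
  have "measure lebesgue (to_plane ` Out) \<le> measure lebesgue (\<Union>t\<in>T. to_plane ` K t)"
    using image_outer_subset finite_T lmeasurable_K
    by (intro measure_mono_fmeasurable fmeasurable.finite_UN) (auto simp: fmeasurableD intro: lmeasurable_to_plane_triangle)
  then have "(\<Sum>t\<in>T. measure lebesgue (to_plane ` K t)) \<le> measure lebesgue (\<Union>t\<in>T. to_plane ` K t)"
    by (rule order_trans[OF sum_measure_K])
  then have null: "measure lebesgue (to_plane ` K t \<inter> to_plane ` K t') = 0"
    by (rule finite_cover_sum_measure_imp_null[OF finite_T lmeasurable_K _ assms])
  show ?thesis
  proof (rule open_null_empty)
    show "interior (K t) \<inter> interior (K t') \<subseteq> K t \<inter> K t'" using interior_subset by blast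
    have "to_plane ` (K t \<inter> K t') = to_plane ` K t \<inter> to_plane ` K t'"
      by (rule image_Int[OF inj_to_plane])
    then show "to_plane ` (K t \<inter> K t') \<in> lmeasurable" "measure lebesgue (to_plane ` (K t \<inter> K t')) = 0"
      using null fmeasurable.Int[OF lmeasurable_K lmeasurable_K] by simp_all
  qed auto
qed

text \<open>The union covers the outer triangle and has no larger area, so the part sticking out is
  null; its open part is empty, and a triangle is the closure of its interior.\<close>

lemma K_subset_outer:
  assumes "t \<in> T"
  shows "K t \<subseteq> Out"
proof -
  let ?U = "\<Union>t\<in>T. to_plane ` K t"
  have U: "?U \<in> lmeasurable" using finite_T lmeasurable_K by (intro fmeasurable.finite_UN) auto
  have sub: "to_plane ` Out \<subseteq> ?U" by (rule image_outer_subset)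
  have "measure lebesgue ?U \<le> (\<Sum>t\<in>T. measure lebesgue (to_plane ` K t))"
    using finite_T lmeasurable_K by (intro measure_UNION_le) (auto simp: fmeasurableD)
  then have "measure lebesgue (?U - to_plane ` Out) \<le> 0"
    using measurable_measure_Diff[OF U _ sub] lmeasurable_K[of "(A, B, C)"] sum_measure_K
    by (simp add: fmeasurableD)
  then have null: "measure lebesgue (?U - to_plane ` Out) = 0" by (simp add: measure_le_0_iff)
  have "interior (K t) - Out = {}"
  proof (rule open_null_empty)
    show "open (interior (K t) - Out)" using closed_K by (intro open_Diff) auto
    show "interior (K t) - Out \<subseteq> (\<Union>(K ` T)) - Out" using interior_subset[of "K t"] assms by blast
    have "to_plane ` ((\<Union>(K ` T)) - Out) = ?U - to_plane ` Out"
      by (simp add: image_set_diff[OF inj_to_plane] image_Union image_image)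
    then show "to_plane ` ((\<Union>(K ` T)) - Out) \<in> lmeasurable" "measure lebesgue (to_plane ` ((\<Union>(K ` T)) - Out)) = 0"
      using null fmeasurable.Diff[OF U lmeasurable_K[of "(A, B, C)"]] by (simp_all only:)
  qed
  then have "closure (interior (K t)) \<subseteq> Out" by (intro closure_minimal closed_K) blast
  then show ?thesis using closure_interior_K assms by auto
qed

lemma ends_distinct:
  assumes "(a, b) \<in> DS"
  shows "P a \<noteq> P b" "a \<noteq> b"
proof -
  obtain t where "t \<in> T" "(a, b) \<in> sides t" using assms by auto
  then obtain c where "cross (P a) (P b) (P c) > 0" using third_vertex by (metis insertI2)
  then show "P a \<noteq> P b" "a \<noteq> b" by auto
qed

definition skeleton :: "complex set" where
  "skeleton = (\<Union>(a, b)\<in>DS. closed_segment (P a) (P b))"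

lemma in_skeleton:
  "(a, b) \<in> sides t \<Longrightarrow> t \<in> T \<Longrightarrow> z \<in> closed_segment (P a) (P b) \<Longrightarrow> z \<in> skeleton"
  by (auto simp: skeleton_def)

lemma side_subset_K:
  assumes "(a, b) \<in> sides t"
  shows "closed_segment (P a) (P b) \<subseteq> K t"
proof -
  obtain x y z where t: "t = (x, y, z)" by (cases t)
  have "P a \<in> K t" "P b \<in> K t" using assms by (auto simp: t sides_def intro: hull_inc)
  then show ?thesis unfolding t K_simp by (intro closed_segment_subset) auto
qed

text \<open>A point on a side is a limit of interior points of the triangle with that side; inside
  another triangle it would make two interiors meet.\<close>

lemma skeleton_disjoint_interior:
  assumes "t \<in> T"
  shows "skeleton \<inter> interior (K t) = {}"
proof (rule ccontr)
  assume "skeleton \<inter> interior (K t) \<noteq> {}"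
  then obtain z a b where z: "(a, b) \<in> DS" "z \<in> closed_segment (P a) (P b)" "z \<in> interior (K t)"
    by (auto simp: skeleton_def)
  then obtain t' where t': "t' \<in> T" "(a, b) \<in> sides t'" by auto
  have "t' \<noteq> t" using side_not_interior[OF t'(2,1)] z by blast
  have "z \<in> closure (interior (K t'))"
    using side_subset_K[OF t'(2)] z closure_interior_K[of t'] t'(1) by auto
  then have "interior (K t) \<inter> interior (K t') \<noteq> {}"
    using z(3) open_interior by (metis closure_iff_nhds_not_empty subset_refl inf_commute)
  then show False using disjoint_interiors[OF assms t'(1)] \<open>t' \<noteq> t\<close> by blast
qed

lemma skeleton_subset_outer: "skeleton \<subseteq> Out"
  unfolding skeleton_def using side_subset_K K_subset_outer by blast

lemma outer_eq: "Out = \<Union> ((\<lambda>t. interior (K t)) ` T) \<union> skeleton"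
proof
  show "Out \<subseteq> \<Union> ((\<lambda>t. interior (K t)) ` T) \<union> skeleton"
  proof
    fix z assume "z \<in> Out"
    then obtain t where t: "t \<in> T" "z \<in> K t" using outer_subset_Union by auto
    then show "z \<in> \<Union> ((\<lambda>t. interior (K t)) ` T) \<union> skeleton"
      using K_frontier_point[OF t] in_skeleton[OF _ t(1)] by (metis UN_I Un_iff)
  qed
  show "\<Union> ((\<lambda>t. interior (K t)) ` T) \<union> skeleton \<subseteq> Out"
    using skeleton_subset_outer K_subset_outer interior_subset by blast
qed

lemma components_skeleton: "components (- skeleton) = insert (- Out) ((\<lambda>t. interior (K t)) ` T)"
proof (rule components_open_unique)
  have *: "- U \<union> I = - S" if "U = I \<union> S" "I \<inter> S = {}" for U I S :: "complex set" using that by blast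
  have "\<Union> ((\<lambda>t. interior (K t)) ` T) \<inter> skeleton = {}"
    unfolding Int_commute[of _ skeleton] Int_UN_distrib by (simp add: skeleton_disjoint_interior)
  then show "\<Union> (insert (- Out) ((\<lambda>t. interior (K t)) ` T)) = - skeleton"
    using *[OF outer_eq] by (simp only: Union_insert)
  have sub: "interior (K t) \<subseteq> Out" if "t \<in> T" for t
    using K_subset_outer[OF that] interior_subset[of "K t"] by (rule subset_trans[rotated])
  show "disjoint (insert (- Out) ((\<lambda>t. interior (K t)) ` T))"
    unfolding pairwise_insert
  proof (intro conjI allI impI)
    show "disjoint ((\<lambda>t. interior (K t)) ` T)"
    proof (rule pairwiseI)
      fix X Y assume "X \<in> (\<lambda>t. interior (K t)) ` T" "Y \<in> (\<lambda>t. interior (K t)) ` T" "X \<noteq> Y"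
      then obtain t t' where "t \<in> T" "t' \<in> T" "X = interior (K t)" "Y = interior (K t')" "t \<noteq> t'" by blast
      then show "disjnt X Y" using disjoint_interiors[of t t'] by (simp add: disjnt_def)
    qed
    fix Y assume "Y \<in> (\<lambda>t. interior (K t)) ` T \<and> Y \<noteq> - Out"
    then obtain t where "t \<in> T" "Y = interior (K t)" by blast
    then have "Y \<subseteq> Out" using sub[of t] by simp
    then have "Y \<inter> - Out = {}" by (simp only: disjoint_eq_subset_Compl double_compl)
    then show "disjnt (- Out) Y" "disjnt Y (- Out)" by (simp_all only: disjnt_def Int_commute[of "- Out"])
  qed
  fix X assume "X \<in> insert (- Out) ((\<lambda>t. interior (K t)) ` T)"
  then consider "X = - Out" | t where "t \<in> T" "X = interior (K t)" by auto
  then show "open X \<and> connected X \<and> X \<noteq> {}"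
  proof cases
    case 1
    have b: "bounded Out" by (simp add: bounded_convex_hull)
    then have "connected (- Out)" by (intro connected_complement_bounded_convex) auto
    moreover have "- Out \<noteq> {}" using b not_bounded_UNIV by (metis Compl_empty_eq double_complement)
    ultimately show ?thesis using 1 closed_K[of "(A, B, C)"] by (simp add: open_Compl)
  next
    case 2
    have "convex (K t)" by (cases t) simp
    then show ?thesis using 2 interior_K_nonempty by (simp add: convex_connected convex_interior)
  qed
qed

text \<open>Two triangles cover a neighbourhood of an inner point of a side, so every segment through
  that point is a side of one of them.\<close>

lemma sides_cross_only_in_ends:
  assumes ab: "(a, b) \<in> DS" and cd: "(c, d) \<in> DS"
    and z: "z \<in> open_segment (P a) (P b)" "z \<in> closed_segment (P c) (P d)"
  shows "{a, b} = {c, d}"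
proof -
  obtain t where t: "t \<in> T" "(c, d) \<in> sides t" using cd by auto
  have zt: "z \<in> closure (interior (K t))"
    using side_subset_K[OF t(2)] z closure_interior_K[of t] t(1) by auto
  obtain s x y where s: "s \<in> T" "(x, y) \<in> sides s" "{x, y} = {a, b}" and st: "s = t"
  proof -
    \<comment> \<open>\<open>N\<close> holds the one or two triangles on the side from
      \<open>a\<close> to \<open>b\<close> that cover a neighbourhood of \<open>z\<close> within the
      outer triangle.\<close>
    obtain r N where r: "r > 0" "N \<subseteq> T" "finite N" and N: "\<And>s. s \<in> N \<Longrightarrow> \<exists>x y. (x, y) \<in> sides s \<and> {x, y} = {a, b}"
      and sub: "ball z r \<inter> Out \<subseteq> \<Union> (K ` N)"
    proof (cases "(a, b) \<in> sides (A, B, C)")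
      case False
      obtain r t1 t2 where *: "r > 0" "t1 \<in> T" "t2 \<in> T" "(a, b) \<in> sides t1" "(b, a) \<in> sides t2" "ball z r \<subseteq> K t1 \<union> K t2"
        using inner_side_disc[OF ab z(1) False] by metis
      show ?thesis by (rule that[of r "{t1, t2}"]) (use * in auto)
    next
      case True
      obtain t1 where t1: "t1 \<in> T" "(a, b) \<in> sides t1" using ab by auto
      obtain r where r: "r > 0" "\<And>w. w \<in> ball z r \<Longrightarrow> 0 \<le> cross (P a) (P b) w \<Longrightarrow> w \<in> K t1"
        using side_half_disc[OF t1(2) _ z(1)] t1(1) by (metis insertI2)
      obtain e where e: "cross (P a) (P b) (P e) > 0" "Out = triangle (P a) (P b) (P e)"
        using third_vertex[OF True] by (metis insertI1)
      then have "0 \<le> cross (P a) (P b) w" if "w \<in> Out" for w using that triangle_eq[OF e(1)] by auto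
      then show ?thesis by (intro that[of r "{t1}"]) (use r t1 in auto)
    qed
    let ?G = "ball z r \<inter> interior (K t)"
    have G: "open ?G" "?G \<noteq> {}"
      using zt r(1) by (auto simp: closure_iff_nhds_not_empty) (metis centre_in_ball disjoint_iff open_ball subset_refl)
    have "?G \<subseteq> \<Union> (K ` N)" using sub K_subset_outer[OF t(1)] interior_subset by blast
    \<comment> \<open>An open set that misses the interiors of these triangles also misses their
      closures, so it could not be covered by them.\<close>
    have "\<exists>s\<in>N. ?G \<inter> interior (K s) \<noteq> {}"
    proof (rule ccontr)
      assume "\<not> (\<exists>s\<in>N. ?G \<inter> interior (K s) \<noteq> {})"
      then have "?G \<inter> closure (interior (K s)) = {}" if "s \<in> N" for s
        using that G(1) open_Int_closure_eq_empty by blast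
      moreover have "closure (interior (K s)) = K s" if "s \<in> N" for s using that closure_interior_K r(2) by blast
      ultimately have "?G \<inter> K s = {}" if "s \<in> N" for s using that by metis
      then show False using \<open>?G \<subseteq> \<Union> (K ` N)\<close> G(2) by blast
    qed
    then obtain s where "s \<in> N" "interior (K t) \<inter> interior (K s) \<noteq> {}" by blast
    then have "s \<in> N" "s = t" using disjoint_interiors[OF t(1), of s] r(2) by blast+
    then show ?thesis using that N r(2) by blast
  qed
  obtain e where e: "cross (P x) (P y) (P e) > 0" "sides t = {(x, y), (y, e), (e, x)}"
    using third_vertex[OF s(2)] s(1) st by (metis insertI2)
  have zxy: "z \<in> open_segment (P x) (P y)"
    using z(1) s(3) by (auto simp: doubleton_eq_iff open_segment_commute)
  \<comment> \<open>\<open>z\<close> is strictly on the positive side of the other two sides of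
    \<open>t\<close>, whereas \<open>cross\<close> vanishes along the side from \<open>c\<close> to
    \<open>d\<close>.\<close>
  have "(c, d) = (x, y)"
    using t(2) e(2) cross_open_segment[OF e(1) zxy] cross_closed_segment[OF z(2)] by auto
  then show ?thesis using s(3) by simp
qed

text \<open>Edges are unordered but \<open>linepath\<close> needs a direction; either choice has the
  same image and the same pair of ends.\<close>

definition drawn_edge :: "'v set \<Rightarrow> real \<Rightarrow> complex" where
  "drawn_edge e = (let (a, b) = SOME (a, b). e = {a, b} in linepath (P a) (P b))"

lemma drawn_edge:
  obtains x y where "{a, b} = {x, y}" "drawn_edge {a, b} = linepath (P x) (P y)"
proof -
  obtain x y where xy: "(SOME (x, y). {a, b} = {x, y}) = (x, y)" by (metis surj_pair)
  moreover have "case SOME (x, y). {a, b} = {x, y} of (x, y) \<Rightarrow> {a, b} = {x, y}"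
    by (rule someI_ex) auto
  ultimately have "{a, b} = {x, y}" by simp
  moreover have "drawn_edge {a, b} = linepath (P x) (P y)" by (simp add: drawn_edge_def xy)
  ultimately show thesis by (rule that)
qed

lemma path_image_drawn_edge: "path_image (drawn_edge {a, b}) = closed_segment (P a) (P b)"
  by (rule drawn_edge[of a b]) (auto simp: doubleton_eq_iff closed_segment_commute)

lemma common_point:
  assumes ab: "(a, b) \<in> DS" and cd: "(c, d) \<in> DS" and ne: "{a, b} \<noteq> {c, d}"
    and z: "z \<in> closed_segment (P a) (P b)" "z \<in> closed_segment (P c) (P d)"
  shows "z \<in> P ` ({a, b} \<inter> {c, d})"
proof -
  have "z \<notin> open_segment (P a) (P b)" using sides_cross_only_in_ends[OF ab cd] z ne by blast
  moreover have "z \<notin> open_segment (P c) (P d)" using sides_cross_only_in_ends[OF cd ab] z ne by blast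
  ultimately have "z \<in> {P a, P b}" "z \<in> {P c, P d}" using z unfolding open_segment_def by blast+
  then obtain u v where uv: "u \<in> {a, b}" "v \<in> {c, d}" "z = P u" "z = P v" by blast
  moreover have "u \<in> VS" "v \<in> VS" using ends_in_VS[OF ab uv(1)] ends_in_VS[OF cd uv(2)] .
  ultimately have "u = v" using inj_P by (metis inj_onD)
  then show ?thesis using uv by auto
qed

theorem plane_triangulation_straight:
  assumes V: "verts G = VS" and E: "edges G = (\<lambda>(a, b). {a, b}) ` DS"
  shows "plane_triangulation G P drawn_edge"
  unfolding plane_triangulation_def
proof (intro conjI ballI)
  show "simple_graph G"
    unfolding simple_graph_def V E
  proof (intro conjI ballI finite_VS)
    fix e assume "e \<in> (\<lambda>(a, b). {a, b}) ` DS"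
    then obtain p where p: "e = (\<lambda>(a, b). {a, b}) p" "p \<in> DS" by (rule imageE)
    obtain a b where "p = (a, b)" by (cases p)
    with p have "e = {a, b}" "(a, b) \<in> DS" by (simp_all del: UN_iff)
    then show "e \<subseteq> VS" "card e = 2" using fst_in_VS[of a b] snd_in_VS[of a b] ends_distinct(2)[of a b]
      by (simp_all del: UN_iff)
  qed
  have ex: "\<exists>a b. e = {a, b} \<and> (a, b) \<in> DS" if "e \<in> edges G" for e using that by (auto simp: E)
  show "plane_embedding G P drawn_edge"
    unfolding plane_embedding_def
  proof (intro conjI ballI impI)
    show "inj_on P (verts G)" using inj_P V by simp
  next
    fix e assume "e \<in> edges G"
    then obtain a b where ab: "e = {a, b}" "(a, b) \<in> DS" using ex by blast
    obtain x y where xy: "{a, b} = {x, y}" "drawn_edge {a, b} = linepath (P x) (P y)" by (rule drawn_edge)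
    have "P x \<noteq> P y" using ends_distinct(1)[OF ab(2)] xy(1) by (auto simp: doubleton_eq_iff)
    then show "arc (drawn_edge e)" using ab xy by (simp add: arc_linepath)
    show "{pathstart (drawn_edge e), pathfinish (drawn_edge e)} = P ` e" using ab xy by simp
  next
    fix e v assume "e \<in> edges G" "v \<in> verts G" "P v \<in> path_image (drawn_edge e)"
    then obtain a b where ab: "e = {a, b}" "(a, b) \<in> DS" "P v \<in> closed_segment (P a) (P b)"
      using ex path_image_drawn_edge by metis
    \<comment> \<open>Every vertex is an end of some side, so a vertex lying on a foreign edge is a
      special case of two edges meeting.\<close>
    obtain w where w: "(v, w) \<in> DS" using \<open>v \<in> verts G\<close> V VS_side by blast
    show "v \<in> e"
    proof (rule ccontr)
      assume v: "v \<notin> e"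
      then have "P v \<in> P ` ({a, b} \<inter> {v, w})"
        using common_point[OF ab(2) w _ ab(3)] ab(1) by auto
      then obtain u where "u \<in> {a, b}" "P v = P u" by auto
      moreover have "u \<in> VS" using ends_in_VS[OF ab(2) \<open>u \<in> {a, b}\<close>] .
      ultimately have "v = u" using inj_P fst_in_VS[OF w] by (metis inj_onD)
      then show False using v ab(1) \<open>u \<in> {a, b}\<close> by simp
    qed
  next
    fix e f assume "e \<in> edges G" "f \<in> edges G" and ne: "e \<noteq> f"
    then obtain a b c d where "e = {a, b}" "(a, b) \<in> DS" "f = {c, d}" "(c, d) \<in> DS" using ex by metis
    then show "path_image (drawn_edge e) \<inter> path_image (drawn_edge f) \<subseteq> P ` (e \<inter> f)"
      using common_point[of a b c d] ne by (auto simp: path_image_drawn_edge simp del: UN_iff)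
  qed
  have "(\<Union>e\<in>edges G. path_image (drawn_edge e)) = skeleton"
    unfolding E skeleton_def image_image
    by (intro arg_cong[of _ _ Union] image_cong refl) (simp split: prod.splits add: path_image_drawn_edge)
  moreover have "P ` verts G \<subseteq> skeleton"
  proof
    fix z assume "z \<in> P ` verts G"
    then obtain a b where "(a, b) \<in> DS" "z = P a" using V VS_side by (metis imageE)
    then show "z \<in> skeleton" unfolding skeleton_def by (intro UN_I[of "(a, b)"]) auto
  qed
  ultimately have draw: "drawing G P drawn_edge = skeleton" by (auto simp: drawing_def)
  fix F assume "F \<in> plane_faces G P drawn_edge"
  then consider "F = - Out" | t where "t \<in> T" "F = interior (K t)"
    by (auto simp: plane_faces_def draw components_skeleton)
  then obtain x y z where F: "sides (x, y, z) \<subseteq> DS"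
    "frontier F = closed_segment (P x) (P y) \<union> closed_segment (P y) (P z) \<union> closed_segment (P z) (P x)"
  proof cases
    case 1 then show thesis using that[OF outer_sides] by (simp add: frontier_triangle)
  next
    case 2
    obtain x y z where t: "t = (x, y, z)" by (cases t)
    have "sides (x, y, z) \<subseteq> DS" using 2(1) t by blast
    then show thesis using that 2 t positive[of x y z] by (simp add: frontier_interior_triangle)
  qed
  have DS: "(x, y) \<in> DS" "(y, z) \<in> DS" "(z, x) \<in> DS" using F(1) by (auto simp: sides_def)
  show "bounded_by_triangle G drawn_edge F"
    unfolding bounded_by_triangle_def
  proof (intro exI conjI)
    show "x \<noteq> y" "y \<noteq> z" "x \<noteq> z" using DS ends_distinct(2) by blast+
    have edge: "{a, b} \<in> edges G" if "(a, b) \<in> DS" for a b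
      unfolding E using that by (rule rev_image_eqI) simp
    show "{x, y} \<in> edges G" "{y, z} \<in> edges G" "{x, z} \<in> edges G"
      using DS[THEN edge] by (simp_all only: insert_commute)
    show "frontier F = path_image (drawn_edge {x, y}) \<union> path_image (drawn_edge {y, z}) \<union> path_image (drawn_edge {x, z})"
      unfolding F(2) path_image_drawn_edge by (simp add: closed_segment_commute)
  qed
qed

end

section \<open>Local analysis of the gadgets\<close>

text \<open>Runs through every deletion pattern of a gadget whose vertices arrive in numerical
  order. Label 0 marks a deleted vertex; a surviving one gets a fresh label, and the labels of its
  earlier neighbours are renamed to it. The final positive labels are thus the components of the
  survivors under the listed adjacencies.\<close>

fun explore :: "(nat list \<Rightarrow> bool) \<Rightarrow> nat list list \<Rightarrow> nat list \<Rightarrow> bool" where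
  "explore \<phi> [] ls = \<phi> ls"
| "explore \<phi> (N # Ns) ls \<longleftrightarrow> explore \<phi> Ns (ls @ [0]) \<and>
     (let k = Suc (length ls); M = filter (\<lambda>l. l \<noteq> 0) (map (nth ls) N)
      in explore \<phi> Ns (map (\<lambda>l. if l \<in> set M then k else l) ls @ [k]))"

text \<open>Equal labels imply equal values of \<open>g\<close>, not conversely, since local
  components may be joined outside the gadget. The bound by the length makes
  \<open>Suc (length ls)\<close> a fresh label.\<close>

definition labelling :: "(nat \<Rightarrow> bool) \<Rightarrow> (nat \<Rightarrow> 'l) \<Rightarrow> nat list \<Rightarrow> bool" where
  "labelling al g ls \<longleftrightarrow>
     (\<forall>i < length ls. (ls ! i \<noteq> 0 \<longleftrightarrow> al i) \<and> ls ! i \<le> length ls) \<and>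
     (\<forall>i < length ls. \<forall>j < length ls. ls ! i \<noteq> 0 \<longrightarrow> ls ! i = ls ! j \<longrightarrow> g i = g j)"

lemma labellingI:
  assumes "\<And>i. i < length ls \<Longrightarrow> ls ! i \<noteq> 0 \<longleftrightarrow> al i" "\<And>i. i < length ls \<Longrightarrow> ls ! i \<le> length ls"
    "\<And>i j. i < length ls \<Longrightarrow> j < length ls \<Longrightarrow> ls ! i \<noteq> 0 \<Longrightarrow> ls ! i = ls ! j \<Longrightarrow> g i = g j"
  shows "labelling al g ls"
  unfolding labelling_def using assms by blast

lemma labellingD:
  assumes "labelling al g ls"
  shows "i < length ls \<Longrightarrow> ls ! i \<noteq> 0 \<longleftrightarrow> al i" "i < length ls \<Longrightarrow> ls ! i \<le> length ls"
    "i < length ls \<Longrightarrow> j < length ls \<Longrightarrow> ls ! i \<noteq> 0 \<Longrightarrow> ls ! i = ls ! j \<Longrightarrow> g i = g j"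
  using assms unfolding labelling_def by blast+

lemma labelling_dead:
  assumes l: "labelling al g ls" and d: "\<not> al (length ls)"
  shows "labelling al g (ls @ [0])"
proof (rule labellingI)
  fix i assume i: "i < length (ls @ [0])"
  then consider "i < length ls" | "i = length ls" by fastforce
  then show "(ls @ [0]) ! i \<noteq> 0 \<longleftrightarrow> al i" "(ls @ [0]) ! i \<le> length (ls @ [0])"
    using labellingD(1,2)[OF l, of i] d by (cases, simp_all add: nth_append)+
next
  fix i j assume "i < length (ls @ [0])" "j < length (ls @ [0])" "(ls @ [0]) ! i \<noteq> 0" "(ls @ [0]) ! i = (ls @ [0]) ! j"
  then have "i < length ls" "j < length ls" "ls ! i \<noteq> 0" "ls ! i = ls ! j"
    by (auto simp: nth_append less_Suc_eq split: if_splits)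
  then show "g i = g j" by (rule labellingD(3)[OF l])
qed

lemma labelling_alive:
  assumes l: "labelling al g ls" and al: "al (length ls)"
    and N: "\<And>i. i \<in> set N \<Longrightarrow> i < length ls \<and> (al i \<longrightarrow> g i = g (length ls))"
    and M: "M = filter (\<lambda>l. l \<noteq> 0) (map (nth ls) N)"
  shows "labelling al g (map (\<lambda>l. if l \<in> set M then Suc (length ls) else l) ls @ [Suc (length ls)])"
    (is "labelling al g ?ls")
proof -
  let ?n = "length ls"
  have fresh: "ls ! i \<noteq> Suc ?n" if "i < ?n" for i using labellingD(2)[OF l that] by simp
  have M0: "0 \<notin> set M" by (simp add: M)
  have gM: "g i = g ?n" if i: "i < ?n" "ls ! i \<in> set M" for i
  proof -
    obtain j where j: "j \<in> set N" "ls ! i = ls ! j" "ls ! j \<noteq> 0" using i(2) by (auto simp: M)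
    have jn: "j < ?n" using N[OF j(1)] by simp
    then have "al j" using labellingD(1)[OF l] j(3) by simp
    then have "g j = g ?n" using N[OF j(1)] by simp
    moreover have "g i = g j" by (rule labellingD(3)[OF l i(1) jn]) (use j in simp_all)
    ultimately show ?thesis by simp
  qed
  have at: "?ls ! i = (if i < ?n then if ls ! i \<in> set M then Suc ?n else ls ! i else Suc ?n)" if "i < Suc ?n" for i
    using that by (simp add: nth_append)
  show ?thesis
  proof (rule labellingI)
    fix i assume "i < length ?ls"
    then have i: "i < Suc ?n" by simp
    show "?ls ! i \<noteq> 0 \<longleftrightarrow> al i"
    proof (cases "i < ?n")
      case True
      then show ?thesis unfolding at[OF i] using labellingD(1)[OF l True] M0 by auto
    next
      case False
      then have "i = ?n" using i by simp
      with al show ?thesis unfolding at[OF i] by simp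
    qed
    show "?ls ! i \<le> length ?ls" unfolding at[OF i] using labellingD(2)[OF l, of i] by auto
  next
    fix i j assume ij': "i < length ?ls" "j < length ?ls" and nz: "?ls ! i \<noteq> 0" and eq: "?ls ! i = ?ls ! j"
    then have ij: "i < Suc ?n" "j < Suc ?n" by simp_all
    show "g i = g j"
    proof (cases "?ls ! i = Suc ?n")
      case True
      have *: "g k = g ?n" if k: "k < Suc ?n" "?ls ! k = Suc ?n" for k
      proof (cases "k < ?n")
        case True
        then have "ls ! k \<in> set M" using k fresh[OF True] unfolding at[OF k(1)] by (simp split: if_splits)
        then show ?thesis using gM True by blast
      next
        case False
        then show ?thesis using k(1) by (simp add: less_Suc_eq)
      qed
      have "?ls ! j = Suc ?n" using eq unfolding True by (rule sym)
      then show ?thesis unfolding *[OF ij(1) True] by (rule *[OF ij(2), symmetric])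
    next
      case False
      then have "i < ?n" "ls ! i = ?ls ! i" "j < ?n" "ls ! j = ?ls ! j"
        using at[OF ij(1)] at[OF ij(2)] eq by (simp_all split: if_splits)
      then show ?thesis using labellingD(3)[OF l, of i j] nz eq by simp
    qed
  qed
qed

lemma explore_sound:
  assumes "explore \<phi> Ns ls" "labelling al g ls"
    and "\<And>k i. k < length Ns \<Longrightarrow> i \<in> set (Ns ! k) \<Longrightarrow> i < length ls + k"
    and "\<And>k i. k < length Ns \<Longrightarrow> i \<in> set (Ns ! k) \<Longrightarrow> al i \<Longrightarrow> al (length ls + k) \<Longrightarrow> g i = g (length ls + k)"
  shows "\<exists>ls'. length ls' = length ls + length Ns \<and> labelling al g ls' \<and> \<phi> ls'"
  using assms
proof (induction Ns arbitrary: ls)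
  case Nil
  then show ?case by auto
next
  case (Cons N Ns)
  let ?M = "filter (\<lambda>l. l \<noteq> 0) (map (nth ls) N)"
  let ?ls = "map (\<lambda>l. if l \<in> set ?M then Suc (length ls) else l) ls @ [Suc (length ls)]"
  have N: "i < length ls" "al i \<Longrightarrow> al (length ls) \<Longrightarrow> g i = g (length ls)" if "i \<in> set N" for i
    using Cons.prems(3,4)[of 0 i] that by auto
  have rest: "i < Suc (length ls) + k" if "k < length Ns" "i \<in> set (Ns ! k)" for k i
    using Cons.prems(3)[of "Suc k" i] that by simp
  have rest': "g i = g (Suc (length ls) + k)" if "k < length Ns" "i \<in> set (Ns ! k)" "al i" "al (Suc (length ls) + k)" for k i
    using Cons.prems(4)[of "Suc k" i] that by simp
  show ?case
  proof (cases "al (length ls)")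
    case False
    have "\<exists>ls'. length ls' = length (ls @ [0]) + length Ns \<and> labelling al g ls' \<and> \<phi> ls'"
      by (rule Cons.IH) (use Cons.prems(1) labelling_dead[OF Cons.prems(2) False] rest rest' in auto)
    then show ?thesis by simp
  next
    case True
    have "\<exists>ls'. length ls' = length ?ls + length Ns \<and> labelling al g ls' \<and> \<phi> ls'"
    proof (rule Cons.IH)
      show "explore \<phi> Ns ?ls" using Cons.prems(1) by (simp add: Let_def)
      show "labelling al g ?ls" by (rule labelling_alive[OF Cons.prems(2) True _ refl]) (use N True in blast)
    qed (use rest rest' in auto)
    then show ?thesis by simp
  qed
qed

definition live_labels :: "nat list \<Rightarrow> nat list \<Rightarrow> nat list" where
  "live_labels ls X = filter (\<lambda>l. l \<noteq> 0) (map (nth ls) X)"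

definition new_labels :: "nat list \<Rightarrow> nat list \<Rightarrow> nat list \<Rightarrow> nat" where
  "new_labels ls X Y = length (remdups (filter (\<lambda>l. l \<notin> set (live_labels ls Y)) (live_labels ls X)))"

definition dead_count :: "nat list \<Rightarrow> nat list \<Rightarrow> nat" where
  "dead_count ls X = length (filter (\<lambda>j. ls ! j = 0) X)"

text \<open>On survivors \<open>g\<close> factors through the labels, so a value attained on
  \<open>X\<close> and missed on \<open>Y\<close> comes from a local component that meets
  \<open>X\<close> and avoids \<open>Y\<close>.\<close>

lemma card_le_new_labels:
  assumes l: "labelling al g ls" and X: "\<And>j. j \<in> set X \<Longrightarrow> j < length ls" and Y: "\<And>j. j \<in> set Y \<Longrightarrow> j < length ls"
    and sub: "L \<subseteq> g ` {j \<in> set X. al j} - g ` {j \<in> set Y. al j}"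
  shows "card L \<le> new_labels ls X Y"
proof -
  let ?F = "filter (\<lambda>l. l \<notin> set (live_labels ls Y)) (live_labels ls X)"
  let ?h = "\<lambda>l. g (SOME j. j < length ls \<and> ls ! j = l)"
  have "L \<subseteq> ?h ` set ?F"
  proof
    fix v assume "v \<in> L"
    then obtain j where j: "j \<in> set X" "al j" "v = g j" "v \<notin> g ` {j \<in> set Y. al j}" using sub by blast
    have jl: "j < length ls" "ls ! j \<noteq> 0" using X[OF j(1)] labellingD(1)[OF l X[OF j(1)]] j(2) by simp_all
    have "ls ! j \<notin> set (live_labels ls Y)"
    proof
      assume "ls ! j \<in> set (live_labels ls Y)"
      then obtain k where k: "k \<in> set Y" "ls ! k = ls ! j" by (auto simp: live_labels_def)
      then have "al k" "g k = g j"
        using labellingD(1)[OF l Y[OF k(1)]] jl(2) by (simp, intro labellingD(3)[OF l Y[OF k(1)] jl(1)]) simp_all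
      then have "g j \<in> g ` {j \<in> set Y. al j}" using k(1) by (intro rev_image_eqI[of k]) simp_all
      then show False using j(3,4) by simp
    qed
    then have "ls ! j \<in> set ?F" using j jl by (auto simp: live_labels_def)
    moreover have "?h (ls ! j) = v"
    proof -
      have "(SOME k. k < length ls \<and> ls ! k = ls ! j) < length ls \<and> ls ! (SOME k. k < length ls \<and> ls ! k = ls ! j) = ls ! j"
        by (rule someI[of _ j]) (use jl in auto)
      then show ?thesis unfolding j(3) using jl(2) by (intro labellingD(3)[OF l _ jl(1)]) simp_all
    qed
    ultimately show "v \<in> ?h ` set ?F" by blast
  qed
  then have "card L \<le> card (set ?F)" using surj_card_le[of "set ?F" L ?h] by blast
  also have "\<dots> = new_labels ls X Y" by (simp only: new_labels_def length_remdups_card_conv)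
  finally show ?thesis .
qed

lemma dead_count_eq:
  assumes "labelling al g ls" "\<And>j. j \<in> set X \<Longrightarrow> j < length ls"
  shows "dead_count ls X = length (filter (\<lambda>j. \<not> al j) X)"
  unfolding dead_count_def
  by (intro arg_cong[of _ _ length] filter_cong refl) (use labellingD(1)[OF assms(1)] assms(2) in blast)

text \<open>Vertices 0 and 7 are links to the two hubs, 8 and 9 are cut vertices in a face of the
  theta graph, and 10 is the cut vertex between the two ears of the pair. The triangle 2, 3, 4 is an
  odd component of the parity argument; 1, 5 and 6 are the independent vertices, each with one
  neighbour in it.\<close>

definition ear_triangles :: "(nat \<times> nat \<times> nat) list" where
  "ear_triangles = [(0,8,1),(0,1,10),(1,8,2),(1,2,10),(2,8,3),(2,3,4),(2,4,10),(3,8,5),(8,9,5),(9,3,5),(3,9,4),(4,9,6),(4,6,10),(6,9,7),(6,7,10)]"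

text \<open>The edge between the cut vertices 8 and 9 is left out. An omission can only split labels
  further, so whatever is verified for these lists remains valid in the graph. The pendant lists
  likewise omit the edges among cut vertices.\<close>

definition ear_neighbours :: "nat list list" where
  "ear_neighbours = [[],[0],[1],[2],[2,3],[3],[4],[6],[0,1,2,3,5],[3,4,5,6,7],[0,1,2,4,6,7]]"

text \<open>The two sides of the ear are its face, with \<open>p\<close> and \<open>q\<close>, and
  its digon, with \<open>s\<close>. An ear that does not conduct pays 1 towards each side whose cut
  vertices in it are not all dead. With \<open>p\<close> and \<open>q\<close> both dead it may
  overdraw by 1, which the face has to cover. A label at cut vertices only costs 2, because a second
  gadget pays for it too. The last conjunct serves the borderline case with at most one dead cut
  vertex.\<close>

definition ear_bound :: "nat list \<Rightarrow> bool" where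
  "ear_bound ls =
    (let closed = new_labels ls [1,2,3,4,5,6] [0,7,8,9,10]; k = new_labels ls [8,9,10] [0,7];
         p = (ls ! 8 = 0); q = (ls ! 9 = 0); s = (ls ! 10 = 0);
         conducts = (ls ! 0 \<noteq> 0 \<and> ls ! 0 = ls ! 7)
     in 3 * closed + 2 * k + (if conducts then 0 else (if p \<and> q then 0 else 1) + (if s then 0 else 1))
          \<le> (if p \<and> q then 1 else 0) + 2 * dead_count ls [0,1,2,3,4,5,6,7]
        \<and> (k \<noteq> 0 \<longrightarrow> \<not> conducts) \<and> (closed \<noteq> 0 \<longrightarrow> p \<and> q \<or> p \<and> s \<or> q \<and> s))"

text \<open>Vertex 0 is the link to the hub and 8 the common cut vertex of the face, with 7 and 9
  before and after it on the closed walk. The roles of 1 to 6 are as in an ear.\<close>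

definition pendant_triangles :: "(nat \<times> nat \<times> nat) list" where
  "pendant_triangles = [(0,7,1),(0,1,9),(1,7,4),(1,4,9),(4,7,2),(4,2,3),(4,3,9),(2,7,5),(7,8,5),(8,2,5),(2,8,3),(3,8,6),(8,9,6),(9,3,6)]"

definition pendant_neighbours :: "nat list list" where
  "pendant_neighbours = [[],[0],[],[2],[1,2,3],[2],[3],[0,1,2,4,5],[2,3,5,6],[0,1,3,4,6]]"

text \<open>The common cut vertex 8 is not among the labels charged here, as two ears of the face
  already pay for it. The overdraft of 3 or 1 is again covered by the face.\<close>

definition pendant_bound :: "nat list \<Rightarrow> bool" where
  "pendant_bound ls =
    (let closed = new_labels ls [1,2,3,4,5,6] [0,7,8,9]; k = new_labels ls [7,9] [0];
         b = (ls ! 7 = 0); o' = (ls ! 8 = 0); a = (ls ! 9 = 0)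
     in 3 * closed + 2 * k \<le> (if o' then if b \<and> a then 3 else if b \<or> a then 1 else 0 else 0) + 2 * dead_count ls [0,1,2,3,4,5,6]
        \<and> (closed \<noteq> 0 \<longrightarrow> b \<and> o' \<or> b \<and> a \<or> o' \<and> a))"

text \<open>An antiprism: the link cycle 0 to 4 around the core cycle 5 to 9, whose inside is cut by
  the diagonals from 6 to 8 and to 9.\<close>

definition hub_triangles :: "(nat \<times> nat \<times> nat) list" where
  "hub_triangles = [(0,5,1),(1,5,6),(1,6,2),(2,6,7),(2,7,3),(3,7,8),(3,8,4),(4,8,9),(4,9,0),(0,9,5),(5,9,6),(6,9,8),(6,8,7)]"

definition hub_neighbours :: "nat list list" where
  "hub_neighbours = [[],[0],[1],[2],[3,0],[0,1],[1,2,5],[2,3,6],[3,4,6,7],[4,0,5,6,8]]"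

text \<open>Only core deletions are charged; a deleted link is charged to the gadget that owns it,
  or to the ends of the theta graph. In the second conjunct the surviving links still form a path or
  the whole cycle, and each core vertex sees two consecutive links, so nothing comes off.\<close>

definition hub_bound :: "nat list \<Rightarrow> bool" where
  "hub_bound ls =
    (let k = new_labels ls [0,1,2,3,4,5,6,7,8,9] []
     in 3 * k \<le> 3 + 2 * dead_count ls [5,6,7,8,9] \<and> (dead_count ls [0,1,2,3,4] \<le> 1 \<longrightarrow> k \<le> 1))"

lemma ear_check: "explore ear_bound ear_neighbours []"
  by code_simp

lemma pendant_check: "explore pendant_bound pendant_neighbours []"
  by code_simp

lemma hub_check: "explore hub_bound hub_neighbours []"
  by code_simp

section \<open>The graph\<close>

text \<open>\<open>corner i j\<close> is the \<open>j\<close>-th vertex of the closed walk along the six triangles of cut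
  vertices in face \<open>i\<close>; the walk passes through the common vertex of these triangles at
  every third step.\<close>

definition corner :: "nat \<Rightarrow> nat \<Rightarrow> nat" where
  "corner i j = (let r = j mod 18 in 390 + 13 * (i mod 3) +
     (if r mod 3 = 1 then 12 else 2 * (r div 3) + (if r mod 3 = 0 then 0 else 1)))"

text \<open>Ear \<open>e\<close> joins hubs \<open>d\<close> and \<open>d + 1\<close> of path
  \<open>i\<close>. Even ears border face \<open>i\<close>, odd ones face \<open>i + 2\<close>
  (taken modulo 3 by \<open>corner\<close>), whose walk they follow backwards. Face \<open>i\<close>
  is therefore bordered by the even ears of path \<open>i\<close> and the odd ears of path
  \<open>i + 1\<close>; the pendants of path \<open>i\<close> hang into it.\<close>

definition ear_verts :: "nat \<Rightarrow> nat list" where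
  "ear_verts e = (let i = e div 8; d = e div 2 mod 4 in
     [8*e, 8*e+1, 8*e+2, 8*e+3, 8*e+4, 8*e+5, 8*e+6, 8*e+7,
      if even e then corner i (3*d+2) else corner (i+2) (18-d),
      if even e then corner i (3*d+3) else corner (i+2) (17-d),
      378 + 4*i + d])"

definition pendant_verts :: "nat \<Rightarrow> nat list" where
  "pendant_verts h = (let i = h div 5; k = h mod 5; b = 192 + 7*h in
     [b, b+1, b+2, b+3, b+4, b+5, b+6, corner i (3*k), corner i (3*k+1), corner i (3*k+2)])"

text \<open>Five links in cyclic order, then the core. At the first and last hub of a path the two
  missing ears are replaced by end vertices, each shared with the corresponding hub of a
  neighbouring path.\<close>

definition hub_verts :: "nat \<Rightarrow> nat list" where
  "hub_verts h = (let i = h div 5; k = h mod 5; e = 8*i + 2*k in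
     [if k = 0 then 372 + i else 8*(e-1) + 7,
      if k = 4 then 375 + i else 8*(e+1),
      if k = 4 then 375 + (i+1) mod 3 else 8*e,
      192 + 7*h,
      if k = 0 then 372 + (i+1) mod 3 else 8*(e-2) + 7,
      297+5*h, 298+5*h, 299+5*h, 300+5*h, 301+5*h])"

definition hub_rim :: "nat \<Rightarrow> (nat \<times> nat \<times> nat) list" where
  "hub_rim h = (let i = h div 5; k = h mod 5; r = hub_verts h in
     [(r!0, r!1, corner (i+2) (18-k)), (r!2, r!3, corner i (3*k+2)), (r!3, r!4, corner i (3*k))] @
     (if k = 4 then [] else [(r!1, r!2, 378 + 4*i + k)]) @
     (if k = 0 then [] else [(r!4, r!0, 377 + 4*i + k)]))"

definition place :: "nat list \<Rightarrow> nat \<times> nat \<times> nat \<Rightarrow> nat \<times> nat \<times> nat" where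
  "place V t = (case t of (a, b, c) \<Rightarrow> (V ! a, V ! b, V ! c))"

definition mirror :: "nat \<times> nat \<times> nat \<Rightarrow> nat \<times> nat \<times> nat" where
  "mirror t = (case t of (a, b, c) \<Rightarrow> (a, c, b))"

text \<open>Odd ears lie on the other side of their path and are mirrored so that all facets are
  oriented alike. The number of facets agrees with Euler's formula: 360 + 210 + 195 + 69 + 18 + 2 =
  854 = 2 * 429 - 4.\<close>

definition facets :: "(nat \<times> nat \<times> nat) list" where
  "facets =
     concat (map (\<lambda>e. map (\<lambda>t. if even e then place (ear_verts e) t else mirror (place (ear_verts e) t)) ear_triangles) [0..<24]) @
     concat (map (\<lambda>h. map (place (pendant_verts h)) pendant_triangles) [0..<15]) @
     concat (map (\<lambda>h. map (place (hub_verts h)) hub_triangles @ hub_rim h) [0..<15]) @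
     map (\<lambda>k. (corner (k div 6) (3*k+1), corner (k div 6) (3*k+3), corner (k div 6) (3*k+2))) [0..<18] @
     [(372, 374, 373), (375, 376, 377)]"

definition the_graph :: "nat ugraph" where
  "the_graph = \<lparr>verts = {..<429}, edges = (\<lambda>(a, b). {a, b}) ` (\<Union> (sides ` set facets))\<rparr>"

lemma in_concat_map_upt: "x \<in> set (F e) \<Longrightarrow> e < n \<Longrightarrow> x \<in> set (concat (map F [0..<n]))"
  by auto

section \<open>Darts and coordinates\<close>

text \<open>Tries indexed by binary numerals. All functions below match on constructors and return lists
  rather than conjunctions: the simplifier would traverse a trie again in every branch of a
  conditional.\<close>

datatype 'b trie = Tip | Nod "'b trie" "'b list" "'b trie"

fun look :: "'b trie \<Rightarrow> num \<Rightarrow> 'b list" where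
  "look Tip k = []"
| "look (Nod l ys r) num.One = ys"
| "look (Nod l ys r) (num.Bit0 k) = look l k"
| "look (Nod l ys r) (num.Bit1 k) = look r k"

fun put :: "num \<Rightarrow> 'b \<Rightarrow> 'b trie \<Rightarrow> 'b trie" where
  "put num.One b Tip = Nod Tip [b] Tip"
| "put (num.Bit0 k) b Tip = Nod (put k b Tip) [] Tip"
| "put (num.Bit1 k) b Tip = Nod Tip [] (put k b Tip)"
| "put num.One b (Nod l ys r) = Nod l (b # ys) r"
| "put (num.Bit0 k) b (Nod l ys r) = Nod (put k b l) ys r"
| "put (num.Bit1 k) b (Nod l ys r) = Nod l ys (put k b r)"

fun entries :: "'b trie \<Rightarrow> 'b set" where
  "entries Tip = {}"
| "entries (Nod l ys r) = entries l \<union> set ys \<union> entries r"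

lemma look_entries: "b \<in> set (look t k) \<Longrightarrow> b \<in> entries t"
  by (induction t k rule: look.induct) auto

lemma entries_put: "entries (put k b t) \<subseteq> insert b (entries t)"
  by (induction k b t rule: put.induct) auto

text \<open>As \<open>num\<close> has no zero, 0 and 1 share a key. This is harmless where bucket
  entries are compared in full; the coordinate trie, which takes the head of a bucket, shifts its
  index by one.\<close>

definition key :: "nat \<Rightarrow> num" where
  "key n = num_of_nat n"

lemma key_code [code]: "key 0 = num.One" "key (nat_of_num k) = k"
  by (simp_all add: key_def num_of_nat.simps nat_of_num_inverse)

fun put_darts :: "(nat \<times> nat) list \<Rightarrow> (nat \<times> nat) trie \<Rightarrow> (nat \<times> nat) trie" where
  "put_darts [] t = t"
| "put_darts ((a, b) # ds) t = put_darts ds (put (key a) (a, b) t)"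

lemma entries_put_darts: "entries (put_darts ds t) \<subseteq> set ds \<union> entries t"
proof (induction ds t rule: put_darts.induct)
  case (2 a b ds t)
  then show ?case using entries_put[of "key a" "(a, b)" t] by auto
qed simp

definition darts :: "(nat \<times> nat) list" where
  "darts = concat (map (\<lambda>(a, b, c). [(a, b), (b, c), (c, a)]) facets)"

lemma set_darts: "set darts = \<Union> (sides ` set facets)"
  unfolding darts_def sides_def by auto

definition recorded :: "(nat \<times> nat) list \<Rightarrow> nat \<times> nat \<Rightarrow> bool" where
  "recorded ys d \<longleftrightarrow> d \<in> set ys"

fun converses_recorded :: "(nat \<times> nat) list \<Rightarrow> (nat \<times> nat) trie \<Rightarrow> bool list" where
  "converses_recorded [] t = []"
| "converses_recorded ((a, b) # ds) t = recorded (look t (key b)) (b, a) # converses_recorded ds t"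

definition origin :: "(nat \<times> nat) list \<Rightarrow> nat \<Rightarrow> bool" where
  "origin ys v \<longleftrightarrow> v \<in> set (map fst ys)"

fun origins :: "nat list \<Rightarrow> (nat \<times> nat) trie \<Rightarrow> bool list" where
  "origins [] t = []"
| "origins (v # vs) t = origin (look t (key v)) v # origins vs t"

lemma converses_recordedD: "list_all id (converses_recorded ds t) \<Longrightarrow> (a, b) \<in> set ds \<Longrightarrow> (b, a) \<in> entries t"
  by (induction ds t rule: converses_recorded.induct) (auto simp: recorded_def look_entries)

lemma originsD: "list_all id (origins vs t) \<Longrightarrow> v \<in> set vs \<Longrightarrow> \<exists>b. (v, b) \<in> entries t"
  by (induction vs t rule: origins.induct) (auto simp: origin_def, metis look_entries)

definition darts_ok :: "(nat \<times> nat) list \<Rightarrow> (nat \<times> nat) trie \<Rightarrow> bool list" where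
  "darts_ok ds t = converses_recorded ds t @ origins [0..<429] t"

lemma darts_check: "list_all id (darts_ok darts (put_darts darts Tip))"
  by code_simp

lemma dart_converse: "(a, b) \<in> set darts \<Longrightarrow> (b, a) \<in> set darts"
  and vertex_has_dart: "v < 429 \<Longrightarrow> \<exists>b. (v, b) \<in> set darts"
proof -
  let ?t = "put_darts darts Tip"
  have sub: "entries ?t \<subseteq> set darts" using entries_put_darts[of darts Tip] by simp
  have ok: "list_all id (converses_recorded darts ?t)" "list_all id (origins [0..<429] ?t)"
    using darts_check unfolding darts_ok_def list_all_append by (rule conjunct1, rule conjunct2)
  show "(a, b) \<in> set darts \<Longrightarrow> (b, a) \<in> set darts"
    by (rule subsetD[OF sub converses_recordedD[OF ok(1)]])
  assume "v < 429"
  then have "v \<in> set [0..<429]" unfolding set_upt atLeastLessThan_iff by simp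
  from originsD[OF ok(2) this] show "\<exists>b. (v, b) \<in> set darts" using sub by blast
qed

text \<open>Coordinates of a Schnyder drawing with outer face 8, 372, 416.\<close>

definition points :: "(int \<times> int) list" where
  "points = [
    (406,19), (58,18), (56,17), (55,19), (55,16), (55,20), (55,15), (52,14), (0,427), (416,11), (53,10), (53,9), (52,11), (54,8), (51,12), (50,13), (68,279), (66,278), (66,277), (65,277), (66,276),
    (64,277), (67,275), (81,268), (49,298), (48,299), (47,300), (45,301), (44,303), (46,7), (43,304), (42,308), (250,103), (231,102), (231,101), (230,101), (229,100), (70,260), (229,99), (229,98), (41,312), (40,313),
    (39,315), (38,316), (255,100), (37,316), (256,100), (260,97), (224,94), (223,94), (222,94), (220,95), (219,94), (76,238), (218,94), (218,92), (264,94), (265,94), (266,94), (267,95), (269,94), (36,325), (270,94),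
    (274,91), (104,33), (103,36), (102,171), (104,170), (101,173), (105,169), (100,174), (99,179), (387,32), (100,31), (99,30), (99,29), (98,32), (100,28), (97,33), (96,183), (122,160), (114,159), (114,158), (113,158),
    (114,157), (112,158), (115,156), (135,149), (95,187), (94,188), (93,189), (91,190), (90,192), (92,27), (89,193), (88,197), (186,102), (161,101), (161,100), (160,100), (159,99), (118,141), (159,98), (159,97), (87,201),
    (86,202), (85,204), (84,205), (191,99), (83,205), (192,99), (196,96), (154,93), (153,93), (152,93), (150,94), (149,93), (124,119), (148,93), (148,91), (200,93), (201,93), (202,93), (203,94), (205,93), (82,214),
    (206,93), (210,90), (8,402), (353,56), (353,55), (352,55), (351,54), (12,394), (351,53), (351,52), (364,49), (362,48), (147,47), (147,46), (146,49), (148,45), (145,50), (144,51), (344,55), (339,59), (338,59),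
    (336,60), (335,59), (18,377), (334,59), (333,59), (143,57), (142,58), (141,59), (139,60), (138,62), (140,44), (137,63), (136,65), (319,69), (314,73), (313,73), (311,74), (310,73), (24,360), (309,73), (308,73),
    (135,71), (134,72), (133,74), (132,75), (135,73), (131,75), (136,73), (137,73), (300,77), (295,81), (294,81), (292,82), (291,81), (30,343), (290,81), (289,81), (137,79), (137,81), (138,81), (139,82), (141,81),
    (130,90), (142,81), (143,81), (401,20), (61,20), (60,22), (59,22), (60,21), (60,23), (58,22), (53,291), (59,284), (58,283), (59,282), (59,283), (57,283), (60,281), (71,265), (70,265), (66,267), (67,266),
    (69,265), (65,267), (68,264), (226,100), (76,249), (72,251), (73,250), (75,249), (71,251), (74,248), (215,94), (82,226), (78,228), (79,227), (81,226), (77,228), (80,225), (379,36), (111,37), (110,39), (109,39),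
    (110,38), (110,40), (108,39), (113,163), (112,163), (108,165), (109,164), (111,163), (107,165), (110,162), (119,146), (118,146), (114,148), (115,147), (117,146), (113,148), (116,145), (156,99), (124,130), (120,132), (121,131),
    (123,130), (119,132), (122,129), (145,93), (130,107), (126,109), (127,108), (129,107), (125,109), (128,106), (7,1), (10,2), (11,4), (10,6), (10,3), (13,5), (10,7), (348,54), (18,383), (14,385), (15,384),
    (17,383), (13,385), (16,382), (323,68), (24,366), (20,368), (21,367), (23,366), (19,368), (22,365), (304,76), (30,349), (26,351), (27,350), (29,349), (25,351), (28,348), (285,84), (36,332), (32,334), (33,333),
    (35,332), (31,334), (34,331), (1,422), (402,22), (402,21), (401,22), (2,421), (50,295), (53,293), (53,292), (52,293), (51,294), (82,269), (85,267), (83,266), (82,267), (82,268), (230,96), (228,95), (227,98),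
    (228,98), (229,97), (219,90), (217,89), (216,92), (217,92), (218,91), (383,35), (381,34), (380,35), (381,35), (382,35), (113,167), (116,165), (114,164), (113,165), (113,166), (136,150), (139,148), (137,147), (136,148),
    (136,149), (160,95), (158,94), (157,97), (158,97), (159,96), (149,89), (147,88), (146,91), (147,91), (148,90), (8,404), (8,403), (7,403), (6,404), (5,406), (144,55), (145,55), (146,54), (146,53), (145,52),
    (136,69), (137,69), (138,68), (138,67), (137,66), (138,77), (139,77), (140,76), (140,75), (139,74), (144,85), (145,85), (146,84), (146,83), (145,82), (1,0), (3,419), (4,412), (281,85), (213,88), (143,87),
    (415,11), (72,276), (255,99), (219,93), (99,32), (126,157), (191,98), (149,92), (361,49), (143,58), (135,72), (138,80), (399,21), (57,19), (54,288), (63,281), (64,274), (69,264), (70,259), (75,248), (76,237),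
    (81,225), (82,213), (93,27), (57,26), (376,38), (104,36), (106,169), (111,162), (112,155), (117,145), (118,140), (123,129), (124,118), (129,106), (130,89), (141,44), (107,43), (427,1), (9,399), (12,393), (17,382),
    (18,376), (23,365), (24,359), (29,348), (30,342), (35,331), (36,324), (47,7), (12,6)]"

fun put_points :: "nat \<Rightarrow> (int \<times> int) list \<Rightarrow> (int \<times> int) trie \<Rightarrow> (int \<times> int) trie" where
  "put_points v [] t = t"
| "put_points v (p # ps) t = put_points (Suc v) ps (put (key (Suc v)) p t)"

definition point :: "(int \<times> int) trie \<Rightarrow> nat \<Rightarrow> int \<times> int" where
  "point Q v = hd (look Q (key (Suc v)))"

fun orient :: "int \<times> int \<Rightarrow> int \<times> int \<Rightarrow> int \<times> int \<Rightarrow> int" where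
  "orient (x, y) (x', y') (x'', y'') = (x' - x) * (y'' - y) - (y' - y) * (x'' - x)"

fun orients :: "(int \<times> int) trie \<Rightarrow> (nat \<times> nat \<times> nat) list \<Rightarrow> int list" where
  "orients Q [] = []"
| "orients Q ((a, b, c) # ts) = orient (point Q a) (point Q b) (point Q c) # orients Q ts"

definition orients_ok :: "int list \<Rightarrow> int \<Rightarrow> bool" where
  "orients_ok ds s \<longleftrightarrow> list_all (\<lambda>d. 0 < d) ds \<and> sum_list ds \<le> s"

text \<open>The computation adds over a list, the area condition over a set. All summands are
  positive, so dropping repetitions only lowers the sum.\<close>

lemma orients_ok_sound:
  assumes "orients_ok (orients Q ts) s"
  shows "(\<forall>(a, b, c) \<in> set ts. 0 < orient (point Q a) (point Q b) (point Q c)) \<and>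
    (\<Sum>(a, b, c) \<in> set ts. orient (point Q a) (point Q b) (point Q c)) \<le> s"
  using assms
proof (induction Q ts arbitrary: s rule: orients.induct)
  case (2 Q a b c ts)
  let ?d = "\<lambda>(a, b, c). orient (point Q a) (point Q b) (point Q c)"
  have IH: "(\<forall>(a, b, c) \<in> set ts. 0 < orient (point Q a) (point Q b) (point Q c)) \<and> sum ?d (set ts) \<le> s - ?d (a, b, c)"
    and pos: "0 < ?d (a, b, c)"
    using "2.IH"[of "s - ?d (a, b, c)"] "2.prems" by (simp_all add: orients_ok_def)
  then have "sum ?d (set ((a, b, c) # ts)) \<le> s" by (cases "(a, b, c) \<in> set ts") (simp_all add: insert_absorb)
  then show ?case using IH pos by auto
qed (simp add: orients_ok_def)

definition inner_facets :: "(nat \<times> nat \<times> nat) list" where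
  "inner_facets = filter (\<lambda>t. t \<noteq> (372, 8, 416)) facets"

text \<open>The bound 181903 = 427 * 427 - 426 is twice the area of the outer triangle with corners
  (0,427), (1,0) and (427,1).\<close>

lemma orient_check: "orients_ok (orients (put_points 0 points Tip) inner_facets) 181903"
  by code_simp

lemma outer_facet: "(372, 8, 416) \<in> set facets"
proof -
  have "list_ex (\<lambda>t. t = (372, 8, 416)) (hub_rim 0)" by code_simp
  then have mem: "(372, 8, 416) \<in> set (map (place (hub_verts 0)) hub_triangles @ hub_rim 0)"
    unfolding list_ex_iff set_append by blast
  show ?thesis
    unfolding facets_def set_append
    by (rule UnI2, rule UnI2, rule UnI1, rule in_concat_map_upt[where e = 0], rule mem, simp)
qed

fun position_key :: "int \<times> int \<Rightarrow> num" where
  "position_key (x, y) = key (nat x)"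

fun put_vertices :: "(int \<times> int) trie \<Rightarrow> nat list \<Rightarrow> ((int \<times> int) \<times> nat) trie \<Rightarrow> ((int \<times> int) \<times> nat) trie" where
  "put_vertices Q [] t = t"
| "put_vertices Q (v # vs) t = put_vertices Q vs (put (position_key (point Q v)) (point Q v, v) t)"

definition vertex_at :: "((int \<times> int) \<times> nat) trie \<Rightarrow> int \<times> int \<Rightarrow> nat option" where
  "vertex_at t p = map_of (look t (position_key p)) p"

fun recover :: "(int \<times> int) trie \<Rightarrow> nat list \<Rightarrow> ((int \<times> int) \<times> nat) trie \<Rightarrow> nat option list" where
  "recover Q [] t = []"
| "recover Q (v # vs) t = vertex_at t (point Q v) # recover Q vs t"

definition recovered :: "(int \<times> int) trie \<Rightarrow> nat list \<Rightarrow> nat option list" where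
  "recovered Q vs = recover Q vs (put_vertices Q vs Tip)"

lemma recover_map: "recover Q vs t = map (\<lambda>v. vertex_at t (point Q v)) vs"
  by (induction vs) auto

text \<open>Looking up a position returns the vertex put there, which is impossible for both of two
  vertices in the same place. Buckets by first coordinate replace the comparison of all
  pairs.\<close>

lemma points_check: "recovered (put_points 0 points Tip) [0..<429] = map Some [0..<429]"
  by code_simp

abbreviation "pos \<equiv> point (put_points 0 points Tip)"

lemma inj_pos: "inj_on pos {..<429}"
proof (rule inj_onI)
  fix u v :: nat assume uv: "u \<in> {..<429}" "v \<in> {..<429}" "pos u = pos v"
  define t where "t = put_vertices (put_points 0 points Tip) [0..<429] Tip"
  have "map (\<lambda>v. vertex_at t (pos v)) [0..<429] = map Some [0..<429]"
    using points_check unfolding recovered_def recover_map t_def .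
  then have "vertex_at t (pos v) = Some v" if "v \<in> {..<429}" for v
    using that unfolding map_eq_conv set_upt atLeast0LessThan by blast
  from this[OF uv(1)] this[OF uv(2)] have "Some u = Some v"
    unfolding uv(3) by (rule trans[OF sym])
  then show "u = v" unfolding option.inject .
qed

lemma outer_pos: "pos 8 = (0, 427)" "pos 372 = (1, 0)" "pos 416 = (427, 1)"
  by code_simp+

section \<open>No 2-factor\<close>

definition touches :: "('v \<Rightarrow> nat) \<Rightarrow> 'v set \<Rightarrow> nat \<Rightarrow> nat \<Rightarrow> bool" where
  "touches cl e p q \<longleftrightarrow> p \<in> cl ` e \<and> q \<in> cl ` e"

lemma degree_sum:
  assumes "simple_graph H" "X \<subseteq> verts H"
  shows "(\<Sum>v\<in>X. degree_in H v) = (\<Sum>e\<in>edges H. card (e \<inter> X))"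
proof -
  have fin: "finite (edges H)" "finite X"
    using assms finite_subset[of "edges H" "Pow (verts H)"] finite_subset[of X] unfolding simple_graph_def by auto
  have "(\<Sum>v\<in>X. degree_in H v) = (\<Sum>v\<in>X. \<Sum>e\<in>edges H. of_bool (v \<in> e))"
    unfolding degree_in_def using fin by (simp add: of_bool_def sum.If_cases Int_def)
  also have "\<dots> = (\<Sum>e\<in>edges H. \<Sum>v\<in>X. of_bool (v \<in> e))" by (rule sum.swap)
  also have "\<dots> = (\<Sum>e\<in>edges H. card (e \<inter> X))"
    using fin by (simp add: of_bool_def sum.If_cases Int_def conj_commute)
  finally show ?thesis .
qed

text \<open>Class 0 is the set deleted in Tutte's criterion, class 1 the independent set, and every other
  class is a union of components of the rest joined to class 1 by an odd number of edges.\<close>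

lemma no_two_factor_if_barrier:
  fixes cl :: "'v \<Rightarrow> nat" and k :: nat
  assumes fin: "finite (verts G)"
    and edge: "\<And>e. e \<in> edges G \<Longrightarrow> \<exists>a b. e = {a, b} \<and> a \<noteq> b \<and> \<not> (cl a = 1 \<and> cl b = 1) \<and> (2 \<le> cl a \<longrightarrow> 2 \<le> cl b \<longrightarrow> cl a = cl b)"
    and sub: "\<And>e. e \<in> edges G \<Longrightarrow> e \<subseteq> verts G"
    and range: "\<And>v. v \<in> verts G \<Longrightarrow> cl v < k"
    and bound: "\<And>c. 2 \<le> c \<Longrightarrow> c < k \<Longrightarrow> card {e \<in> edges G. touches cl e 1 c} \<le> E c \<and> odd (E c)"
    and count: "2 * card {v \<in> verts G. cl v = 0} + (\<Sum>c=2..<k. E c) < 2 * card {v \<in> verts G. cl v = 1} + (k - 2)"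
  shows "\<not> (\<exists>H. two_factor H G)"
proof
  assume "\<exists>H. two_factor H G"
  then obtain H where H: "simple_graph H" "verts H = verts G" "edges H \<subseteq> edges G" "\<And>v. v \<in> verts G \<Longrightarrow> degree_in H v = 2"
    unfolding two_factor_def by blast
  define X where "X c = {v \<in> verts G. cl v = c}" for c
  define N where "N p q = (\<Sum>e\<in>edges H. of_bool (touches cl e p q) :: nat)" for p q
  have finE: "finite (edges G)" using fin sub finite_subset[of "edges G" "Pow (verts G)"] by auto
  then have finH: "finite (edges H)" using H(3) finite_subset by blast
  have deg: "2 * card (X c) = (\<Sum>e\<in>edges H. card (e \<inter> X c))" for c
  proof -
    have "(\<Sum>v\<in>X c. degree_in H v) = (\<Sum>v\<in>X c. 2)" by (rule sum.cong) (auto simp: X_def H(4))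
    then show ?thesis using degree_sum[of H "X c"] H(1,2) by (simp add: X_def)
  qed
  have shape: "\<exists>a b. e = {a, b} \<and> a \<noteq> b \<and> a \<in> verts G \<and> b \<in> verts G \<and> \<not> (cl a = 1 \<and> cl b = 1) \<and> (2 \<le> cl a \<longrightarrow> 2 \<le> cl b \<longrightarrow> cl a = cl b)"
    if "e \<in> edges H" for e
    using edge[of e] sub[of e] H(3) that by fastforce
  have cardX: "card ({a, b} \<inter> X c) = of_bool (cl a = c) + of_bool (cl b = c)" if "a \<noteq> b" "a \<in> verts G" "b \<in> verts G" for a b c
    using that by (auto simp: X_def Int_insert_left)
  have touch: "touches cl {a, b} p q \<longleftrightarrow> (p = cl a \<or> p = cl b) \<and> (q = cl a \<or> q = cl b)" for a b p q
    by (auto simp: touches_def)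
  have single: "(\<Sum>c=2..<k. of_bool (c = d) :: nat) = of_bool (2 \<le> d \<and> d < k)" for d
    by (simp add: of_bool_def sum.If_cases Int_def)
  \<comment> \<open>An \<open>H\<close>-edge at class 1 has exactly one end there, and its other end
    is in class 0 or in one of the classes from 2 on, so the right-hand side counts it once.\<close>
  have T: "2 * card (X 1) \<le> N 1 0 + (\<Sum>c=2..<k. N 1 c)"
  proof -
    have "2 * card (X 1) \<le> (\<Sum>e\<in>edges H. of_bool (touches cl e 1 0) + (\<Sum>c=2..<k. of_bool (touches cl e 1 c)))"
      unfolding deg
    proof (rule sum_mono)
      fix e assume "e \<in> edges H"
      then obtain a b where e: "e = {a, b}" "a \<noteq> b" "a \<in> verts G" "b \<in> verts G" "\<not> (cl a = 1 \<and> cl b = 1)"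
        using shape by blast
      have ends: "cl a < k" "cl b < k" using range e by blast+
      show "card (e \<inter> X 1) \<le> of_bool (touches cl e 1 0) + (\<Sum>c=2..<k. of_bool (touches cl e 1 c))"
      proof (cases "cl a = 1 \<or> cl b = 1")
        case True
        then obtain d where d: "cl a = 1 \<and> cl b = d \<or> cl b = 1 \<and> cl a = d" "d \<noteq> 1" "d < k" using e(5) ends by metis
        then have "touches cl e 1 c \<longleftrightarrow> c = d" if "c \<noteq> 1" for c
          unfolding e(1) touch using that by auto
        then have "of_bool (touches cl e 1 0) + (\<Sum>c=2..<k. of_bool (touches cl e 1 c)) = of_bool (d = 0) + (\<Sum>c=2..<k. of_bool (c = d) :: nat)"
          by (intro arg_cong2[of _ _ _ _ "(+)"] sum.cong) auto
        also have "\<dots> = 1" unfolding single using d(2,3) by (auto simp: of_bool_def)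
        finally show ?thesis using cardX[OF e(2-4), of 1] e(5) unfolding e(1) by (auto simp: of_bool_def)
      qed (simp add: cardX[OF e(2-4)] e(1))
    qed
    also have "\<dots> = N 1 0 + (\<Sum>c=2..<k. N 1 c)"
      unfolding N_def sum.distrib by (subst sum.swap) (rule refl)
    finally show ?thesis .
  qed
  \<comment> \<open>The edges from class 0 to class 1 and to the component classes are disjoint
    families, each using one place at class 0; edges inside class 0 only add slack.\<close>
  have S: "N 1 0 + (\<Sum>c=2..<k. N 0 c) \<le> 2 * card (X 0)"
  proof -
    have "N 1 0 + (\<Sum>c=2..<k. N 0 c) = (\<Sum>e\<in>edges H. of_bool (touches cl e 1 0) + (\<Sum>c=2..<k. of_bool (touches cl e 0 c)))"
      unfolding N_def sum.distrib by (subst (2) sum.swap) (rule refl)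
    also have "\<dots> \<le> 2 * card (X 0)"
      unfolding deg
    proof (rule sum_mono)
      fix e assume "e \<in> edges H"
      then obtain a b where e: "e = {a, b}" "a \<noteq> b" "a \<in> verts G" "b \<in> verts G"
        using shape by blast
      show "of_bool (touches cl e 1 0) + (\<Sum>c=2..<k. of_bool (touches cl e 0 c)) \<le> card (e \<inter> X 0)"
      proof (cases "cl a = 0 \<or> cl b = 0")
        case True
        then obtain d where d: "cl a = 0 \<and> cl b = d \<or> cl b = 0 \<and> cl a = d" by metis
        then have "touches cl e 0 c \<longleftrightarrow> c = d" if "c \<noteq> 0" for c
          unfolding e(1) touch using that by auto
        moreover have "touches cl e 1 0 \<longleftrightarrow> d = 1" unfolding e(1) touch using d by auto
        ultimately have "of_bool (touches cl e 1 0) + (\<Sum>c=2..<k. of_bool (touches cl e 0 c)) = of_bool (d = 1) + (\<Sum>c=2..<k. of_bool (c = d) :: nat)"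
          by (intro arg_cong2[of _ _ _ _ "(+)"] sum.cong) auto
        also have "\<dots> \<le> 1" unfolding single by (auto simp: of_bool_def)
        finally show ?thesis using cardX[OF e(2-4), of 0] True unfolding e(1) by (auto simp: of_bool_def)
      next
        case False
        then have "\<not> touches cl e 1 0" "\<not> touches cl e 0 c" for c unfolding e(1) touch by auto
        then show ?thesis by simp
      qed
    qed
    finally show ?thesis .
  qed
  \<comment> \<open>Edges inside class \<open>c\<close> contribute 2 to its even degree sum, so an
    even number of \<open>H\<close>-edges leaves it. Using up the odd bound \<open>E c\<close>
    towards class 1 therefore forces an edge towards class 0.\<close>
  have C: "N 1 c + 1 \<le> E c + N 0 c" if c: "2 \<le> c" "c < k" for c
  proof -
    have "even (\<Sum>e\<in>edges H. card (e \<inter> X c) + (of_bool (touches cl e 1 c) + of_bool (touches cl e 0 c)))"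
    proof (rule dvd_sum)
      fix e assume "e \<in> edges H"
      then obtain a b where e: "e = {a, b}" "a \<noteq> b" "a \<in> verts G" "b \<in> verts G" "2 \<le> cl a \<longrightarrow> 2 \<le> cl b \<longrightarrow> cl a = cl b"
        using shape by blast
      show "even (card (e \<inter> X c) + (of_bool (touches cl e 1 c) + of_bool (touches cl e 0 c)))"
        using e(5) c unfolding e(1) touch cardX[OF e(2-4)]
        by (cases "cl a = c"; cases "cl b = c"; cases "cl a = 0"; cases "cl a = 1"; cases "cl b = 0"; cases "cl b = 1") auto
    qed
    then have even: "even (N 1 c + N 0 c)"
      unfolding sum.distrib deg[symmetric] N_def[symmetric] by simp
    have "N 1 c = card {e \<in> edges H. touches cl e 1 c}"
      unfolding N_def using finH by (simp add: of_bool_def sum.If_cases Int_def)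
    also have "\<dots> \<le> card {e \<in> edges G. touches cl e 1 c}" using finE H(3) by (intro card_mono) auto
    also have "\<dots> \<le> E c" using bound[OF c] by blast
    finally have "N 1 c \<le> E c" .
    moreover have "N 1 c \<noteq> E c \<or> N 0 c \<noteq> 0" using even bound[OF c] by (cases "N 0 c = 0") auto
    ultimately show ?thesis by linarith
  qed
  have "(\<Sum>c=2..<k. N 1 c) + (\<Sum>c=2..<k. 1) \<le> (\<Sum>c=2..<k. E c) + (\<Sum>c=2..<k. N 0 c)"
    unfolding sum.distrib[symmetric] by (rule sum_mono) (simp add: C[simplified])
  then have "(\<Sum>c=2..<k. N 1 c) + (k - 2) \<le> (\<Sum>c=2..<k. E c) + (\<Sum>c=2..<k. N 0 c)" by simp
  then show False using T S count unfolding X_def by linarith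
qed

lemma darts_simple_check: "list_all id (map (\<lambda>(a, b). a \<noteq> b \<and> a < 429 \<and> b < 429) darts)"
  by code_simp

lemma dart_distinct: "(a, b) \<in> set darts \<Longrightarrow> a \<noteq> b"
  and dart_range: "(a, b) \<in> set darts \<Longrightarrow> a < 429 \<and> b < 429"
  using darts_simple_check unfolding list_all_iff by auto

text \<open>The first hubs of the three paths are connected through 372, 373, 374 and share class 2,
  the last hubs share class 3 through 375, 376, 377; the nine middle hubs receive 4 to 12.\<close>

definition hub_class :: "nat \<Rightarrow> nat" where
  "hub_class h = (if h mod 5 = 0 then 2 else if h mod 5 = 4 then 3 else 3 + 3 * (h div 5) + h mod 5)"

definition vertex_class :: "nat \<Rightarrow> nat" where
  "vertex_class v =
     (if v < 192 then
        (if v mod 8 = 0 then hub_class (5 * (v div 64) + v div 16 mod 4)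
         else if v mod 8 = 7 then hub_class (5 * (v div 64) + v div 16 mod 4 + 1)
         else if v mod 8 \<in> {2, 3, 4} then 13 + v div 8 else 1)
      else if v < 297 then
        (if (v - 192) mod 7 = 0 then hub_class ((v - 192) div 7)
         else if (v - 192) mod 7 \<in> {2, 3, 4} then 37 + (v - 192) div 7 else 1)
      else if v < 372 then hub_class ((v - 297) div 5)
      else if v < 375 then 2 else if v < 378 then 3 else 0)"

text \<open>Only darts leaving class 1 are kept, so that an edge is not counted again through its
  converse.\<close>

definition tally :: "(nat \<times> nat) list \<Rightarrow> nat list" where
  "tally ps = concat (map (\<lambda>(x, y). if x = 1 \<and> 2 \<le> y then [y] else []) ps)"

text \<open>180 = 24 * 5 + 15 * 4: the three independent vertices of an ear send three edges to its
  inner triangle and two to hubs, those of a pendant three and one. An inner triangle thus receives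
  3, a middle hub 5 and each end class 9 edges, all odd.\<close>

definition tally_ok :: "nat list \<Rightarrow> bool" where
  "tally_ok L \<longleftrightarrow> list_all (\<lambda>c. odd (count_list L c)) [2..<52] \<and> sum_list (map (count_list L) [2..<52]) = 180"

definition classes_ok :: "(nat \<times> nat) list \<Rightarrow> bool" where
  "classes_ok ps \<longleftrightarrow> list_all id (map (\<lambda>(x, y). \<not> (x = 1 \<and> y = 1) \<and> (2 \<le> x \<longrightarrow> 2 \<le> y \<longrightarrow> x = y)) ps) \<and> tally_ok (tally ps)"

lemma classes_check: "classes_ok (map (\<lambda>(a, b). (vertex_class a, vertex_class b)) darts)"
  by code_simp

definition class_sizes_ok :: "nat list \<Rightarrow> bool" where
  "class_sizes_ok cs \<longleftrightarrow> list_all (\<lambda>c. c < 52) cs \<and> count_list cs 0 = 51 \<and> count_list cs 1 = 117"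

lemma class_sizes_check: "class_sizes_ok (map vertex_class [0..<429])"
  by code_simp

lemma count_list_tally: "2 \<le> c \<Longrightarrow> count_list (tally ps) c = length (filter (\<lambda>p. p = (1, c)) ps)"
  by (induction ps) (auto simp: tally_def)

lemma count_list_map_upt: "count_list (map g [0..<n]) c = card {v. v < n \<and> g v = c}"
proof -
  have "count_list (map g xs) c = length (filter (\<lambda>v. g v = c) xs)" for xs :: "nat list" by (induction xs) auto
  also have "length (filter (\<lambda>v. g v = c) [0..<n]) = card (set (filter (\<lambda>v. g v = c) [0..<n]))"
    by (intro distinct_card[symmetric] distinct_filter distinct_upt)
  finally show ?thesis by simp
qed

lemma edges_the_graph: "edges the_graph = (\<lambda>(a, b). {a, b}) ` set darts"
  by (simp add: the_graph_def set_darts)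

theorem the_graph_no_two_factor: "\<not> (\<exists>H. two_factor H the_graph)"
proof -
  let ?cl = vertex_class
  let ?ps = "map (\<lambda>(a, b). (?cl a, ?cl b)) darts"
  have dart: "\<not> (?cl a = 1 \<and> ?cl b = 1)" "2 \<le> ?cl a \<Longrightarrow> 2 \<le> ?cl b \<Longrightarrow> ?cl a = ?cl b" if "(a, b) \<in> set darts" for a b
  proof -
    have "list_all id (map (\<lambda>(x, y). \<not> (x = 1 \<and> y = 1) \<and> (2 \<le> x \<longrightarrow> 2 \<le> y \<longrightarrow> x = y)) ?ps)"
      using classes_check unfolding classes_ok_def by (rule conjunct1)
    then have "\<forall>(a, b) \<in> set darts. \<not> (?cl a = 1 \<and> ?cl b = 1) \<and> (2 \<le> ?cl a \<longrightarrow> 2 \<le> ?cl b \<longrightarrow> ?cl a = ?cl b)"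
      unfolding list_all_iff set_map by (simp add: case_prod_unfold)
    then show "\<not> (?cl a = 1 \<and> ?cl b = 1)" "2 \<le> ?cl a \<Longrightarrow> 2 \<le> ?cl b \<Longrightarrow> ?cl a = ?cl b" using that by blast+
  qed
  have V: "verts the_graph = {..<429}" by (simp add: the_graph_def)
  have sizes: "{v \<in> verts the_graph. ?cl v = c} = {v. v < 429 \<and> ?cl v = c}" for c unfolding V by auto
  show ?thesis
  proof (rule no_two_factor_if_barrier[where cl = ?cl and k = 52 and E = "count_list (tally ?ps)"])
    show "finite (verts the_graph)" by (simp add: V)
    fix e assume e: "e \<in> edges the_graph"
    then obtain a b where ab: "e = {a, b}" "(a, b) \<in> set darts" unfolding edges_the_graph by auto
    show "\<exists>a b. e = {a, b} \<and> a \<noteq> b \<and> \<not> (?cl a = 1 \<and> ?cl b = 1) \<and> (2 \<le> ?cl a \<longrightarrow> 2 \<le> ?cl b \<longrightarrow> ?cl a = ?cl b)"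
      using ab dart[OF ab(2)] dart_distinct[OF ab(2)] by blast
    show "e \<subseteq> verts the_graph" using ab dart_range[OF ab(2)] by (auto simp: V)
  next
    fix v assume "v \<in> verts the_graph"
    then show "?cl v < 52" using class_sizes_check unfolding class_sizes_ok_def V by (simp add: list_all_iff)
  next
    fix c :: nat assume c: "2 \<le> c" "c < 52"
    have "{e \<in> edges the_graph. touches ?cl e 1 c} \<subseteq> (\<lambda>(a, b). {a, b}) ` set (filter (\<lambda>(a, b). ?cl a = 1 \<and> ?cl b = c) darts)"
    proof
      fix e assume "e \<in> {e \<in> edges the_graph. touches ?cl e 1 c}"
      then obtain a b where ab: "e = {a, b}" "(a, b) \<in> set darts" "touches ?cl e 1 c" unfolding edges_the_graph by auto
      then have "?cl a = 1 \<and> ?cl b = c \<or> ?cl b = 1 \<and> ?cl a = c" using c(1) by (auto simp: touches_def)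
      then show "e \<in> (\<lambda>(a, b). {a, b}) ` set (filter (\<lambda>(a, b). ?cl a = 1 \<and> ?cl b = c) darts)"
        using ab dart_converse[OF ab(2)] by (force simp: insert_commute)
    qed
    then have "card {e \<in> edges the_graph. touches ?cl e 1 c} \<le> card ((\<lambda>(a, b). {a, b}) ` set (filter (\<lambda>(a, b). ?cl a = 1 \<and> ?cl b = c) darts))"
      by (intro card_mono) auto
    also have "\<dots> \<le> card (set (filter (\<lambda>(a, b). ?cl a = 1 \<and> ?cl b = c) darts))" by (rule card_image_le) simp
    also have "\<dots> \<le> length (filter (\<lambda>(a, b). ?cl a = 1 \<and> ?cl b = c) darts)" by (rule card_length)
    also have "\<dots> = length (filter (\<lambda>p. p = (1, c)) ?ps)"
      by (simp add: filter_map comp_def case_prod_unfold)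
    also have "\<dots> = count_list (tally ?ps) c" by (rule count_list_tally[OF c(1), symmetric])
    finally show "card {e \<in> edges the_graph. touches ?cl e 1 c} \<le> count_list (tally ?ps) c \<and> odd (count_list (tally ?ps) c)"
    proof
      have "list_all (\<lambda>c. odd (count_list (tally ?ps) c)) [2..<52]"
        using classes_check unfolding classes_ok_def tally_ok_def by blast
      then show "odd (count_list (tally ?ps) c)"
        using c unfolding list_all_iff set_upt by (meson atLeastLessThan_iff)
    qed
  next
    have "(\<Sum>c=2..<52. count_list (tally ?ps) c) = 180"
      using classes_check unfolding classes_ok_def tally_ok_def by (simp only: interv_sum_list_conv_sum_set_nat set_upt)
    then show "2 * card {v \<in> verts the_graph. ?cl v = 0} + (\<Sum>c=2..<52. count_list (tally ?ps) c)
        < 2 * card {v \<in> verts the_graph. ?cl v = 1} + (52 - 2)"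
      using class_sizes_check unfolding sizes class_sizes_ok_def count_list_map_upt by simp
  qed
qed

section \<open>Toughness\<close>

lemma card_Un_of_bool:
  assumes "finite A" "finite B" "p \<Longrightarrow> A \<inter> B \<noteq> {}"
  shows "card (A \<union> B) + of_bool p \<le> card A + card B"
proof (cases p)
  case True
  then have "card (A \<inter> B) \<ge> 1" using assms by (simp add: Suc_leI card_gt_0_iff)
  then show ?thesis using card_Un_Int[OF assms(1,2)] True by simp
qed (simp add: card_Un_le)

lemma card_chain4:
  assumes fin: "finite X" "finite A" "finite B" "finite C"
    and "p \<Longrightarrow> X \<inter> A \<noteq> {}" "q \<Longrightarrow> (X \<union> A) \<inter> B \<noteq> {}" "r \<Longrightarrow> (X \<union> A \<union> B) \<inter> C \<noteq> {}"
  shows "card (X \<union> A \<union> B \<union> C) + (of_bool p + of_bool q + of_bool r) \<le> card X + (card A + card B + card C)"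
  using card_Un_of_bool[of X A p] card_Un_of_bool[of "X \<union> A" B q] card_Un_of_bool[of "X \<union> A \<union> B" C r] assms
  by auto

text \<open>Together with \<open>X\<close> the four links form a cycle, of which three can save.
  Some link is either absent or can be given up, and the sets are adjoined in the order in which
  each of the other links meets what is already there.\<close>

lemma card_attach_path:
  assumes fin: "finite X" "finite A" "finite B" "finite C"
    and a: "a \<Longrightarrow> X \<inter> A \<noteq> {}" and b: "b \<Longrightarrow> A \<inter> B \<noteq> {}" and c: "c \<Longrightarrow> B \<inter> C \<noteq> {}" and d: "d \<Longrightarrow> C \<inter> X \<noteq> {}"
  shows "card (X \<union> (A \<union> B \<union> C)) + min 3 (of_bool a + of_bool b + of_bool c + of_bool d) \<le> card X + (card A + card B + card C)"
proof -
  consider "a" "b" "c" | "\<not> d" | "\<not> a" | "\<not> b" | "\<not> c" by blast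
  then show ?thesis
  proof cases
    case 1
    have "card (X \<union> A \<union> B \<union> C) + (of_bool a + of_bool b + of_bool c) \<le> card X + (card A + card B + card C)"
      by (rule card_chain4[OF fin]) (use a b c in blast)+
    then show ?thesis using 1 by (simp add: Un_assoc)
  next
    case 2
    have "card (X \<union> A \<union> B \<union> C) + (of_bool a + of_bool b + of_bool c) \<le> card X + (card A + card B + card C)"
      by (rule card_chain4[OF fin]) (use a b c in blast)+
    then show ?thesis using 2 by (simp add: Un_assoc)
  next
    case 3
    have "card (X \<union> C \<union> B \<union> A) + (of_bool d + of_bool c + of_bool b) \<le> card X + (card C + card B + card A)"
      by (rule card_chain4[OF fin(1,4,3,2)]) (use b c d in blast)+
    moreover have "X \<union> C \<union> B \<union> A = X \<union> (A \<union> B \<union> C)" by blast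
    ultimately show ?thesis using 3 by simp
  next
    case 4
    have "card (X \<union> A \<union> C \<union> B) + (of_bool a + of_bool d + of_bool c) \<le> card X + (card A + card C + card B)"
      by (rule card_chain4[OF fin(1,2,4,3)]) (use a c d in blast)+
    moreover have "X \<union> A \<union> C \<union> B = X \<union> (A \<union> B \<union> C)" by blast
    ultimately show ?thesis using 4 by simp
  next
    case 5
    have "card (X \<union> A \<union> B \<union> C) + (of_bool a + of_bool b + of_bool d) \<le> card X + (card A + card B + card C)"
      by (rule card_chain4[OF fin]) (use a b d in blast)+
    moreover have "X \<union> A \<union> B \<union> C = X \<union> (A \<union> B \<union> C)" by blast
    ultimately show ?thesis using 5 by simp
  qed
qed

text \<open>Three links in a cycle save at most two labels.\<close>

lemma card_three:
  assumes fin: "finite A" "finite B" "finite C"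
    and p: "p \<Longrightarrow> A \<inter> B \<noteq> {}" and q: "q \<Longrightarrow> B \<inter> C \<noteq> {}" and r: "r \<Longrightarrow> C \<inter> A \<noteq> {}"
  shows "card (A \<union> B \<union> C) + min 2 (of_bool p + of_bool q + of_bool r) \<le> card A + card B + card C"
proof -
  have "card ((A \<union> B) \<union> C) + of_bool (q \<or> r) \<le> card (A \<union> B) + card C"
    by (rule card_Un_of_bool) (use assms in auto)
  moreover have "card (A \<union> B) + of_bool p \<le> card A + card B"
    by (rule card_Un_of_bool) (use assms in auto)
  moreover have "card ((B \<union> C) \<union> A) + of_bool (p \<or> r) \<le> card (B \<union> C) + card A"
    by (rule card_Un_of_bool) (use assms in auto)
  moreover have "card (B \<union> C) + of_bool q \<le> card B + card C"
    by (rule card_Un_of_bool) (use assms in auto)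
  moreover have "(B \<union> C) \<union> A = A \<union> B \<union> C" by blast
  ultimately show ?thesis by (cases p; cases q; cases r) simp_all
qed

definition path_links :: "(nat \<Rightarrow> bool) \<Rightarrow> nat" where
  "path_links c = of_bool (c 0) + of_bool (c 1) + of_bool (c 2) + of_bool (c 3)"

text \<open>The union bound for label sets of hubs arranged on a theta graph: a link saves one label
  unless it closes a cycle.\<close>

lemma card_theta_ordered:
  fixes Y :: "nat \<Rightarrow> nat \<Rightarrow> 'a set"
  assumes fin: "finite U" "finite D" "\<And>i k. finite (Y i k)"
    and l0: "\<And>i. c i 0 \<Longrightarrow> U \<inter> Y i 1 \<noteq> {}" and l1: "\<And>i. c i 1 \<Longrightarrow> Y i 1 \<inter> Y i 2 \<noteq> {}"
    and l2: "\<And>i. c i 2 \<Longrightarrow> Y i 2 \<inter> Y i 3 \<noteq> {}" and l3: "\<And>i. c i 3 \<Longrightarrow> Y i 3 \<inter> D \<noteq> {}"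
  shows "card (U \<union> D \<union> (Y i 1 \<union> Y i 2 \<union> Y i 3) \<union> (Y j 1 \<union> Y j 2 \<union> Y j 3) \<union> (Y k 1 \<union> Y k 2 \<union> Y k 3))
      + (min 3 (path_links (c i)) + min 3 (path_links (c j)) + min 3 (path_links (c k)) + of_bool (path_links (c i) = 4))
    \<le> card U + card D + (card (Y i 1) + card (Y i 2) + card (Y i 3)) + (card (Y j 1) + card (Y j 2) + card (Y j 3))
      + (card (Y k 1) + card (Y k 2) + card (Y k 3))"
proof -
  let ?P = "\<lambda>i. Y i 1 \<union> Y i 2 \<union> Y i 3"
  have attach: "card (X \<union> ?P i) + min 3 (path_links (c i)) \<le> card X + (card (Y i 1) + card (Y i 2) + card (Y i 3))"
    if "finite X" "U \<union> D \<subseteq> X" for X i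
    unfolding path_links_def
    by (rule card_attach_path) (use fin that l0[of i] l1[of i] l2[of i] l3[of i] in blast)+
  \<comment> \<open>The path attached before the others may use a fourth link, since joining
    \<open>U\<close> to \<open>D\<close> closes no cycle yet. For the later paths \<open>U\<close>
    and \<open>D\<close> already belong to one union.\<close>
  have "card (U \<union> D \<union> ?P i) + (min 3 (path_links (c i)) + of_bool (path_links (c i) = 4))
      \<le> card U + card D + (card (Y i 1) + card (Y i 2) + card (Y i 3))"
  proof (cases "path_links (c i) = 4")
    case True
    then have c: "c i 0" "c i 1" "c i 2" "c i 3" unfolding path_links_def by (cases "c i 0"; cases "c i 1"; cases "c i 2"; cases "c i 3"; simp)+
    have "card (U \<union> Y i 1 \<union> Y i 2 \<union> Y i 3) + (of_bool True + of_bool True + of_bool True) \<le> card U + (card (Y i 1) + card (Y i 2) + card (Y i 3))"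
      by (rule card_chain4) (use fin c l0[of i] l1[of i] l2[of i] in blast)+
    moreover have "card ((U \<union> Y i 1 \<union> Y i 2 \<union> Y i 3) \<union> D) + of_bool True \<le> card (U \<union> Y i 1 \<union> Y i 2 \<union> Y i 3) + card D"
      by (rule card_Un_of_bool) (use fin c l3[of i] in auto)
    moreover have "(U \<union> Y i 1 \<union> Y i 2 \<union> Y i 3) \<union> D = U \<union> D \<union> ?P i" by blast
    ultimately show ?thesis using True by simp
  next
    case False
    have "finite (U \<union> D)" using fin by simp
    from attach[OF this subset_refl, of i] show ?thesis using False card_Un_le[of U D] by simp
  qed
  moreover have "finite (U \<union> D \<union> ?P i)" "finite (U \<union> D \<union> ?P i \<union> ?P j)" using fin by simp_all
  from attach[OF this(1), of j] attach[OF this(2), of k]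
  have "card (U \<union> D \<union> ?P i \<union> ?P j) + min 3 (path_links (c j)) \<le> card (U \<union> D \<union> ?P i) + (card (Y j 1) + card (Y j 2) + card (Y j 3))"
    "card (U \<union> D \<union> ?P i \<union> ?P j \<union> ?P k) + min 3 (path_links (c k)) \<le> card (U \<union> D \<union> ?P i \<union> ?P j) + (card (Y k 1) + card (Y k 2) + card (Y k 3))"
    by blast+
  ultimately show ?thesis by linarith
qed

text \<open>The extra saving is obtained by attaching a complete path before the other two. In total
  at most 3 + 3 + 3 + 1 = 10 labels are saved, the edges of a spanning tree on \<open>U\<close>,
  \<open>D\<close> and nine middle hubs.\<close>

lemma card_theta:
  fixes Y :: "nat \<Rightarrow> nat \<Rightarrow> 'a set"
  assumes "finite U" "finite D" "\<And>i k. finite (Y i k)"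
    and "\<And>i. c i 0 \<Longrightarrow> U \<inter> Y i 1 \<noteq> {}" and "\<And>i. c i 1 \<Longrightarrow> Y i 1 \<inter> Y i 2 \<noteq> {}"
    and "\<And>i. c i 2 \<Longrightarrow> Y i 2 \<inter> Y i 3 \<noteq> {}" and "\<And>i. c i 3 \<Longrightarrow> Y i 3 \<inter> D \<noteq> {}"
  shows "card (U \<union> D \<union> (Y 0 1 \<union> Y 0 2 \<union> Y 0 3) \<union> (Y 1 1 \<union> Y 1 2 \<union> Y 1 3) \<union> (Y 2 1 \<union> Y 2 2 \<union> Y 2 3))
      + (min 3 (path_links (c 0)) + min 3 (path_links (c 1)) + min 3 (path_links (c 2))
        + of_bool (path_links (c 0) = 4 \<or> path_links (c 1) = 4 \<or> path_links (c 2) = 4))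
    \<le> card U + card D + (card (Y 0 1) + card (Y 0 2) + card (Y 0 3)) + (card (Y 1 1) + card (Y 1 2) + card (Y 1 3))
      + (card (Y 2 1) + card (Y 2 2) + card (Y 2 3))"
proof -
  let ?P = "\<lambda>i. Y i 1 \<union> Y i 2 \<union> Y i 3"
  have eq: "U \<union> D \<union> ?P 1 \<union> ?P 0 \<union> ?P 2 = U \<union> D \<union> ?P 0 \<union> ?P 1 \<union> ?P 2"
    "U \<union> D \<union> ?P 2 \<union> ?P 0 \<union> ?P 1 = U \<union> D \<union> ?P 0 \<union> ?P 1 \<union> ?P 2" by blast+
  note * = card_theta_ordered[of U D Y c, OF assms]
  show ?thesis using *[of 0 1 2] *[of 1 0 2] *[of 2 0 1] unfolding eq by (auto simp: of_bool_def)
qed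

section \<open>Dead cut vertices of one face\<close>

fun adjacent_pairs :: "bool list \<Rightarrow> nat" where
  "adjacent_pairs (a # b # xs) = of_bool (a \<and> b) + adjacent_pairs (b # xs)"
| "adjacent_pairs xs = 0"

text \<open>A run of consecutive true entries has one adjacent pair fewer than entries.\<close>

lemma adjacent_pairs_bound: "adjacent_pairs xs + of_bool (\<exists>x \<in> set xs. x) \<le> (\<Sum>x\<leftarrow>xs. of_bool x)"
  by (induction xs rule: adjacent_pairs.induct) (auto simp: of_bool_def split: if_splits)

text \<open>The total overdraft of the eight ears and five pendants around one face, in terms of its
  dead cut vertices; 12 is the common vertex. The summands belong to the even ears of one path, the
  odd ears of the next, and the pendants.\<close>

definition corner_gain :: "(nat \<Rightarrow> bool) \<Rightarrow> nat" where
  "corner_gain x =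
     of_bool (x 1 \<and> x 2) + of_bool (x 3 \<and> x 4) + of_bool (x 5 \<and> x 6) + of_bool (x 7 \<and> x 8) +
     (of_bool (x 0 \<and> x 11) + of_bool (x 11 \<and> x 12) + of_bool (x 12 \<and> x 10) + of_bool (x 10 \<and> x 9)) +
     (\<Sum>k<5. if x 12 then if x (2*k) \<and> x (2*k+1) then 3 else if x (2*k) \<or> x (2*k+1) then 1 else 0 else 0)"

text \<open>Dead cut vertices of a face pay 2 each. Two or more of them cover the overdraft and
  leave at least 3; a single one causes no overdraft.\<close>

lemma corner_gain_bound:
  defines "n x \<equiv> (\<Sum>j<13. of_bool (x j)) :: nat"
  shows "n x \<le> 1 \<Longrightarrow> corner_gain x = 0" and "2 \<le> n x \<Longrightarrow> corner_gain x + 3 \<le> 2 * n x"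
proof -
  define b where "b j = (of_bool (x j) :: nat)" for j
  define p where "p i j = (of_bool (x i \<and> x j) :: nat)" for i j
  define r where "r = (of_bool (\<exists>j \<in> {11,0,1,2,3,4,5,6,7,8,9,10}. x j) :: nat)"
  have n: "n x = b 0 + b 1 + b 2 + b 3 + b 4 + b 5 + b 6 + b 7 + b 8 + b 9 + b 10 + b 11 + b 12"
    unfolding n_def b_def by (simp add: eval_nat_numeral)
  have path: "p 11 0 + p 0 1 + p 1 2 + p 2 3 + p 3 4 + p 4 5 + p 5 6 + p 6 7 + p 7 8 + p 8 9 + p 9 10
      + r
    \<le> b 11 + b 0 + b 1 + b 2 + b 3 + b 4 + b 5 + b 6 + b 7 + b 8 + b 9 + b 10"
  proof -
    let ?xs = "[x 11, x 0, x 1, x 2, x 3, x 4, x 5, x 6, x 7, x 8, x 9, x 10]"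
    have "adjacent_pairs ?xs = p 11 0 + p 0 1 + p 1 2 + p 2 3 + p 3 4 + p 4 5 + p 5 6 + p 6 7 + p 7 8 + p 8 9 + p 9 10"
      by (simp only: adjacent_pairs.simps p_def[symmetric] add.assoc add_0_right)
    moreover have "(\<Sum>x\<leftarrow>?xs. of_bool x) = b 11 + b 0 + b 1 + b 2 + b 3 + b 4 + b 5 + b 6 + b 7 + b 8 + b 9 + b 10"
      by (simp only: list.map sum_list.Cons sum_list.Nil b_def[symmetric] add.assoc add_0_right)
    moreover have "of_bool (\<exists>x \<in> set ?xs. x) = r"
      unfolding r_def by (simp only: list.set bex_simps)
    ultimately show ?thesis using adjacent_pairs_bound[of ?xs] by linarith
  qed
  have pair: "p i j \<le> b i" "p i j \<le> b j" "2 * p i j \<le> b i + b j" "p i j = p j i" for i j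
    by (auto simp: b_def p_def)
  have alive: "corner_gain x = p 1 2 + p 3 4 + p 5 6 + p 7 8 + (p 11 0 + p 9 10)" if "\<not> x 12"
    using that unfolding p_def by (simp add: corner_gain_def conj_commute)
  have pend: "(if x 12 then if x i \<and> x j then 3 else if x i \<or> x j then 1 else 0 else 0) = b i + b j + p i j" if "x 12" for i j
    using that by (auto simp: b_def p_def)
  have dead: "corner_gain x = p 1 2 + p 3 4 + p 5 6 + p 7 8 + (p 11 0 + b 11 + b 10 + p 9 10)
      + (b 0 + b 1 + p 0 1 + (b 2 + b 3 + p 2 3) + (b 4 + b 5 + p 4 5) + (b 6 + b 7 + p 6 7) + (b 8 + b 9 + p 8 9))" if "x 12"
  proof -
    have sum5: "(\<Sum>k<5. g k) = g 0 + g 1 + g 2 + g 3 + g 4" for g :: "nat \<Rightarrow> nat"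
      by (simp add: eval_nat_numeral)
    have "(\<Sum>k<5. if x 12 then if x (2*k) \<and> x (2*k+1) then 3 else if x (2*k) \<or> x (2*k+1) then 1 else 0 else 0) =
        (b 0 + b 1 + p 0 1 + (b 2 + b 3 + p 2 3) + (b 4 + b 5 + p 4 5) + (b 6 + b 7 + p 6 7) + (b 8 + b 9 + p 8 9))"
      unfolding sum5 pend[OF that] by simp
    moreover have "of_bool (x 0 \<and> x 11) = p 11 0" "of_bool (x 11 \<and> x 12) = b 11" "of_bool (x 12 \<and> x 10) = b 10" "of_bool (x 10 \<and> x 9) = p 9 10"
      using that by (simp_all add: p_def b_def conj_commute)
    ultimately show ?thesis unfolding corner_gain_def p_def[symmetric] by linarith
  qed
  \<comment> \<open>\<open>M\<close> collects pairs at ears and \<open>M'\<close> pairs at pendants;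
    together they are the consecutive pairs of the path 11, 0, 1, ..., 10. With the common vertex
    alive the gain is \<open>M\<close>, at most half of \<open>B\<close>. With it dead the gain is
    \<open>B + M + M'\<close>, at most \<open>2 * B - 1\<close> unless \<open>B\<close> is 0, while
    2 more units come from the common vertex.\<close>
  define B where "B = b 11 + b 0 + b 1 + b 2 + b 3 + b 4 + b 5 + b 6 + b 7 + b 8 + b 9 + b 10"
  define M where "M = p 1 2 + p 3 4 + p 5 6 + p 7 8 + (p 11 0 + p 9 10)"
  define M' where "M' = p 0 1 + p 2 3 + p 4 5 + p 6 7 + p 8 9"
  have nB: "n x = B + b 12" unfolding n B_def by (simp only: ac_simps)
  have M: "2 * M \<le> B"
  proof -
    have "2 * M = 2 * p 1 2 + 2 * p 3 4 + 2 * p 5 6 + 2 * p 7 8 + (2 * p 11 0 + 2 * p 9 10)"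
      unfolding M_def by (simp only: distrib_left)
    also have "\<dots> \<le> (b 1 + b 2) + (b 3 + b 4) + (b 5 + b 6) + (b 7 + b 8) + ((b 11 + b 0) + (b 9 + b 10))"
      by (intro add_mono pair(3))
    also have "\<dots> = B" unfolding B_def by (simp only: ac_simps)
    finally show ?thesis .
  qed
  have path': "M + M' + r \<le> B" using path unfolding M_def M'_def B_def by (simp only: ac_simps)
  have alive': "\<not> x 12 \<Longrightarrow> corner_gain x = M" using alive unfolding M_def by simp
  have dead': "x 12 \<Longrightarrow> corner_gain x = B + M + M'" unfolding M_def M'_def B_def by (subst dead, assumption, simp only: ac_simps)
  have r: "r \<noteq> 0" if "B \<noteq> 0" using that by (auto simp: r_def B_def b_def)
  have b12: "b 12 = of_bool (x 12)" by (simp add: b_def)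
  show "corner_gain x = 0" if "n x \<le> 1"
    using that nB b12 M path' alive' dead' by (cases "x 12") auto
  show "corner_gain x + 3 \<le> 2 * n x" if "2 \<le> n x"
    using that nB b12 M path' alive' dead' r by (cases "x 12") auto
qed

text \<open>The three arguments count the broken links on the paths. The constant is 33 = 3 * 15 - 2
  * 6: fifteen hubs less the savings at the two ends. Without any broken link the right-hand side is
  only 30, whence the last assumption.\<close>

lemma theta_arith:
  fixes n0 n1 n2 :: nat
  assumes "n0 \<le> 4" "n1 \<le> 4" "n2 \<le> 4" "n0 + n1 + n2 \<noteq> 0"
  shows "33 \<le> 3 * (min 3 (4 - n0) + min 3 (4 - n1) + min 3 (4 - n2) + of_bool (n0 = 0 \<or> n1 = 0 \<or> n2 = 0))
    + 2 * (n0 + n1 + n2) + (min 3 (n0 + n1) + min 3 (n1 + n2) + min 3 (n2 + n0))"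
proof -
  have "n0 \<in> {0,1,2,3,4}" "n1 \<in> {0,1,2,3,4}" "n2 \<in> {0,1,2,3,4}" using assms by auto
  then show ?thesis using assms(4) by (elim insertE emptyE) simp_all
qed

section \<open>Transfer of the local checks to the graph\<close>

lemma sides_place: "(i, k) \<in> sides t \<Longrightarrow> (V ! i, V ! k) \<in> sides (place V t)"
  by (cases t) (auto simp: sides_def place_def)

lemma sides_mirror: "(a, b) \<in> sides t \<Longrightarrow> (b, a) \<in> sides (mirror t)"
  by (cases t) (auto simp: sides_def mirror_def)

definition adjacent_in :: "(nat \<times> nat \<times> nat) list \<Rightarrow> nat \<Rightarrow> nat \<Rightarrow> bool" where
  "adjacent_in L i k \<longleftrightarrow> list_ex (\<lambda>(a, b, c). (i, k) \<in> set [(a, b), (b, c), (c, a), (b, a), (c, b), (a, c)]) L"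

definition earlier_neighbours :: "(nat \<times> nat \<times> nat) list \<Rightarrow> nat list list \<Rightarrow> bool" where
  "earlier_neighbours L Ns \<longleftrightarrow> list_all (\<lambda>k. list_all (\<lambda>i. i < k \<and> adjacent_in L i k) (Ns ! k)) [0..<length Ns]"

lemma earlier_neighbours_ear: "earlier_neighbours ear_triangles ear_neighbours"
  and earlier_neighbours_pendant: "earlier_neighbours pendant_triangles pendant_neighbours"
  and earlier_neighbours_hub: "earlier_neighbours hub_triangles hub_neighbours"
  by code_simp+

lemma adjacent_in_sides: "adjacent_in L i k \<Longrightarrow> \<exists>t \<in> set L. (i, k) \<in> sides t \<or> (k, i) \<in> sides t"
proof -
  assume "adjacent_in L i k"
  then obtain a b c where "(a, b, c) \<in> set L" "(i, k) \<in> set [(a, b), (b, c), (c, a), (b, a), (c, b), (a, c)]"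
    unfolding adjacent_in_def list_ex_iff by (metis (mono_tags, lifting) case_prod_conv prod_cases3)
  then show ?thesis by (intro bexI[of _ "(a, b, c)"]) (auto simp: sides_def)
qed

lemma ear_facet:
  assumes "e < 24" "t \<in> set ear_triangles"
  shows "place (ear_verts e) t \<in> set facets \<or> mirror (place (ear_verts e) t) \<in> set facets"
proof -
  have "(if even e then place (ear_verts e) t else mirror (place (ear_verts e) t)) \<in> set facets"
    unfolding facets_def set_append
    by (rule UnI1, rule in_concat_map_upt[OF _ assms(1)]) (simp add: assms(2))
  then show ?thesis by (simp split: if_splits)
qed

lemma pendant_facet: "h < 15 \<Longrightarrow> t \<in> set pendant_triangles \<Longrightarrow> place (pendant_verts h) t \<in> set facets"
  unfolding facets_def set_append
  by (rule UnI2, rule UnI1, rule in_concat_map_upt[of _ _ h]) simp_all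

lemma hub_facet: "h < 15 \<Longrightarrow> t \<in> set hub_triangles \<Longrightarrow> place (hub_verts h) t \<in> set facets"
  unfolding facets_def set_append
  by (rule UnI2, rule UnI2, rule UnI1, rule in_concat_map_upt[of _ _ h]) simp_all

lemma ear_verts_nth: "j < 8 \<Longrightarrow> ear_verts e ! j = 8*e + j"
proof -
  have "take 8 (ear_verts e) = map (\<lambda>j. 8*e + j) [0..<8]" by (simp add: ear_verts_def Let_def upt_rec)
  then show "j < 8 \<Longrightarrow> ear_verts e ! j = 8*e + j" by (metis add_0 diff_zero length_upt nth_map nth_take nth_upt)
qed

lemma pendant_verts_nth: "j < 7 \<Longrightarrow> pendant_verts h ! j = 192 + 7*h + j"
proof -
  have "take 7 (pendant_verts h) = map (\<lambda>j. 192 + 7*h + j) [0..<7]" by (simp add: pendant_verts_def Let_def upt_rec)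
  then show "j < 7 \<Longrightarrow> pendant_verts h ! j = 192 + 7*h + j" by (metis add_0 diff_zero length_upt nth_map nth_take nth_upt)
qed

lemma hub_verts_nth: "j < 5 \<Longrightarrow> hub_verts h ! (5 + j) = 297 + 5*h + j"
proof -
  have "drop 5 (hub_verts h) = map (\<lambda>j. 297 + 5*h + j) [0..<5]" by (simp add: hub_verts_def Let_def upt_rec)
  moreover have "length (hub_verts h) = 10" by (simp add: hub_verts_def Let_def)
  ultimately show "j < 5 \<Longrightarrow> hub_verts h ! (5 + j) = 297 + 5*h + j"
    by (metis add_0 diff_zero length_upt nth_map nth_upt nth_drop le_add_same_cancel1 numeral_Bit0_eq_double numeral_le_iff zero_le semiring_norm(69) semiring_norm(72) le_numeral_extra(4) numeral_Bit0 trans_le_add2)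
qed

lemma length_filter_upt: "length (filter P [0..<n]) = (\<Sum>j<n. of_bool (P j))"
  by (induction n) simp_all

lemma hub_members:
  "list_all (\<lambda>e. 8*e \<in> set (hub_verts (5*(e div 8) + e div 2 mod 4)) \<and> 8*e+7 \<in> set (hub_verts (5*(e div 8) + e div 2 mod 4 + 1))) [0..<24]"
  "list_all (\<lambda>h. 192+7*h \<in> set (hub_verts h)) [0..<15]"
  "list_all (\<lambda>i. 372+i \<in> set (hub_verts (5*i)) \<and> 372+i \<in> set (hub_verts (5*((i+2) mod 3))) \<and>
     375+i \<in> set (hub_verts (5*i+4)) \<and> 375+i \<in> set (hub_verts (5*((i+2) mod 3)+4))) [0..<3]"
  "list_all (\<lambda>h. distinct (take 5 (hub_verts h)) \<and> list_all (\<lambda>v. v < 297 \<or> 372 \<le> v \<and> v < 429) (take 5 (hub_verts h))) [0..<15]"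
  by code_simp+

lemma ear_link_in_hub:
  assumes "e < 24"
  shows "8*e \<in> set (hub_verts (5*(e div 8) + e div 2 mod 4))" "8*e+7 \<in> set (hub_verts (5*(e div 8) + e div 2 mod 4 + 1))"
  using hub_members(1) assms by (auto simp: list_all_iff)

lemma corner_range: "378 \<le> corner i j" "corner i j < 429"
proof -
  have "i mod 3 \<le> 2" "j mod 18 div 3 \<le> 5" by (simp_all add: less_Suc_eq_le[symmetric] less_mult_imp_div_less numeral_eq_Suc[of "Num.Bit0 num.One"])
  then show "378 \<le> corner i j" "corner i j < 429" by (auto simp: corner_def Let_def)
qed

lemma ear_cuts_range: "e < 24 \<Longrightarrow> v \<in> {ear_verts e ! 8, ear_verts e ! 9, ear_verts e ! 10} \<Longrightarrow> 378 \<le> v \<and> v < 429"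
proof -
  assume e: "e < 24"
  then have "e div 8 \<le> 2" "e div 2 mod 4 \<le> 3" by (simp_all add: less_Suc_eq_le[symmetric] less_mult_imp_div_less)
  moreover assume "v \<in> {ear_verts e ! 8, ear_verts e ! 9, ear_verts e ! 10}"
  ultimately show "378 \<le> v \<and> v < 429" using corner_range by (auto simp: ear_verts_def Let_def)
qed

lemma pendant_cuts_range: "v \<in> {pendant_verts h ! 7, pendant_verts h ! 8, pendant_verts h ! 9} \<Longrightarrow> 378 \<le> v \<and> v < 429"
  using corner_range by (auto simp: pendant_verts_def Let_def)

text \<open>The common cut vertex is left out for pendants, as two ears of its face contain it. This
  way every cut vertex occurs in two lists.\<close>

definition gadget_cuts :: "nat \<Rightarrow> nat list" where
  "gadget_cuts g = (if g < 24 then [ear_verts g ! 8, ear_verts g ! 9, ear_verts g ! 10]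
     else [pendant_verts (g - 24) ! 7, pendant_verts (g - 24) ! 9])"

lemma gadget_cuts_table:
  "map gadget_cuts [0..<39] =
    [[391,392,378], [416,427,378], [393,394,379], [427,428,379], [395,396,380], [428,426,380],
     [397,398,381], [426,425,381], [404,405,382], [390,401,382], [406,407,383], [401,402,383],
     [408,409,384], [402,400,384], [410,411,385], [400,399,385], [417,418,386], [403,414,386],
     [419,420,387], [414,415,387], [421,422,388], [415,413,388], [423,424,389], [413,412,389], [390,391],
     [392,393], [394,395], [396,397], [398,399], [403,404], [405,406], [407,408], [409,410], [411,412],
     [416,417], [418,419], [420,421], [422,423], [424,425]]"
  by code_simp

lemma cut_vertex_in_two_gadgets_table:
  "list_all (\<lambda>v. 2 \<le> length (filter (\<lambda>l. v \<in> set l) (map gadget_cuts [0..<39]))) [378..<429]"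
  unfolding gadget_cuts_table by code_simp

lemma cut_vertex_in_two_gadgets:
  assumes "378 \<le> v" "v < 429"
  shows "2 \<le> (\<Sum>g<39. of_bool (v \<in> set (gadget_cuts g)) :: nat)"
proof -
  have "2 \<le> length (filter (\<lambda>g. v \<in> set (gadget_cuts g)) [0..<39])"
    using bspec[OF cut_vertex_in_two_gadgets_table[unfolded list_all_iff], of v] assms
    by (simp only: filter_map comp_def length_map set_upt atLeastLessThan_iff simp_thms)
  then show ?thesis by (simp only: length_filter_upt)
qed

lemma sum_blocks: "(\<Sum>v<a + k * n. g v) = (\<Sum>v<a. g v) + (\<Sum>i<n. \<Sum>j<k. g (a + k * i + j))" for g :: "nat \<Rightarrow> nat"
proof (induction n)
  case (Suc n)
  have "(\<Sum>v<m + k. g v) = (\<Sum>v<m. g v) + (\<Sum>j<k. g (m + j))" for m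
    by (induction k) simp_all
  from this[of "a + k * n"] Suc show ?case by (simp add: add.assoc add.commute add.left_commute)
qed simp

text \<open>\<open>f\<close> stands for the component of a surviving vertex after deleting
  \<open>W\<close>; constancy along surviving edges is all that an upper bound on the number of
  components requires.\<close>

locale vertex_cut =
  fixes W :: "nat set" and f :: "nat \<Rightarrow> 'l"
  assumes W_sub: "W \<subseteq> {..<429}"
    and adj: "t \<in> set facets \<Longrightarrow> (a, b) \<in> sides t \<Longrightarrow> a \<notin> W \<Longrightarrow> b \<notin> W \<Longrightarrow> f a = f b"
begin

definition lab :: "nat set \<Rightarrow> 'l set" where
  "lab X = f ` (X - W)"

definition w :: "nat \<Rightarrow> nat" where
  "w v = (if v \<in> W then 1 else 0)"

definition "hub_lab h = lab (set (hub_verts h))"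
definition "LH = (\<Union>h<15. hub_lab h)"
definition "LC = lab {378..<429}"
text \<open>A label is credited to hubs if it occurs there, otherwise to cut vertices, otherwise to
  the interior of a gadget. The links \<open>8*e\<close> and \<open>8*e+7\<close> count as hub
  vertices.\<close>

definition "ear_inner e = lab {8*e+1..<8*e+7} - LH - LC"
definition "pendant_inner h = lab {193+7*h..<199+7*h} - LH - LC"
definition "cut_lab g = lab (set (gadget_cuts g)) - LH"

lemma finite_lab: "finite X \<Longrightarrow> finite (lab X)"
  by (simp add: lab_def)

lemma finite_hub_lab [simp]: "finite (hub_lab h)"
  by (simp add: hub_lab_def finite_lab)

text \<open>Gadget triangles occur among the facets up to mirroring, so listed adjacencies give
  equal values of \<open>f\<close>, and the exhaustive check applies to the actual trace of
  \<open>W\<close>.\<close>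

lemma local_labelling:
  assumes T: "\<And>t. t \<in> set L \<Longrightarrow> place V t \<in> set facets \<or> mirror (place V t) \<in> set facets"
    and Ns: "earlier_neighbours L Ns" and ex: "explore \<phi> Ns []"
  shows "\<exists>ls. length ls = length Ns \<and> labelling (\<lambda>j. V ! j \<notin> W) (\<lambda>j. f (V ! j)) ls \<and> \<phi> ls"
proof -
  have lt: "i < k" "adjacent_in L i k" if "k < length Ns" "i \<in> set (Ns ! k)" for k i
    using Ns that by (auto simp: earlier_neighbours_def list_all_iff)
  have "f (V ! i) = f (V ! k)" if ki: "k < length Ns" "i \<in> set (Ns ! k)" and al: "V ! i \<notin> W" "V ! k \<notin> W" for k i
  proof -
    obtain t where t: "t \<in> set L" "(i, k) \<in> sides t \<or> (k, i) \<in> sides t"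
      using adjacent_in_sides[OF lt(2)[OF ki]] by blast
    obtain t' where "t' \<in> set facets" "(V ! i, V ! k) \<in> sides t' \<or> (V ! k, V ! i) \<in> sides t'"
      using T[OF t(1)] t(2) sides_place sides_mirror by metis
    then show ?thesis using adj al by metis
  qed
  note same = this
  have "\<exists>ls'. length ls' = length ([] :: nat list) + length Ns \<and> labelling (\<lambda>j. V ! j \<notin> W) (\<lambda>j. f (V ! j)) ls' \<and> \<phi> ls'"
    by (rule explore_sound[OF ex]) (use lt(1) same in \<open>simp_all add: labelling_def\<close>)
  then show ?thesis by simp
qed

lemma hub_lab_bounds:
  assumes "h < 15"
  shows "3 * card (hub_lab h) \<le> 3 + 2 * (\<Sum>j<5. w (297 + 5*h + j))"
    and "card (W - {297..<372}) \<le> 1 \<Longrightarrow> card (hub_lab h) \<le> 1"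
proof -
  have "\<exists>ls. length ls = length hub_neighbours \<and> labelling (\<lambda>j. hub_verts h ! j \<notin> W) (\<lambda>j. f (hub_verts h ! j)) ls \<and> hub_bound ls"
    by (rule local_labelling[OF _ earlier_neighbours_hub hub_check]) (simp add: hub_facet[OF assms])
  then obtain ls where ls: "length ls = 10" "labelling (\<lambda>j. hub_verts h ! j \<notin> W) (\<lambda>j. f (hub_verts h ! j)) ls" "hub_bound ls"
    by (auto simp: hub_neighbours_def eval_nat_numeral)
  have len: "length (hub_verts h) = 10" by (simp add: hub_verts_def Let_def)
  have "set (hub_verts h) = (!) (hub_verts h) ` set [0,1,2,3,4,5,6,7,8,9]"
  proof -
    have "set (hub_verts h) = (!) (hub_verts h) ` {0..<10}" using nth_image[of 10 "hub_verts h"] len by simp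
    also have "{0..<10} = set [0..<10]" by simp
    also have "[0..<10] = [0,1,2,3,4,5,6,7,8,9]" by (simp add: upt_rec)
    finally show ?thesis .
  qed
  then have "hub_lab h \<subseteq> (\<lambda>j. f (hub_verts h ! j)) ` {j \<in> set [0,1,2,3,4,5,6,7,8,9]. hub_verts h ! j \<notin> W}"
    unfolding hub_lab_def lab_def by auto
  then have le: "card (hub_lab h) \<le> new_labels ls [0,1,2,3,4,5,6,7,8,9] []"
    using ls(1) by (intro card_le_new_labels[OF ls(2)]) auto
  have "dead_count ls [5,6,7,8,9] = length (filter (\<lambda>j. \<not> hub_verts h ! j \<notin> W) [5,6,7,8,9])"
    using ls(1) by (intro dead_count_eq[OF ls(2)]) auto
  also have "\<dots> = length (filter (\<lambda>j. \<not> hub_verts h ! (5 + j) \<notin> W) [0..<5])"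
    by (simp add: upt_rec)
  also have "\<dots> = (\<Sum>j<5. w (297 + 5*h + j))"
    unfolding length_filter_upt w_def by (intro sum.cong refl) (simp add: hub_verts_nth)
  finally show "3 * card (hub_lab h) \<le> 3 + 2 * (\<Sum>j<5. w (297 + 5*h + j))"
    using ls(3) le by (simp add: hub_bound_def Let_def)
  assume W1: "card (W - {297..<372}) \<le> 1"
  have "dead_count ls [0,1,2,3,4] = length (filter (\<lambda>j. \<not> hub_verts h ! j \<notin> W) [0,1,2,3,4])"
    using ls(1) by (intro dead_count_eq[OF ls(2)]) auto
  also have "\<dots> = length (filter (\<lambda>v. v \<in> W) (take 5 (hub_verts h)))"
    by (simp add: hub_verts_def Let_def)
  also have "\<dots> = card (set (filter (\<lambda>v. v \<in> W) (take 5 (hub_verts h))))"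
    using hub_members(4) assms by (intro distinct_card[symmetric] distinct_filter) (auto simp: list_all_iff)
  also have "\<dots> \<le> card (W - {297..<372})"
  proof (rule card_mono)
    show "finite (W - {297..<372})" using W_sub finite_subset by blast
    have "v < 297 \<or> 372 \<le> v" if "v \<in> set (take 5 (hub_verts h))" for v
      using hub_members(4) assms that unfolding list_all_iff by fastforce
    then show "set (filter (\<lambda>v. v \<in> W) (take 5 (hub_verts h))) \<subseteq> W - {297..<372}"
      by fastforce
  qed
  finally have "new_labels ls [0,1,2,3,4,5,6,7,8,9] [] \<le> 1" using ls(3) W1 by (simp add: hub_bound_def Let_def)
  then show "card (hub_lab h) \<le> 1" using le by simp
qed

lemma hub_lab_LH: "h < 15 \<Longrightarrow> v \<in> set (hub_verts h) \<Longrightarrow> v \<notin> W \<Longrightarrow> f v \<in> LH"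
  by (auto simp: LH_def hub_lab_def lab_def)

lemma ear_link_LH:
  assumes "e < 24" "v = 8*e \<or> v = 8*e+7" "v \<notin> W"
  shows "f v \<in> LH"
proof -
  have "e div 8 < 3" "e div 2 mod 4 < 4" using assms(1) by auto
  then have "5*(e div 8) + e div 2 mod 4 < 15" "5*(e div 8) + e div 2 mod 4 + 1 < 15" by linarith+
  then show ?thesis
    using assms(2,3) ear_link_in_hub[OF assms(1)] hub_lab_LH by metis
qed

lemma cut_LC: "378 \<le> v \<Longrightarrow> v < 429 \<Longrightarrow> v \<notin> W \<Longrightarrow> f v \<in> LC"
  by (auto simp: LC_def lab_def)

text \<open>\<open>b\<close> says that the ear does not conduct within itself. It cannot be read off
  from \<open>f\<close>, which may agree on both links because of a connection outside; it depends
  on a local labelling that is merely known to exist, so \<open>blocked\<close> is chosen to satisfy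
  these consequences.\<close>

definition ear_state :: "nat \<Rightarrow> bool \<Rightarrow> bool" where
  "ear_state e b \<longleftrightarrow>
    (let p = ear_verts e ! 8 \<in> W; q = ear_verts e ! 9 \<in> W; s = ear_verts e ! 10 \<in> W in
    3 * card (ear_inner e) + 2 * card (cut_lab e) + (if b then (if p \<and> q then 0 else 1) + (if s then 0 else 1) else 0)
      \<le> (if p \<and> q then 1 else 0) + 2 * (\<Sum>j<8. w (8*e + j)) \<and>
    (\<not> b \<longrightarrow> 8*e \<notin> W \<and> 8*e+7 \<notin> W \<and> f (8*e) = f (8*e+7)) \<and>
    (cut_lab e \<noteq> {} \<longrightarrow> b) \<and> (ear_inner e \<noteq> {} \<longrightarrow> p \<and> q \<or> p \<and> s \<or> q \<and> s))"

definition "blocked e = (SOME b. ear_state e b)"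

lemma ear_state_blocked:
  assumes e: "e < 24"
  shows "ear_state e (blocked e)"
proof -
  define p q s where "p \<longleftrightarrow> ear_verts e ! 8 \<in> W" and "q \<longleftrightarrow> ear_verts e ! 9 \<in> W" and "s \<longleftrightarrow> ear_verts e ! 10 \<in> W"
  let ?V = "ear_verts e"
  have "\<exists>ls. length ls = length ear_neighbours \<and> labelling (\<lambda>j. ?V ! j \<notin> W) (\<lambda>j. f (?V ! j)) ls \<and> ear_bound ls"
    by (rule local_labelling[OF _ earlier_neighbours_ear ear_check]) (rule ear_facet[OF e])
  then obtain ls where ls: "length ls = 11" "labelling (\<lambda>j. ?V ! j \<notin> W) (\<lambda>j. f (?V ! j)) ls" "ear_bound ls"
    by (auto simp: ear_neighbours_def eval_nat_numeral)
  have cuts: "f (?V ! j) \<in> LC" if "j \<in> {8, 9, 10}" "?V ! j \<notin> W" for j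
    using ear_cuts_range[OF e, of "?V ! j"] that cut_LC[of "?V ! j"] by auto
  have "ear_inner e \<subseteq> (\<lambda>j. f (?V ! j)) ` {j \<in> set [1,2,3,4,5,6]. ?V ! j \<notin> W} - (\<lambda>j. f (?V ! j)) ` {j \<in> set [0,7,8,9,10]. ?V ! j \<notin> W}"
  proof
    fix l assume l: "l \<in> ear_inner e"
    then obtain v where v: "8*e+1 \<le> v" "v < 8*e+7" "v \<notin> W" "l = f v" and nl: "l \<notin> LH" "l \<notin> LC"
      by (auto simp: ear_inner_def lab_def)
    then consider "v = 8*e+1" | "v = 8*e+2" | "v = 8*e+3" | "v = 8*e+4" | "v = 8*e+5" | "v = 8*e+6" by linarith
    then obtain j where j: "j \<in> set [1,2,3,4,5,6]" "v = 8*e+j"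
      by cases fastforce+
    then have "?V ! j = v" using ear_verts_nth[of j] by auto
    then have "l \<in> (\<lambda>j. f (?V ! j)) ` {j \<in> set [1,2,3,4,5,6]. ?V ! j \<notin> W}" using v j j by (intro image_eqI[of _ _ j]) auto
    moreover have "l \<noteq> f (?V ! j)" if "j \<in> set [0,7,8,9,10]" "?V ! j \<notin> W" for j
      using nl cuts[of j] ear_link_LH[OF e, of "?V ! j"] that by (auto simp: ear_verts_nth)
    ultimately show "l \<in> (\<lambda>j. f (?V ! j)) ` {j \<in> set [1,2,3,4,5,6]. ?V ! j \<notin> W} - (\<lambda>j. f (?V ! j)) ` {j \<in> set [0,7,8,9,10]. ?V ! j \<notin> W}"
      by blast
  qed
  then have inner: "card (ear_inner e) \<le> new_labels ls [1,2,3,4,5,6] [0,7,8,9,10]"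
    using ls(1) by (intro card_le_new_labels[OF ls(2)]) auto
  have "cut_lab e \<subseteq> (\<lambda>j. f (?V ! j)) ` {j \<in> set [8,9,10]. ?V ! j \<notin> W} - (\<lambda>j. f (?V ! j)) ` {j \<in> set [0,7]. ?V ! j \<notin> W}"
    using ear_link_LH[OF e] by (auto simp: cut_lab_def lab_def gadget_cuts_def e ear_verts_nth)
  then have cut: "card (cut_lab e) \<le> new_labels ls [8,9,10] [0,7]"
    using ls(1) by (intro card_le_new_labels[OF ls(2)]) auto
  have "dead_count ls [0,1,2,3,4,5,6,7] = length (filter (\<lambda>j. \<not> ?V ! j \<notin> W) [0,1,2,3,4,5,6,7])"
    using ls(1) by (intro dead_count_eq[OF ls(2)]) auto
  also have "\<dots> = length (filter (\<lambda>j. \<not> ?V ! j \<notin> W) [0..<8])"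
  proof -
    have "[0..<8] = [0,1,2,3,4,5,6,7]" by code_simp
    then show ?thesis by simp
  qed
  also have "\<dots> = (\<Sum>j<8. w (8*e + j))"
    unfolding length_filter_upt w_def by (intro sum.cong refl) (simp add: ear_verts_nth)
  finally have dead: "dead_count ls [0,1,2,3,4,5,6,7] = (\<Sum>j<8. w (8*e + j))" .
  have pqs: "ls ! 8 = 0 \<longleftrightarrow> p" "ls ! 9 = 0 \<longleftrightarrow> q" "ls ! 10 = 0 \<longleftrightarrow> s"
    using labellingD(1)[OF ls(2), of 8] labellingD(1)[OF ls(2), of 9] labellingD(1)[OF ls(2), of 10] ls(1) unfolding p_def q_def s_def by auto
  define b where "b \<longleftrightarrow> \<not> (ls ! 0 \<noteq> 0 \<and> ls ! 0 = ls ! 7)"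
  have bound: "3 * new_labels ls [1,2,3,4,5,6] [0,7,8,9,10] + 2 * new_labels ls [8,9,10] [0,7]
      + (if b then (if p \<and> q then 0 else 1) + (if s then 0 else 1) else 0) \<le> (if p \<and> q then 1 else 0) + 2 * (\<Sum>j<8. w (8*e + j))"
    "new_labels ls [8,9,10] [0,7] \<noteq> 0 \<longrightarrow> b"
    "new_labels ls [1,2,3,4,5,6] [0,7,8,9,10] \<noteq> 0 \<longrightarrow> p \<and> q \<or> p \<and> s \<or> q \<and> s"
    using ls(3) unfolding ear_bound_def Let_def dead pqs b_def by (auto split: if_splits)
  have fin: "finite (ear_inner e)" "finite (cut_lab e)"
    by (simp_all add: ear_inner_def cut_lab_def finite_lab)
  have "8*e \<notin> W \<and> 8*e+7 \<notin> W \<and> f (8*e) = f (8*e+7)" if "\<not> b"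
    using labellingD(1)[OF ls(2), of 0] labellingD(1)[OF ls(2), of 7] labellingD(3)[OF ls(2), of 0 7] that ls(1)
    by (auto simp: b_def ear_verts_nth)
  then have "ear_state e b"
    unfolding ear_state_def Let_def p_def[symmetric] q_def[symmetric] s_def[symmetric]
    using bound inner cut fin by (auto simp: card_gt_0_iff split: if_splits)
  then show ?thesis unfolding blocked_def by (rule someI)
qed

lemma pendant_bounds:
  assumes h: "h < 15"
  defines "b \<equiv> pendant_verts h ! 7 \<in> W" and "c \<equiv> pendant_verts h ! 8 \<in> W" and "a \<equiv> pendant_verts h ! 9 \<in> W"
  shows "3 * card (pendant_inner h) + 2 * card (cut_lab (24 + h))
      \<le> (if c then if b \<and> a then 3 else if b \<or> a then 1 else 0 else 0) + 2 * (\<Sum>j<7. w (192 + 7*h + j))"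
    and "pendant_inner h \<noteq> {} \<Longrightarrow> b \<and> c \<or> b \<and> a \<or> c \<and> a"
proof -
  let ?V = "pendant_verts h"
  have "\<exists>ls. length ls = length pendant_neighbours \<and> labelling (\<lambda>j. ?V ! j \<notin> W) (\<lambda>j. f (?V ! j)) ls \<and> pendant_bound ls"
    by (rule local_labelling[OF _ earlier_neighbours_pendant pendant_check]) (simp add: pendant_facet[OF h])
  then obtain ls where ls: "length ls = 10" "labelling (\<lambda>j. ?V ! j \<notin> W) (\<lambda>j. f (?V ! j)) ls" "pendant_bound ls"
    by (auto simp: pendant_neighbours_def eval_nat_numeral)
  have link: "f (?V ! 0) \<in> LH" if "?V ! 0 \<notin> W"
    using hub_lab_LH[OF h _ that] hub_members(2) h by (auto simp: list_all_iff pendant_verts_nth)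
  have cuts: "f (?V ! j) \<in> LC" if "j \<in> {7, 8, 9}" "?V ! j \<notin> W" for j
    using pendant_cuts_range[of "?V ! j" h] that cut_LC[of "?V ! j"] by auto
  have "pendant_inner h \<subseteq> (\<lambda>j. f (?V ! j)) ` {j \<in> set [1,2,3,4,5,6]. ?V ! j \<notin> W} - (\<lambda>j. f (?V ! j)) ` {j \<in> set [0,7,8,9]. ?V ! j \<notin> W}"
  proof
    fix l assume l: "l \<in> pendant_inner h"
    then obtain v where v: "193+7*h \<le> v" "v < 199+7*h" "v \<notin> W" "l = f v" and nl: "l \<notin> LH" "l \<notin> LC"
      by (auto simp: pendant_inner_def lab_def)
    then consider "v = 192+7*h+1" | "v = 192+7*h+2" | "v = 192+7*h+3" | "v = 192+7*h+4" | "v = 192+7*h+5" | "v = 192+7*h+6" by linarith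
    then obtain j where j: "j \<in> set [1,2,3,4,5,6]" "v = 192+7*h+j"
      by cases fastforce+
    then have "?V ! j = v" using pendant_verts_nth[of j] by auto
    then have "l \<in> (\<lambda>j. f (?V ! j)) ` {j \<in> set [1,2,3,4,5,6]. ?V ! j \<notin> W}" using v j j by (intro image_eqI[of _ _ j]) auto
    moreover have "l \<noteq> f (?V ! j)" if "j \<in> set [0,7,8,9]" "?V ! j \<notin> W" for j
      using nl cuts[of j] link that by auto
    ultimately show "l \<in> (\<lambda>j. f (?V ! j)) ` {j \<in> set [1,2,3,4,5,6]. ?V ! j \<notin> W} - (\<lambda>j. f (?V ! j)) ` {j \<in> set [0,7,8,9]. ?V ! j \<notin> W}"
      by blast
  qed
  then have inner: "card (pendant_inner h) \<le> new_labels ls [1,2,3,4,5,6] [0,7,8,9]"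
    using ls(1) by (intro card_le_new_labels[OF ls(2)]) auto
  have "cut_lab (24 + h) \<subseteq> (\<lambda>j. f (?V ! j)) ` {j \<in> set [7,9]. ?V ! j \<notin> W} - (\<lambda>j. f (?V ! j)) ` {j \<in> set [0]. ?V ! j \<notin> W}"
    using link by (auto simp: cut_lab_def lab_def gadget_cuts_def)
  then have cut: "card (cut_lab (24 + h)) \<le> new_labels ls [7,9] [0]"
    using ls(1) by (intro card_le_new_labels[OF ls(2)]) auto
  have "dead_count ls [0,1,2,3,4,5,6] = length (filter (\<lambda>j. \<not> ?V ! j \<notin> W) [0,1,2,3,4,5,6])"
    using ls(1) by (intro dead_count_eq[OF ls(2)]) auto
  also have "\<dots> = length (filter (\<lambda>j. \<not> ?V ! j \<notin> W) [0..<7])"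
  proof -
    have "[0..<7] = [0,1,2,3,4,5,6]" by code_simp
    then show ?thesis by simp
  qed
  also have "\<dots> = (\<Sum>j<7. w (192 + 7*h + j))"
    unfolding length_filter_upt w_def by (intro sum.cong refl) (simp add: pendant_verts_nth)
  finally have dead: "dead_count ls [0,1,2,3,4,5,6] = (\<Sum>j<7. w (192 + 7*h + j))" .
  have bca: "ls ! 7 = 0 \<longleftrightarrow> b" "ls ! 8 = 0 \<longleftrightarrow> c" "ls ! 9 = 0 \<longleftrightarrow> a"
    using labellingD(1)[OF ls(2), of 7] labellingD(1)[OF ls(2), of 8] labellingD(1)[OF ls(2), of 9] ls(1) unfolding b_def c_def a_def by auto
  note bound = ls(3)[unfolded pendant_bound_def Let_def dead bca]
  then show "3 * card (pendant_inner h) + 2 * card (cut_lab (24 + h))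
      \<le> (if c then if b \<and> a then 3 else if b \<or> a then 1 else 0 else 0) + 2 * (\<Sum>j<7. w (192 + 7*h + j))"
    using inner cut by linarith
  have "finite (pendant_inner h)" by (simp add: pendant_inner_def finite_lab)
  then show "pendant_inner h \<noteq> {} \<Longrightarrow> b \<and> c \<or> b \<and> a \<or> c \<and> a"
    using bound inner by (auto simp: card_gt_0_iff)
qed

end

section \<open>Summation over the gadgets\<close>

lemma ear_cut_positions:
  "list_all (\<lambda>i. list_all (\<lambda>d.
     ear_verts (8*i + 2*d) ! 8 = 390 + 13*i + [1,3,5,7]!d \<and> ear_verts (8*i + 2*d) ! 9 = 390 + 13*i + [2,4,6,8]!d \<and>
     ear_verts (8*((i+1) mod 3) + (2*d+1)) ! 8 = 390 + 13*i + [0,11,12,10]!d \<and>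
     ear_verts (8*((i+1) mod 3) + (2*d+1)) ! 9 = 390 + 13*i + [11,12,10,9]!d) [0..<4]) [0..<3]"
  "list_all (\<lambda>e. ear_verts e ! 10 = 378 + e div 2) [0..<24]"
  "list_all (\<lambda>i. list_all (\<lambda>k. pendant_verts (5*i + k) ! 7 = 390 + 13*i + 2*k \<and>
     pendant_verts (5*i + k) ! 8 = 390 + 13*i + 12 \<and> pendant_verts (5*i + k) ! 9 = 390 + 13*i + (2*k+1)) [0..<5]) [0..<3]"
  by code_simp+

lemma sum_numeral_lessThan:
  fixes g :: "nat \<Rightarrow> nat"
  shows "(\<Sum>j<2. g j) = g 0 + g 1" "(\<Sum>j<3. g j) = g 0 + g 1 + g 2" "(\<Sum>j<4. g j) = g 0 + g 1 + g 2 + g 3"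
    "(\<Sum>j<6. g j) = g 0 + g 1 + g 2 + g 3 + g 4 + g 5"
    "(\<Sum>j<8. g j) = g 0 + g 1 + g 2 + g 3 + g 4 + g 5 + g 6 + g 7"
  by (simp_all add: eval_nat_numeral)

text \<open>Groups the ears by the face that they border: the even ears of one path and the odd ears
  of the next.\<close>

lemma sum_ears:
  fixes g :: "nat \<Rightarrow> nat"
  shows "(\<Sum>e<24. g e) = (\<Sum>i<3. (\<Sum>d<4. g (8*i + 2*d)) + (\<Sum>d<4. g (8*((i+1) mod 3) + (2*d+1))))"
proof -
  have eight: "(\<Sum>j<8. g (8*i + j)) = (\<Sum>d<4. g (8*i + 2*d)) + (\<Sum>d<4. g (8*i + (2*d+1)))" for i
  proof -
    have "(\<Sum>j<2. h j) = h 0 + h 1" for h :: "nat \<Rightarrow> nat" by (simp add: numeral_2_eq_2)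
    then show ?thesis using sum_blocks[of "\<lambda>j. g (8*i + j)" 0 2 4] by (simp add: sum.distrib)
  qed
  have "(\<Sum>e<24. g e) = (\<Sum>i<3. \<Sum>j<8. g (8*i + j))"
    using sum_blocks[of g 0 8 3] by simp
  also have "\<dots> = (\<Sum>i<3. \<Sum>d<4. g (8*i + 2*d)) + (\<Sum>i<3. \<Sum>d<4. g (8*i + (2*d+1)))"
    unfolding eight sum.distrib ..
  finally have split: "(\<Sum>e<24. g e) = (\<Sum>i<3. \<Sum>d<4. g (8*i + 2*d)) + (\<Sum>i<3. \<Sum>d<4. g (8*i + (2*d+1)))" .
  have "(\<Sum>i<3. h i) = (\<Sum>i<3. h ((i+1) mod 3))" for h :: "nat \<Rightarrow> nat"
    by (simp add: sum_numeral_lessThan numeral_2_eq_2)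
  from this[of "\<lambda>i. \<Sum>d<4. g (8*i + (2*d+1))"]
  have "(\<Sum>i<3. \<Sum>d<4. g (8*i + (2*d+1))) = (\<Sum>i<3. \<Sum>d<4. g (8*((i+1) mod 3) + (2*d+1)))" .
  then show ?thesis unfolding split sum.distrib by simp
qed

context vertex_cut
begin

lemma w_of_bool: "w v = of_bool (v \<in> W)"
  by (simp add: w_def)

lemma card_W: "card W = (\<Sum>e<24. \<Sum>j<8. w (8*e + j)) + (\<Sum>h<15. \<Sum>j<7. w (192 + 7*h + j)) + (\<Sum>h<15. \<Sum>j<5. w (297 + 5*h + j))
    + (\<Sum>j<6. w (372 + j)) + (\<Sum>d<12. w (378 + d)) + (\<Sum>i<3. \<Sum>j<13. w (390 + 13*i + j))"
proof -
  have "card W = (\<Sum>v<429. w v)"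
    using W_sub by (simp add: w_def sum.If_cases Int_absorb1)
  moreover have "(\<Sum>v<192. w v) = (\<Sum>e<24. \<Sum>j<8. w (8*e + j))"
    using sum_blocks[of w 0 8 24] by simp
  moreover have "(\<Sum>v<297. w v) = (\<Sum>v<192. w v) + (\<Sum>h<15. \<Sum>j<7. w (192 + 7*h + j))"
    using sum_blocks[of w 192 7 15] by simp
  moreover have "(\<Sum>v<372. w v) = (\<Sum>v<297. w v) + (\<Sum>h<15. \<Sum>j<5. w (297 + 5*h + j))"
    using sum_blocks[of w 297 5 15] by simp
  moreover have "(\<Sum>v<378. w v) = (\<Sum>v<372. w v) + (\<Sum>j<6. w (372 + j))"
    using sum_blocks[of w 372 1 6] by simp
  moreover have "(\<Sum>v<390. w v) = (\<Sum>v<378. w v) + (\<Sum>d<12. w (378 + d))"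
    using sum_blocks[of w 378 1 12] by simp
  moreover have "(\<Sum>v<429. w v) = (\<Sum>v<390. w v) + (\<Sum>i<3. \<Sum>j<13. w (390 + 13*i + j))"
    using sum_blocks[of w 390 13 3] by simp
  ultimately show ?thesis by linarith
qed

definition "LS = LC - LH"

lemma finite_labels [simp]: "finite LH" "finite LS" "finite (ear_inner e)" "finite (pendant_inner h)" "finite (cut_lab g)"
  by (simp_all add: LH_def LS_def LC_def ear_inner_def pendant_inner_def cut_lab_def finite_lab)

lemma hub_core_LH: "h < 15 \<Longrightarrow> j < 5 \<Longrightarrow> 297 + 5*h + j \<notin> W \<Longrightarrow> f (297 + 5*h + j) \<in> LH"
proof -
  assume h: "h < 15" "j < 5" "297 + 5*h + j \<notin> W"
  have "length (hub_verts h) = 10" by (simp add: hub_verts_def Let_def)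
  then have "hub_verts h ! (5 + j) \<in> set (hub_verts h)" using h(2) by (intro nth_mem) simp
  then show "f (297 + 5*h + j) \<in> LH" using hub_lab_LH h hub_verts_nth[of j h] by simp
qed

lemma alive_label_cases:
  assumes "v < 429" "v \<notin> W"
  shows "f v \<in> LH \<or> f v \<in> LS \<or> (\<exists>e<24. f v \<in> ear_inner e) \<or> (\<exists>h<15. f v \<in> pendant_inner h)"
proof -
  consider "v < 192" | "192 \<le> v" "v < 297" | "297 \<le> v" "v < 372" | "372 \<le> v" "v < 378" | "378 \<le> v" by linarith
  then show ?thesis
  proof cases
    case 1
    define e where "e = v div 8"
    have e: "e < 24" "8*e \<le> v" "v < 8*e+8" using 1 unfolding e_def by presburger+
    then consider "v = 8*e \<or> v = 8*e+7" | "v \<in> {8*e+1..<8*e+7}" by fastforce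
    then show ?thesis
    proof cases
      case 2
      then have "f v \<in> lab {8*e+1..<8*e+7}" using assms(2) by (auto simp: lab_def)
      then show ?thesis using e(1) unfolding ear_inner_def LS_def by blast
    qed (use ear_link_LH[OF e(1)] assms(2) in blast)
  next
    case 2
    define h where "h = (v - 192) div 7"
    have "7*h + (v - 192) mod 7 = v - 192" "(v - 192) mod 7 < 7" unfolding h_def by simp_all
    then have h: "h < 15" "192 + 7*h \<le> v" "v < 192 + 7*h + 7" using 2 by linarith+
    then consider "v = 192 + 7*h" | "193+7*h \<le> v" "v < 199+7*h" by linarith
    then show ?thesis
    proof cases
      case 1
      have "192 + 7*h \<in> set (hub_verts h)" using hub_members(2) h(1) by (simp add: list_all_iff)
      then show ?thesis using hub_lab_LH[OF h(1)] assms(2) 1 by simp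
    next
      case 2
      then have "f v \<in> lab {193+7*h..<199+7*h}" using assms(2) by (auto simp: lab_def)
      then show ?thesis using h(1) unfolding pendant_inner_def LS_def by blast
    qed
  next
    case 3
    define h j where "h = (v - 297) div 5" and "j = (v - 297) mod 5"
    have "5*h + j = v - 297" "j < 5" unfolding h_def j_def by simp_all
    then have "h < 15" "j < 5" "v = 297 + 5*h + j" using 3 by linarith+
    then show ?thesis using hub_core_LH assms(2) by blast
  next
    case 4
    have ends: "372 + i \<in> set (hub_verts (5*i))" "375 + i \<in> set (hub_verts (5*i + 4))" if "i < 3" for i
      using bspec[OF hub_members(3)[unfolded list_all_iff], of i] that by simp_all
    have "(\<exists>i<3. v = 372 + i) \<or> (\<exists>i<3. v = 375 + i)" using 4 by presburger
    then have "\<exists>h<15. v \<in> set (hub_verts h)"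
    proof (elim disjE exE conjE)
      fix i assume "i < 3" "v = 372 + i"
      then show ?thesis using ends(1) by (intro exI[of _ "5*i"]) simp
    next
      fix i assume "i < 3" "v = 375 + i"
      then show ?thesis using ends(2) by (intro exI[of _ "5*i + 4"]) simp
    qed
    then show ?thesis using hub_lab_LH assms(2) by blast
  next
    case 5
    then show ?thesis using cut_LC[OF _ assms] by (auto simp: LS_def)
  qed
qed

lemma label_count:
  "card (f ` ({..<429} - W)) \<le> card LH + card LS + (\<Sum>e<24. card (ear_inner e)) + (\<Sum>h<15. card (pendant_inner h))"
proof -
  have "f ` ({..<429} - W) \<subseteq> LH \<union> LS \<union> (\<Union>e<24. ear_inner e) \<union> (\<Union>h<15. pendant_inner h)"
    using alive_label_cases by fastforce
  then have "card (f ` ({..<429} - W)) \<le> card (LH \<union> LS \<union> (\<Union>e<24. ear_inner e) \<union> (\<Union>h<15. pendant_inner h))"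
    by (intro card_mono) auto
  also have "\<dots> \<le> card LH + card LS + card (\<Union>e<24. ear_inner e) + card (\<Union>h<15. pendant_inner h)"
    using card_Un_le[of "LH \<union> LS \<union> (\<Union>e<24. ear_inner e)" "\<Union>h<15. pendant_inner h"]
      card_Un_le[of "LH \<union> LS" "\<Union>e<24. ear_inner e"] card_Un_le[of LH LS] by linarith
  also have "\<dots> \<le> card LH + card LS + (\<Sum>e<24. card (ear_inner e)) + (\<Sum>h<15. card (pendant_inner h))"
    by (intro add_mono card_UN_le order_refl) simp_all
  finally show ?thesis .
qed

lemma gadget_cuts_range: "g < 39 \<Longrightarrow> v \<in> set (gadget_cuts g) \<Longrightarrow> 378 \<le> v \<and> v < 429"
  using ear_cuts_range[of g v] pendant_cuts_range[of v "g - 24"] by (auto simp: gadget_cuts_def split: if_splits)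

lemma cut_lab_LS: "g < 39 \<Longrightarrow> cut_lab g \<subseteq> LS"
  using gadget_cuts_range by (fastforce simp: cut_lab_def LS_def LC_def lab_def)

lemma LS_in_cut_lab:
  assumes "l \<in> LS"
  shows "\<exists>v. 378 \<le> v \<and> v < 429 \<and> (\<forall>g. v \<in> set (gadget_cuts g) \<longrightarrow> l \<in> cut_lab g)"
proof -
  obtain v where "v \<in> {378..<429}" "v \<notin> W" "l = f v" "l \<notin> LH" using assms by (auto simp: LS_def LC_def lab_def)
  then have "l \<in> cut_lab g" if "v \<in> set (gadget_cuts g)" for g
    using that by (auto simp: cut_lab_def lab_def)
  then show ?thesis using \<open>v \<in> {378..<429}\<close> by (intro exI[of _ v]) simp
qed

text \<open>Double counting: a label in \<open>LS\<close> sits at a cut vertex, which occurs in at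
  least two lists.\<close>

lemma card_LS: "2 * card LS \<le> (\<Sum>g<39. card (cut_lab g))"
proof -
  have "2 * card LS = (\<Sum>l\<in>LS. 2)" by simp
  also have "\<dots> \<le> (\<Sum>l\<in>LS. \<Sum>g<39. of_bool (l \<in> cut_lab g))"
  proof (rule sum_mono)
    fix l assume "l \<in> LS"
    then obtain v where v: "378 \<le> v" "v < 429" "\<And>g. v \<in> set (gadget_cuts g) \<Longrightarrow> l \<in> cut_lab g"
      using LS_in_cut_lab by blast
    have "2 \<le> (\<Sum>g<39. of_bool (v \<in> set (gadget_cuts g)) :: nat)" by (rule cut_vertex_in_two_gadgets[OF v(1,2)])
    also have "\<dots> \<le> (\<Sum>g<39. of_bool (l \<in> cut_lab g))" using v(3) by (intro sum_mono) (auto simp: of_bool_def)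
    finally show "2 \<le> (\<Sum>g<39. of_bool (l \<in> cut_lab g) :: nat)" .
  qed
  also have "\<dots> = (\<Sum>g<39. \<Sum>l\<in>LS. of_bool (l \<in> cut_lab g))" by (rule sum.swap)
  also have "\<dots> = (\<Sum>g<39. card (cut_lab g))"
  proof (intro sum.cong refl)
    fix g :: nat assume "g \<in> {..<39}"
    then have "cut_lab g \<subseteq> LS" using cut_lab_LS by simp
    then have "(\<Sum>l\<in>LS. of_bool (l \<in> cut_lab g) :: nat) = card (LS \<inter> cut_lab g)" by (simp add: of_bool_def sum.If_cases)
    also have "LS \<inter> cut_lab g = cut_lab g" using \<open>cut_lab g \<subseteq> LS\<close> by blast
    finally show "(\<Sum>l\<in>LS. of_bool (l \<in> cut_lab g) :: nat) = card (cut_lab g)" .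
  qed
  finally show ?thesis .
qed

end

section \<open>Costs of faces and digons, and hub labels on the theta graph\<close>

definition face_ears :: "(nat \<Rightarrow> nat) \<Rightarrow> nat \<Rightarrow> nat" where
  "face_ears g i = (\<Sum>d<4. g (8*i + 2*d)) + (\<Sum>d<4. g (8*((i+1) mod 3) + (2*d+1)))"

lemma face_ears_zeroD: "face_ears g i = 0 \<Longrightarrow> d < 4 \<Longrightarrow> g (8*i + 2*d) = 0 \<and> g (8*((i+1) mod 3) + (2*d+1)) = 0"
  by (simp add: face_ears_def)

lemma face_ears_cong:
  assumes "\<And>d. d < 4 \<Longrightarrow> g (8*i + 2*d) = h (8*i + 2*d)"
    "\<And>d. d < 4 \<Longrightarrow> g (8*((i+1) mod 3) + (2*d+1)) = h (8*((i+1) mod 3) + (2*d+1))"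
  shows "face_ears g i = face_ears h i"
  unfolding face_ears_def by (intro arg_cong2[of _ _ _ _ "(+)"] sum.cong refl) (use assms in auto)

context vertex_cut
begin

definition "cut_dead i j \<longleftrightarrow> 390 + 13*i + j \<in> W"
definition "n i = (\<Sum>j<13. w (390 + 13*i + j))"
text \<open>\<open>ear_gain\<close> and \<open>ear_cost\<close> belong to the face side of an ear,
  \<open>ear_cost'\<close> to its digon side.\<close>

definition ear_gain :: "nat \<Rightarrow> nat" where
  "ear_gain e = of_bool (ear_verts e ! 8 \<in> W \<and> ear_verts e ! 9 \<in> W)"
definition ear_cost :: "nat \<Rightarrow> nat" where
  "ear_cost e = of_bool (blocked e \<and> \<not> (ear_verts e ! 8 \<in> W \<and> ear_verts e ! 9 \<in> W))"
definition ear_cost' :: "nat \<Rightarrow> nat" where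
  "ear_cost' e = of_bool (blocked e \<and> 378 + e div 2 \<notin> W)"
definition pendant_gain :: "nat \<Rightarrow> nat" where
  "pendant_gain h = (if pendant_verts h ! 8 \<in> W then if pendant_verts h ! 7 \<in> W \<and> pendant_verts h ! 9 \<in> W then 3
     else if pendant_verts h ! 7 \<in> W \<or> pendant_verts h ! 9 \<in> W then 1 else 0 else 0)"
definition "digon_cost d = ear_cost' (2*d) + ear_cost' (2*d+1) + 2 * w (378 + d)"
text \<open>The subtraction of naturals is never truncated, by
  \<open>corner_gain_le\<close>.\<close>

definition "face_cost i = 2 * n i + face_ears ear_cost i - corner_gain (cut_dead i)"
definition "core = (\<Sum>h<15. \<Sum>j<5. w (297 + 5*h + j))"

lemma ear_ineq:
  assumes e: "e < 24"
  shows "3 * card (ear_inner e) + 2 * card (cut_lab e) + ear_cost e + ear_cost' e \<le> ear_gain e + 2 * (\<Sum>j<8. w (8*e + j))"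
proof -
  have "ear_verts e ! 10 = 378 + e div 2" using ear_cut_positions(2) e by (simp add: list_all_iff)
  with ear_state_blocked[OF e] show ?thesis
    unfolding ear_state_def ear_cost_def ear_cost'_def ear_gain_def by (auto simp: Let_def split: if_splits)
qed

lemma pendant_ineq:
  assumes h: "h < 15"
  shows "3 * card (pendant_inner h) + 2 * card (cut_lab (24 + h)) \<le> pendant_gain h + 2 * (\<Sum>j<7. w (192 + 7*h + j))"
  using pendant_bounds(1)[OF h] unfolding pendant_gain_def by simp

lemma corner_gain_face:
  assumes i: "i < 3"
  shows "corner_gain (cut_dead i) = face_ears ear_gain i + (\<Sum>k<5. pendant_gain (5*i + k))"
proof -
  have ears: "ear_gain (8*i + 2*d) = of_bool (cut_dead i ([1,3,5,7]!d) \<and> cut_dead i ([2,4,6,8]!d))"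
    "ear_gain (8*((i+1) mod 3) + (2*d+1)) = of_bool (cut_dead i ([0,11,12,10]!d) \<and> cut_dead i ([11,12,10,9]!d))" if "d < 4" for d
    using ear_cut_positions(1) i that unfolding list_all_iff ear_gain_def cut_dead_def by auto
  have "pendant_gain (5*i + k) = (if cut_dead i 12 then if cut_dead i (2*k) \<and> cut_dead i (2*k+1) then 3
      else if cut_dead i (2*k) \<or> cut_dead i (2*k+1) then 1 else 0 else 0)" if "k < 5" for k
    using ear_cut_positions(3) i that unfolding list_all_iff pendant_gain_def cut_dead_def by auto
  then have "(\<Sum>k<5. pendant_gain (5*i + k)) = (\<Sum>k<5. if cut_dead i 12 then if cut_dead i (2*k) \<and> cut_dead i (2*k+1) then 3
      else if cut_dead i (2*k) \<or> cut_dead i (2*k+1) then 1 else 0 else 0)"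
    by (intro sum.cong refl) simp
  moreover have "(\<Sum>d<4. ear_gain (8*i + 2*d)) = of_bool (cut_dead i 1 \<and> cut_dead i 2) + of_bool (cut_dead i 3 \<and> cut_dead i 4)
      + of_bool (cut_dead i 5 \<and> cut_dead i 6) + of_bool (cut_dead i 7 \<and> cut_dead i 8)"
    using ears(1)[of 0] ears(1)[of 1] ears(1)[of 2] ears(1)[of 3] unfolding sum_numeral_lessThan by simp
  moreover have "(\<Sum>d<4. ear_gain (8*((i+1) mod 3) + (2*d+1))) = of_bool (cut_dead i 0 \<and> cut_dead i 11) + of_bool (cut_dead i 11 \<and> cut_dead i 12)
      + of_bool (cut_dead i 12 \<and> cut_dead i 10) + of_bool (cut_dead i 10 \<and> cut_dead i 9)"
    using ears(2)[of 0] ears(2)[of 1] ears(2)[of 2] ears(2)[of 3] unfolding sum_numeral_lessThan by simp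
  ultimately show ?thesis unfolding corner_gain_def face_ears_def by linarith
qed

lemma n_dead: "n i = (\<Sum>j<13. of_bool (cut_dead i j))"
  by (simp add: n_def w_of_bool cut_dead_def)

lemma corner_gain_le: "corner_gain (cut_dead i) \<le> 2 * n i"
  using corner_gain_bound[of "cut_dead i"] unfolding n_dead[symmetric] by (cases "n i \<le> 1") auto

lemma face_cost_many: "2 \<le> n i \<Longrightarrow> 3 \<le> face_cost i"
  using corner_gain_bound(2)[of "cut_dead i"] unfolding n_dead[symmetric] face_cost_def by linarith

lemma face_cost_few:
  assumes "i < 3" "n i \<le> 1"
  shows "face_cost i = 2 * n i + face_ears (\<lambda>e. of_bool (blocked e)) i"
proof -
  have g: "corner_gain (cut_dead i) = 0" using corner_gain_bound(1)[of "cut_dead i"] assms(2) unfolding n_dead[symmetric] .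
  then have "face_ears ear_gain i = 0" using corner_gain_face[OF assms(1)] by linarith
  from face_ears_zeroD[OF this] have "face_ears ear_cost i = face_ears (\<lambda>e. of_bool (blocked e)) i"
    by (intro face_ears_cong) (simp_all add: ear_gain_def ear_cost_def)
  then show ?thesis unfolding face_cost_def g by simp
qed

text \<open>The balance over all gadgets. Twice the sum of the cut labels is at least
  \<open>4 * card LS\<close>; three quarters of that pay for these components, and the rest stays on
  the left. What remains to be shown elsewhere is that the surplus on the left covers
  \<open>3 * card LH\<close>.\<close>

lemma component_bound:
  "3 * card (f ` ({..<429} - W)) + card LS + (\<Sum>d<12. digon_cost d) + (\<Sum>i<3. face_cost i) + 2 * core + 2 * (\<Sum>j<6. w (372 + j))
    \<le> 3 * card LH + 2 * card W"
proof -
  have "3 * (\<Sum>e<24. card (ear_inner e)) + 2 * (\<Sum>e<24. card (cut_lab e)) + (\<Sum>e<24. ear_cost e) + (\<Sum>e<24. ear_cost' e)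
      \<le> (\<Sum>e<24. ear_gain e) + 2 * (\<Sum>e<24. \<Sum>j<8. w (8*e + j))"
    unfolding sum_distrib_left[of _ _ "{..<24}"] sum.distrib[symmetric] by (intro sum_mono ear_ineq) simp
  moreover have "3 * (\<Sum>h<15. card (pendant_inner h)) + 2 * (\<Sum>h<15. card (cut_lab (24 + h)))
      \<le> (\<Sum>h<15. pendant_gain h) + 2 * (\<Sum>h<15. \<Sum>j<7. w (192 + 7*h + j))"
    unfolding sum_distrib_left[of _ _ "{..<15}"] sum.distrib[symmetric] by (intro sum_mono pendant_ineq) simp
  moreover have "(\<Sum>g<39. card (cut_lab g)) = (\<Sum>e<24. card (cut_lab e)) + (\<Sum>h<15. card (cut_lab (24 + h)))"
    using sum_blocks[of "\<lambda>g. card (cut_lab g)" 24 1 15] by simp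
  moreover have "(\<Sum>e<24. ear_cost e) = (\<Sum>i<3. face_ears ear_cost i)" "(\<Sum>e<24. ear_gain e) = (\<Sum>i<3. face_ears ear_gain i)"
    unfolding face_ears_def by (rule sum_ears)+
  moreover have "(\<Sum>h<15. pendant_gain h) = (\<Sum>i<3. \<Sum>k<5. pendant_gain (5*i + k))"
    using sum_blocks[of pendant_gain 0 5 3] by simp
  moreover have "(\<Sum>i<3. corner_gain (cut_dead i)) = (\<Sum>i<3. face_ears ear_gain i) + (\<Sum>i<3. \<Sum>k<5. pendant_gain (5*i + k))"
    unfolding sum.distrib[symmetric] by (intro sum.cong refl corner_gain_face) simp
  moreover have "(\<Sum>i<3. face_cost i) + (\<Sum>i<3. corner_gain (cut_dead i)) = 2 * (\<Sum>i<3. n i) + (\<Sum>i<3. face_ears ear_cost i)"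
    unfolding sum_distrib_left sum.distrib[symmetric]
    by (intro sum.cong refl) (use corner_gain_le in \<open>simp add: face_cost_def trans_le_add1\<close>)
  moreover have "(\<Sum>e<24. ear_cost' e) + 2 * (\<Sum>d<12. w (378 + d)) = (\<Sum>d<12. digon_cost d)"
  proof -
    have "(\<Sum>d<12. digon_cost d) = (\<Sum>d<12. ear_cost' (2*d) + ear_cost' (2*d+1)) + 2 * (\<Sum>d<12. w (378 + d))"
      unfolding digon_cost_def sum_distrib_left sum.distrib[symmetric] ..
    then show ?thesis using sum_blocks[of ear_cost' 0 2 12] unfolding sum_numeral_lessThan(1) by simp
  qed
  moreover have "(\<Sum>i<3. \<Sum>j<13. w (390 + 13*i + j)) = (\<Sum>i<3. n i)" by (simp add: n_def)
  ultimately show ?thesis using label_count card_LS card_W unfolding core_def by linarith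
qed

definition "double_blocked i d \<longleftrightarrow> blocked (8*i + 2*d) \<and> blocked (8*i + (2*d+1))"
definition m :: "nat \<Rightarrow> nat" where "m i = (\<Sum>d<4. of_bool (double_blocked i d))"

text \<open>If both ears of a pair are blocked, either their common cut vertex survives and each
  pays 1, or it is dead and its own 2 units are still unspent.\<close>

lemma digon_cost_sum: "2 * (\<Sum>i<3. m i) \<le> (\<Sum>d<12. digon_cost d)"
proof -
  have "2 * of_bool (double_blocked i d) \<le> digon_cost (4*i + d)" for i d
    by (auto simp: double_blocked_def digon_cost_def ear_cost'_def w_def)
  then have "(\<Sum>i<3. \<Sum>d<4. 2 * of_bool (double_blocked i d)) \<le> (\<Sum>i<3. \<Sum>d<4. digon_cost (4*i + d))"
    by (intro sum_mono)
  also have "\<dots> = (\<Sum>d<12. digon_cost d)" using sum_blocks[of digon_cost 0 4 3] by simp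
  finally show ?thesis by (simp only: m_def sum_distrib_left)
qed

text \<open>With at most one dead cut vertex in the face no blocked ear is excused from paying 1.
  With more of them the face keeps at least 3, which is where the minimum comes from.\<close>

lemma face_cost_m: "i < 3 \<Longrightarrow> min 3 (m i + m ((i+1) mod 3)) \<le> face_cost i"
proof (cases "n i \<le> 1")
  case True
  assume i: "i < 3"
  have "m i + m ((i+1) mod 3) \<le> face_ears (\<lambda>e. of_bool (blocked e)) i"
    unfolding m_def face_ears_def by (intro add_mono sum_mono) (auto simp: double_blocked_def)
  then show ?thesis using face_cost_few[OF i True] by simp
qed (use face_cost_many[of i] in simp)

lemma m_le: "m i \<le> 4"
  unfolding m_def using sum_mono[of "{..<4::nat}" "\<lambda>d. of_bool (double_blocked i d)" "\<lambda>_. 1 :: nat"] by simp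

lemma digon_link:
  assumes "i < 3" "d < 4" "\<not> double_blocked i d"
  shows "hub_lab (5*i + d) \<inter> hub_lab (5*i + (d+1)) \<noteq> {}"
proof -
  obtain b where b: "b \<in> {0, 1}" "\<not> blocked (8*i + (2*d+b))" using assms(3) unfolding double_blocked_def by force
  define e where "e = 8*i + (2*d+b)"
  have e: "e < 24" "e div 8 = i" "e div 2 mod 4 = d" using assms(1,2) b(1) unfolding e_def by auto
  have "8*e \<notin> W \<and> 8*e+7 \<notin> W \<and> f (8*e) = f (8*e+7)"
    using ear_state_blocked[OF e(1)] b(2) unfolding e_def[symmetric] ear_state_def Let_def by blast
  moreover have "8*e \<in> set (hub_verts (5*i + d))" "8*e+7 \<in> set (hub_verts (5*i + (d+1)))"
    using ear_link_in_hub[OF e(1)] unfolding e by (simp_all add: add.assoc)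
  ultimately have "f (8*e) \<in> hub_lab (5*i + d)" "f (8*e) \<in> hub_lab (5*i + (d+1))"
    unfolding hub_lab_def lab_def by (blast, metis DiffI imageI)
  then show ?thesis by blast
qed

lemma end_link:
  assumes "i < 3"
  shows "372 + i \<notin> W \<Longrightarrow> hub_lab (5*i) \<inter> hub_lab (5*((i+2) mod 3)) \<noteq> {}"
    and "375 + i \<notin> W \<Longrightarrow> hub_lab (5*i+4) \<inter> hub_lab (5*((i+2) mod 3)+4) \<noteq> {}"
  using hub_members(3) assms unfolding list_all_iff hub_lab_def lab_def by fastforce+

lemma LH_eq: "LH = (hub_lab 0 \<union> hub_lab 5 \<union> hub_lab 10) \<union> (hub_lab 4 \<union> hub_lab 9 \<union> hub_lab 14) \<union>
    (hub_lab 1 \<union> hub_lab 2 \<union> hub_lab 3) \<union> (hub_lab 6 \<union> hub_lab 7 \<union> hub_lab 8) \<union> (hub_lab 11 \<union> hub_lab 12 \<union> hub_lab 13)"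
proof -
  have "{..<15::nat} = set [0..<15]" by auto
  also have "[0..<15::nat] = [0,1,2,3,4,5,6,7,8,9,10,11,12,13,14]" by code_simp
  finally have "{..<15::nat} = set [0,1,2,3,4,5,6,7,8,9,10,11,12,13,14]" .
  then show ?thesis unfolding LH_def by auto
qed

lemma sum_hubs: "(\<Sum>h<15. g h) = g 0 + g 1 + g 2 + g 3 + g 4 + g 5 + g 6 + g 7 + g 8 + g 9 + g 10 + g 11 + g 12 + g 13 + g 14"
  for g :: "nat \<Rightarrow> nat"
  by (simp add: eval_nat_numeral)

lemma path_links_m: "i < 3 \<Longrightarrow> path_links (\<lambda>d. i < 3 \<and> d < 4 \<and> \<not> double_blocked i d) = 4 - m i"
  unfolding path_links_def m_def sum_numeral_lessThan
  by (cases "double_blocked i 0"; cases "double_blocked i 1"; cases "double_blocked i 2"; cases "double_blocked i 3") simp_all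

lemma card_LH_theta:
  "card LH + (min 2 (of_bool (373 \<notin> W) + of_bool (374 \<notin> W) + of_bool (372 \<notin> W))
      + min 2 (of_bool (376 \<notin> W) + of_bool (377 \<notin> W) + of_bool (375 \<notin> W))
      + (min 3 (4 - m 0) + min 3 (4 - m 1) + min 3 (4 - m 2) + of_bool (m 0 = 0 \<or> m 1 = 0 \<or> m 2 = 0)))
    \<le> (\<Sum>h<15. card (hub_lab h))"
proof -
  define Y where "Y i k = hub_lab (5*i + k)" for i k
  define c where "c i d \<longleftrightarrow> i < 3 \<and> d < 4 \<and> \<not> double_blocked i d" for i d
  define U where "U = hub_lab 0 \<union> hub_lab 5 \<union> hub_lab 10"
  define D where "D = hub_lab 4 \<union> hub_lab 9 \<union> hub_lab 14"
  have U: "card U + min 2 (of_bool (373 \<notin> W) + of_bool (374 \<notin> W) + of_bool (372 \<notin> W)) \<le> card (hub_lab 0) + card (hub_lab 5) + card (hub_lab 10)"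
    unfolding U_def by (rule card_three) (use end_link(1)[of 0] end_link(1)[of 1] end_link(1)[of 2] in \<open>simp_all add: Int_commute\<close>)
  have D: "card D + min 2 (of_bool (376 \<notin> W) + of_bool (377 \<notin> W) + of_bool (375 \<notin> W)) \<le> card (hub_lab 4) + card (hub_lab 9) + card (hub_lab 14)"
    unfolding D_def by (rule card_three) (use end_link(2)[of 0] end_link(2)[of 1] end_link(2)[of 2] in \<open>simp_all add: Int_commute\<close>)
  have link: "Y i d \<inter> Y i (d + 1) \<noteq> {}" if "c i d" for i d
    using digon_link[of i d] that by (simp add: c_def Y_def)
  have ends: "Y i 0 \<subseteq> U" "Y i 4 \<subseteq> D" if "c i d" for i d
  proof -
    have "i = 0 \<or> i = 1 \<or> i = 2" using that by (auto simp: c_def)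
    then show "Y i 0 \<subseteq> U" "Y i 4 \<subseteq> D" by (auto simp: Y_def U_def D_def)
  qed
  have T: "card (U \<union> D \<union> (Y 0 1 \<union> Y 0 2 \<union> Y 0 3) \<union> (Y 1 1 \<union> Y 1 2 \<union> Y 1 3) \<union> (Y 2 1 \<union> Y 2 2 \<union> Y 2 3))
      + (min 3 (path_links (c 0)) + min 3 (path_links (c 1)) + min 3 (path_links (c 2))
        + of_bool (path_links (c 0) = 4 \<or> path_links (c 1) = 4 \<or> path_links (c 2) = 4))
    \<le> card U + card D + (card (Y 0 1) + card (Y 0 2) + card (Y 0 3)) + (card (Y 1 1) + card (Y 1 2) + card (Y 1 3))
      + (card (Y 2 1) + card (Y 2 2) + card (Y 2 3))"
  proof (rule card_theta)
    show "U \<inter> Y i 1 \<noteq> {}" if "c i 0" for i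
      using link[OF that] ends(1)[OF that] by auto
    show "Y i 1 \<inter> Y i 2 \<noteq> {}" if "c i 1" for i
      using link[OF that] by (simp add: numeral_2_eq_2)
    show "Y i 2 \<inter> Y i 3 \<noteq> {}" if "c i 2" for i
      using link[OF that] by simp
    show "Y i 3 \<inter> D \<noteq> {}" if "c i 3" for i
      using link[OF that] ends(2)[OF that] by auto
  qed (simp_all add: U_def D_def Y_def)
  have links: "path_links (c i) = 4 - m i" if "i < 3" for i
    unfolding c_def by (rule path_links_m[OF that])
  have Y: "Y 0 1 = hub_lab 1" "Y 0 2 = hub_lab 2" "Y 0 3 = hub_lab 3" "Y 1 1 = hub_lab 6" "Y 1 2 = hub_lab 7" "Y 1 3 = hub_lab 8"
    "Y 2 1 = hub_lab 11" "Y 2 2 = hub_lab 12" "Y 2 3 = hub_lab 13"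
    unfolding Y_def by (intro arg_cong[of _ _ hub_lab], simp)+
  have eq4: "4 - m i = 4 \<longleftrightarrow> m i = 0" for i using m_le[of i] by linarith
  have combine: "L + (u + d + t) \<le> a + b + p + q + r"
    if "L + t \<le> U' + D' + p + q + r" "U' + u \<le> a" "D' + d \<le> b" for L t U' D' p q r u d a b :: nat
    using that by linarith
  have LH: "U \<union> D \<union> (Y 0 1 \<union> Y 0 2 \<union> Y 0 3) \<union> (Y 1 1 \<union> Y 1 2 \<union> Y 1 3) \<union> (Y 2 1 \<union> Y 2 2 \<union> Y 2 3) = LH"
    unfolding Y U_def D_def LH_eq ..
  have "path_links (c 0) = 4 - m 0" "path_links (c 1) = 4 - m 1" "path_links (c 2) = 4 - m 2" by (simp_all add: links)
  from combine[OF T[unfolded LH, unfolded this eq4 Y] U D] show ?thesis unfolding sum_hubs by (simp only: ac_simps)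
qed

text \<open>When all paths are intact, two paths are tied as soon as either of their two common end
  vertices survives. Treating the two ends separately, as for general deletions, would waste
  savings.\<close>

lemma card_LH_linked:
  assumes "m 0 = 0" "m 1 = 0" "m 2 = 0"
  shows "card LH + 12 + min 2 (of_bool (373 \<notin> W \<or> 376 \<notin> W) + of_bool (374 \<notin> W \<or> 377 \<notin> W) + of_bool (372 \<notin> W \<or> 375 \<notin> W))
    \<le> (\<Sum>h<15. card (hub_lab h))"
proof -
  define Y where "Y i k = hub_lab (5*i + k)" for i k
  have Y: "Y 0 0 = hub_lab 0" "Y 0 1 = hub_lab 1" "Y 0 2 = hub_lab 2" "Y 0 3 = hub_lab 3" "Y 0 4 = hub_lab 4" "Y 1 0 = hub_lab 5" "Y 1 1 = hub_lab 6" "Y 1 2 = hub_lab 7" "Y 1 3 = hub_lab 8" "Y 1 4 = hub_lab 9" "Y 2 0 = hub_lab 10" "Y 2 1 = hub_lab 11" "Y 2 2 = hub_lab 12" "Y 2 3 = hub_lab 13" "Y 2 4 = hub_lab 14"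
    unfolding Y_def by (intro arg_cong[of _ _ hub_lab], simp)+
  define P where "P i = Y i 0 \<union> Y i 1 \<union> Y i 2 \<union> Y i 3 \<union> Y i 4" for i
  have fin: "finite (Y i k)" for i k by (simp add: Y_def)
  have path: "card (P i) + 4 \<le> card (Y i 0) + (card (Y i 1) + card (Y i 2) + card (Y i 3)) + card (Y i 4)" if i: "i < 3" for i
  proof -
    have "i = 0 \<or> i = 1 \<or> i = 2" using i by auto
    then have "m i = 0" using assms by blast
    then have nb: "\<not> double_blocked i d" if "d < 4" for d
      using that bspec[OF \<open>m i = 0\<close>[unfolded m_def sum_eq_0_iff[OF finite_lessThan]], of d] by simp
    have link: "Y i d \<inter> Y i (d+1) \<noteq> {}" if "d < 4" for d
      unfolding Y_def by (rule digon_link[OF i that nb[OF that]])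
    have "card (Y i 0 \<union> Y i 1 \<union> Y i 2 \<union> Y i 3) + (of_bool True + of_bool True + of_bool True) \<le> card (Y i 0) + (card (Y i 1) + card (Y i 2) + card (Y i 3))"
      by (rule card_chain4) (use fin link[of 0] link[of 1] link[of 2] in \<open>auto simp: numeral_2_eq_2 numeral_3_eq_3\<close>)
    moreover have "card (P i) + of_bool True \<le> card (Y i 0 \<union> Y i 1 \<union> Y i 2 \<union> Y i 3) + card (Y i 4)"
      unfolding P_def by (rule card_Un_of_bool) (use fin link[of 3] in auto)
    ultimately show ?thesis by simp
  qed
  have cross: "P i \<inter> P ((i+2) mod 3) \<noteq> {}" if "i < 3" "372 + i \<notin> W \<or> 375 + i \<notin> W" for i
  proof -
    have "Y i 0 \<inter> Y ((i+2) mod 3) 0 \<noteq> {} \<or> Y i 4 \<inter> Y ((i+2) mod 3) 4 \<noteq> {}"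
      using end_link[OF that(1)] that(2) unfolding Y_def by auto
    moreover have "Y k 0 \<subseteq> P k" "Y k 4 \<subseteq> P k" for k unfolding P_def by blast+
    ultimately show ?thesis by blast
  qed
  have "card (P 0 \<union> P 1 \<union> P 2) + min 2 (of_bool (373 \<notin> W \<or> 376 \<notin> W) + of_bool (374 \<notin> W \<or> 377 \<notin> W) + of_bool (372 \<notin> W \<or> 375 \<notin> W))
      \<le> card (P 0) + card (P 1) + card (P 2)"
  proof (rule card_three)
    show "finite (P 0)" "finite (P 1)" "finite (P 2)" unfolding P_def using fin by simp_all
    show "P 0 \<inter> P 1 \<noteq> {}" if "373 \<notin> W \<or> 376 \<notin> W" using cross[of 1] that by (simp add: Int_commute)
    show "P 1 \<inter> P 2 \<noteq> {}" if "374 \<notin> W \<or> 377 \<notin> W" using cross[of 2] that by (simp add: Int_commute)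
    show "P 2 \<inter> P 0 \<noteq> {}" if "372 \<notin> W \<or> 375 \<notin> W" using cross[of 0] that by (simp add: Int_commute numeral_2_eq_2)
  qed
  moreover have "P 0 \<union> P 1 \<union> P 2 = LH" unfolding P_def Y LH_eq by (simp only: ac_simps)
  ultimately have tri: "card LH + min 2 (of_bool (373 \<notin> W \<or> 376 \<notin> W) + of_bool (374 \<notin> W \<or> 377 \<notin> W) + of_bool (372 \<notin> W \<or> 375 \<notin> W))
      \<le> card (P 0) + card (P 1) + card (P 2)" by simp
  have combine: "L + 12 + t \<le> a + b + c" if "L + t \<le> p + q + r" "p + 4 \<le> a" "q + 4 \<le> b" "r + 4 \<le> c" for L t p q r a b c :: nat
    using that by linarith
  have "0 < (3::nat)" "1 < (3::nat)" "2 < (3::nat)" by simp_all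
  from combine[OF tri path[OF this(1)] path[OF this(2)] path[OF this(3)], unfolded Y] show ?thesis
    unfolding sum_hubs by (simp only: ac_simps)
qed

lemma sum_hub_lab: "3 * (\<Sum>h<15. card (hub_lab h)) \<le> 45 + 2 * core"
proof -
  have "3 * (\<Sum>h<15. card (hub_lab h)) \<le> (\<Sum>h<15. 3 + 2 * (\<Sum>j<5. w (297 + 5*h + j)))"
    unfolding sum_distrib_left[of _ _ "{..<15}"] by (intro sum_mono hub_lab_bounds(1)) simp
  also have "\<dots> = 45 + 2 * core" unfolding core_def sum.distrib by (simp add: sum_distrib_left)
  finally show ?thesis .
qed

end

section \<open>Broken links, costly deletions and the borderline case\<close>

lemma ear_cuts_distinct: "list_all (\<lambda>e. ear_verts e ! 8 \<noteq> ear_verts e ! 9 \<and> ear_verts e ! 8 \<noteq> ear_verts e ! 10 \<and> ear_verts e ! 9 \<noteq> ear_verts e ! 10) [0..<24]"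
  and pendant_cuts_distinct: "list_all (\<lambda>h. pendant_verts h ! 7 \<noteq> pendant_verts h ! 8 \<and> pendant_verts h ! 7 \<noteq> pendant_verts h ! 9 \<and>
    pendant_verts h ! 8 \<noteq> pendant_verts h ! 9) [0..<15]"
  by code_simp+

context vertex_cut
begin

text \<open>Fifteen hubs start with 45. Each end triangle returns 6: intact it saves two labels
  worth 3 each, and savings lost by deleting its vertices are made up by 2 per deleted
  vertex.\<close>

lemma LH_bound_theta:
  "3 * card LH + 3 * (min 3 (4 - m 0) + min 3 (4 - m 1) + min 3 (4 - m 2) + of_bool (m 0 = 0 \<or> m 1 = 0 \<or> m 2 = 0))
    \<le> 33 + 2 * core + 2 * (\<Sum>j<6. w (372 + j))"
proof -
  define u d where "u = min 2 (of_bool (373 \<notin> W) + of_bool (374 \<notin> W) + of_bool (372 \<notin> W) :: nat)"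
    and "d = min 2 (of_bool (376 \<notin> W) + of_bool (377 \<notin> W) + of_bool (375 \<notin> W) :: nat)"
  have "6 \<le> 3 * u + 2 * (w 372 + w 373 + w 374)" unfolding u_def w_def by (simp add: of_bool_def)
  moreover have "6 \<le> 3 * d + 2 * (w 375 + w 376 + w 377)" unfolding d_def w_def by (simp add: of_bool_def)
  moreover have "(\<Sum>j<6. w (372 + j)) = (w 372 + w 373 + w 374) + (w 375 + w 376 + w 377)"
    unfolding sum_numeral_lessThan by simp
  moreover define t where "t = min 3 (4 - m 0) + min 3 (4 - m 1) + min 3 (4 - m 2) + of_bool (m 0 = 0 \<or> m 1 = 0 \<or> m 2 = 0)"
  have "card LH + (u + d + t) \<le> (\<Sum>h<15. card (hub_lab h))"
    unfolding u_def d_def t_def by (rule card_LH_theta)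
  moreover have "3 * L + 3 * t \<le> 33 + 2 * c + 2 * x"
    if "6 \<le> 3 * u + 2 * a" "6 \<le> 3 * d + 2 * b" "x = a + b" "L + (u + d + t) \<le> y" "3 * y \<le> 45 + 2 * c" for L t c x a b y u d :: nat
    using that by linarith
  ultimately show ?thesis using sum_hub_lab unfolding t_def[symmetric] by blast
qed

lemma component_bound_blocked:
  assumes "m 0 + m 1 + m 2 \<noteq> 0"
  shows "3 * card (f ` ({..<429} - W)) \<le> 2 * card W"
proof -
  define t where "t = min 3 (4 - m 0) + min 3 (4 - m 1) + min 3 (4 - m 2) + of_bool (m 0 = 0 \<or> m 1 = 0 \<or> m 2 = 0)"
  define r where "r = min 3 (m 0 + m 1) + min 3 (m 1 + m 2) + min 3 (m 2 + m 0)"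
  have "33 \<le> 3 * t + 2 * (m 0 + m 1 + m 2) + r"
    unfolding t_def r_def by (rule theta_arith) (use m_le assms in auto)
  moreover have "2 * (m 0 + m 1 + m 2) \<le> (\<Sum>d<12. digon_cost d)"
    using digon_cost_sum unfolding sum_numeral_lessThan .
  moreover have "r \<le> (\<Sum>i<3. face_cost i)"
    using face_cost_m[of 0] face_cost_m[of 1] face_cost_m[of 2] unfolding sum_numeral_lessThan r_def
    by (simp add: numeral_2_eq_2 del: min_le_iff_disj)
  moreover have "3 * card LH + 3 * t \<le> 33 + 2 * core + 2 * (\<Sum>j<6. w (372 + j))"
    unfolding t_def by (rule LH_bound_theta)
  ultimately show ?thesis using component_bound by linarith
qed

text \<open>Without broken links the theta bound leaves a gap of 33 - 30 = 3, which the assumed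
  costs fill.\<close>

lemma component_bound_costly:
  assumes "3 \<le> card LS + (\<Sum>d<12. digon_cost d) + (\<Sum>i<3. face_cost i)"
  shows "3 * card (f ` ({..<429} - W)) \<le> 2 * card W"
proof (cases "m 0 + m 1 + m 2 = 0")
  case True
  then have "3 * card LH + 30 \<le> 33 + 2 * core + 2 * (\<Sum>j<6. w (372 + j))"
    using LH_bound_theta by simp
  then show ?thesis using component_bound assms by linarith
qed (rule component_bound_blocked)

text \<open>A blocked ear pays at its digon, or the dead cut vertex there contributes. At its face
  it cannot be excused, since both of its cut vertices there would have to be dead.\<close>

lemma blocked_cost:
  assumes e: "e < 24" "blocked e" and small: "\<And>i. i < 3 \<Longrightarrow> n i \<le> 1"
  shows "(\<Sum>d<12. digon_cost d) \<ge> 1" "(\<Sum>i<3. face_cost i) \<ge> 1"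
proof -
  have "e = 2 * (e div 2) \<or> e = 2 * (e div 2) + 1" by presburger
  moreover have "1 \<le> digon_cost d" if "e = 2*d \<or> e = 2*d + 1" for d
    using e(2) that by (auto simp: digon_cost_def ear_cost'_def w_def)
  ultimately have "1 \<le> digon_cost (e div 2)" by blast
  also have "\<dots> \<le> (\<Sum>d<12. digon_cost d)" using e(1) by (intro member_le_sum) auto
  finally show "(\<Sum>d<12. digon_cost d) \<ge> 1" .
  have "(\<Sum>e<24. of_bool (blocked e)) = (\<Sum>i<3. face_ears (\<lambda>e. of_bool (blocked e)) i)"
    unfolding face_ears_def by (rule sum_ears)
  also have "\<dots> \<le> (\<Sum>i<3. face_cost i)"
  proof (rule sum_mono)
    fix i :: nat assume "i \<in> {..<3}"
    then have "i < 3" by simp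
    then show "face_ears (\<lambda>e. of_bool (blocked e)) i \<le> face_cost i" using face_cost_few[OF _ small, of i] by simp
  qed
  finally have "(\<Sum>e<24. of_bool (blocked e)) \<le> (\<Sum>i<3. face_cost i)" .
  moreover have "of_bool (blocked e) \<le> (\<Sum>e<24. of_bool (blocked e) :: nat)" using e(1) by (intro member_le_sum) auto
  ultimately show "(\<Sum>i<3. face_cost i) \<ge> 1" using e(2) by simp
qed

lemma cut_vertex_in_ear_table: "list_all (\<lambda>v. list_ex (\<lambda>g. v \<in> set (gadget_cuts g)) [0..<24]) [378..<429]"
proof -
  have "list_all (\<lambda>v. list_ex (\<lambda>l. v \<in> set l) (take 24 (map gadget_cuts [0..<39]))) [378..<429]"
    unfolding gadget_cuts_table by code_simp
  then show ?thesis by (simp only: take_map take_upt list_ex_iff set_map bex_simps add_0)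
qed

lemma cut_vertex_in_ear:
  assumes "378 \<le> v" "v < 429"
  shows "\<exists>g<24. v \<in> set (gadget_cuts g)"
proof -
  have "v \<in> set [378..<429]" unfolding set_upt atLeastLessThan_iff using assms ..
  from bspec[OF cut_vertex_in_ear_table[unfolded list_all_iff] this]
  show ?thesis unfolding list_ex_iff set_upt by (meson atLeastLessThan_iff)
qed

text \<open>So little cost forces every component to meet a hub, so that \<open>card LH\<close>
  bounds the number of components; the hubs are then counted on the intact theta graph.\<close>

lemma component_bound_cheap:
  assumes cheap: "card LS + (\<Sum>d<12. digon_cost d) + (\<Sum>i<3. face_cost i) \<le> 2"
    and two: "2 \<le> card (f ` ({..<429} - W))"
  shows "3 * card (f ` ({..<429} - W)) \<le> 2 * card W"
proof -
  have "face_cost i \<le> (\<Sum>i<3. face_cost i)" if "i < 3" for i using that by (intro member_le_sum) auto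
  then have small: "n i \<le> 1" if "i < 3" for i using face_cost_many[of i] cheap that by fastforce
  have "2 * n i \<le> face_cost i" if "i < 3" for i
    using face_cost_few[OF that small[OF that]] by simp
  then have "(\<Sum>i<3. 2 * n i) \<le> (\<Sum>i<3. face_cost i)" by (intro sum_mono) simp
  moreover have "(\<Sum>d<12. 2 * w (378 + d)) \<le> (\<Sum>d<12. digon_cost d)" by (intro sum_mono) (simp add: digon_cost_def)
  moreover have "(\<Sum>v<390. w v) = (\<Sum>v<378. w v) + (\<Sum>d<12. w (378 + d))"
    using sum_blocks[of w 378 1 12] by simp
  moreover have "(\<Sum>v<429. w v) = (\<Sum>v<390. w v) + (\<Sum>i<3. n i)"
    using sum_blocks[of w 390 13 3] by (simp add: n_def)
  ultimately have dead1: "(\<Sum>v<429. w v) \<le> (\<Sum>v<378. w v) + 1"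
    using cheap by (simp add: sum_distrib_left[symmetric])
  \<comment> \<open>Each dead cut vertex leaves 2 units in a face or digon cost, so at most one is
    dead.\<close>
  have dead2: "\<not> (a \<in> W \<and> b \<in> W)" if "378 \<le> a" "a < 429" "378 \<le> b" "b < 429" "a \<noteq> b" for a b
  proof
    assume "a \<in> W \<and> b \<in> W"
    then have "2 = (\<Sum>v\<in>{a, b}. w v)" using that(5) by (simp add: w_def)
    also have "\<dots> \<le> (\<Sum>v\<in>{378..<429}. w v)" using that by (intro sum_mono2) auto
    also have "(\<Sum>v\<in>{378..<429}. w v) = (\<Sum>v<429. w v) - (\<Sum>v<378. w v)"
      using sum.atLeastLessThan_concat[of 0 378 429 w] by (simp add: atLeast0LessThan)
    finally show False using dead1 by linarith
  qed
  \<comment> \<open>One label in \<open>LS\<close>, a digon cost and a face cost would already add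
    up to 3.\<close>
  have unblocked: "\<not> blocked e" if "e < 24" "LS \<noteq> {}" for e
    using blocked_cost[OF that(1) _ small] cheap that(2) card_gt_0_iff[of LS] by fastforce
  have LS: "LS = {}"
  proof (rule ccontr)
    assume ne: "LS \<noteq> {}"
    then obtain l v where v: "378 \<le> v" "v < 429" "\<And>g. v \<in> set (gadget_cuts g) \<Longrightarrow> l \<in> cut_lab g"
      using LS_in_cut_lab by blast
    obtain g where "g < 24" "v \<in> set (gadget_cuts g)"
      using cut_vertex_in_ear[OF v(1,2)] by blast
    then have "cut_lab g \<noteq> {}" "g < 24" using v(3) by blast+
    then have "blocked g" using ear_state_blocked[of g] unfolding ear_state_def Let_def by blast
    then show False using unblocked[OF \<open>g < 24\<close> ne] by blast
  qed
  have EI: "ear_inner e = {}" if e: "e < 24" for e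
  proof (rule ccontr)
    assume ne: "ear_inner e \<noteq> {}"
    let ?p = "ear_verts e ! 8" and ?q = "ear_verts e ! 9" and ?s = "ear_verts e ! 10"
    have "?p \<in> W \<and> ?q \<in> W \<or> ?p \<in> W \<and> ?s \<in> W \<or> ?q \<in> W \<and> ?s \<in> W"
      using ear_state_blocked[OF e] ne unfolding ear_state_def Let_def by blast
    moreover have "?p \<noteq> ?q" "?p \<noteq> ?s" "?q \<noteq> ?s"
      using ear_cuts_distinct e by (auto simp: list_all_iff)
    ultimately show False using dead2 ear_cuts_range[OF e] by blast
  qed
  have PI: "pendant_inner h = {}" if h: "h < 15" for h
  proof (rule ccontr)
    assume ne: "pendant_inner h \<noteq> {}"
    let ?p = "pendant_verts h ! 7" and ?q = "pendant_verts h ! 8" and ?s = "pendant_verts h ! 9"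
    have "?p \<in> W \<and> ?q \<in> W \<or> ?p \<in> W \<and> ?s \<in> W \<or> ?q \<in> W \<and> ?s \<in> W"
      using pendant_bounds(2)[OF h ne] by blast
    moreover have "?p \<noteq> ?q" "?p \<noteq> ?s" "?q \<noteq> ?s"
      using pendant_cuts_distinct h by (auto simp: list_all_iff)
    ultimately show False using dead2 pendant_cuts_range[of _ h] by blast
  qed
  have c: "card (f ` ({..<429} - W)) \<le> card LH" using label_count EI PI LS by simp
  show ?thesis
  proof (cases "m 0 + m 1 + m 2 = 0")
    case True
    \<comment> \<open>The number of pairs of paths tied at some end; an untied pair has lost both of
      its end vertices.\<close>
    define a where "a = (of_bool (373 \<notin> W \<or> 376 \<notin> W) + of_bool (374 \<notin> W \<or> 377 \<notin> W) + of_bool (372 \<notin> W \<or> 375 \<notin> W) :: nat)"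
    have linked: "card LH + 12 + min 2 a \<le> (\<Sum>h<15. card (hub_lab h))"
      unfolding a_def by (rule card_LH_linked) (use True in simp_all)
    have a: "6 \<le> 2 * a + (\<Sum>j<6. w (372 + j))"
      unfolding a_def sum_numeral_lessThan w_def by (simp add: of_bool_def)
    have a3: "a \<le> 3" unfolding a_def by (simp add: of_bool_def)
    have "(\<Sum>v<372. w v) = (\<Sum>v<297. w v) + core" using sum_blocks[of w 297 5 15] by (simp add: core_def)
    moreover have "(\<Sum>v<378. w v) = (\<Sum>v<372. w v) + (\<Sum>j<6. w (372 + j))" using sum_blocks[of w 372 1 6] by simp
    moreover have cW: "card W = (\<Sum>v<429. w v)" using W_sub by (simp add: w_def sum.If_cases Int_absorb1)
    moreover have "(\<Sum>v<378. w v) \<le> (\<Sum>v<429. w v)" by (intro sum_mono2) auto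
    ultimately have tot: "core + (\<Sum>j<6. w (372 + j)) \<le> card W" by linarith
    have core: "card (W \<inter> {297..<372}) = core"
    proof -
      have "(\<Sum>v<297. w v) + (\<Sum>v\<in>{297..<372}. w v) = (\<Sum>v<372. w v)"
        using sum.atLeastLessThan_concat[of 0 297 372 w] by (simp add: atLeast0LessThan)
      then have "core = (\<Sum>v\<in>{297..<372}. w v)" using \<open>(\<Sum>v<372. w v) = (\<Sum>v<297. w v) + core\<close> by linarith
      then show ?thesis by (simp add: w_def sum.If_cases Int_commute)
    qed
    have finW: "finite W" using W_sub finite_subset by blast
    have Z: "card W = core + card (W - {297..<372})"
      using card_Int_Diff[OF finW, of "{297..<372}"] core by simp
    \<comment> \<open>With at most one deletion outside the cores each hub shows at most one label
      and enough pairs of paths stay tied, so only one hub label would remain, against the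
      assumption of two components.\<close>
    have "2 \<le> card (W - {297..<372})"
    proof (rule ccontr)
      assume "\<not> 2 \<le> card (W - {297..<372})"
      then have Z1: "card (W - {297..<372}) \<le> 1" by simp
      have "(\<Sum>h<15. card (hub_lab h)) \<le> (\<Sum>h<15::nat. 1)"
        by (rule sum_mono, rule hub_lab_bounds(2)[OF _ Z1], simp)
      then have "card LH + 12 + min 2 a \<le> 15" using linked by simp
      moreover have "2 \<le> a" using a tot Z Z1 by linarith
      ultimately have "card LH \<le> 1" by simp
      then show False using c two by linarith
    qed
    moreover have "3 * card LH + 36 + 3 * min 2 a \<le> 45 + 2 * core" using linked sum_hub_lab by linarith
    moreover have "a = 0 \<or> a = 1 \<or> 2 \<le> a" by linarith
    ultimately show ?thesis using c Z a tot by (elim disjE) simp_all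
  qed (rule component_bound_blocked)
qed

theorem component_bound_tough:
  assumes "2 \<le> card (f ` ({..<429} - W))"
  shows "3 * card (f ` ({..<429} - W)) \<le> 2 * card W"
  using component_bound_cheap[OF _ assms] component_bound_costly by linarith

end

section \<open>Components as labels\<close>

lemma joined_adjacent: "{a, b} \<in> edges G \<Longrightarrow> a \<in> verts G \<Longrightarrow> b \<in> verts G \<Longrightarrow> (a, b) \<in> joined G"
  unfolding joined_def by (auto intro: r_into_rtrancl)

lemma equiv_joined: "equiv (verts G) (joined G)"
proof (rule equivI)
  show "joined G \<subseteq> verts G \<times> verts G" by (auto simp: joined_def)
  show "refl_on (verts G) (joined G)" by (auto simp: refl_on_def joined_def)
  have "sym ({(x, y). {x, y} \<in> edges G}\<^sup>*)" by (rule sym_rtrancl) (auto simp: sym_def insert_commute)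
  then show "sym (joined G)" unfolding joined_def sym_def by blast
  show "trans (joined G)" unfolding joined_def trans_def by (auto intro: rtrancl_trans)
qed

theorem the_graph_tough: "tough (3 / 2) the_graph"
  unfolding tough_def
proof (intro allI impI)
  fix S assume S: "S \<subseteq> verts the_graph" and two: "2 \<le> num_components (delete_verts the_graph S)"
  let ?G = "delete_verts the_graph S"
  define f where "f v = joined ?G `` {v}" for v
  have verts: "verts ?G = {..<429} - S" by (simp add: delete_verts_def the_graph_def)
  have comps: "graph_components ?G = f ` ({..<429} - S)"
    unfolding graph_components_def quotient_def f_def verts[symmetric] by auto
  interpret vertex_cut S f
  proof
    show "S \<subseteq> {..<429}" using S by (simp add: the_graph_def)
    fix t a b assume t: "t \<in> set facets" "(a, b) \<in> sides t" "a \<notin> S" "b \<notin> S"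
    have "{a, b} \<in> edges the_graph" using t(1,2) by (force simp: the_graph_def)
    then have e: "{a, b} \<in> edges ?G" using t(3,4) by (simp add: delete_verts_def)
    have "a < 429" "b < 429" using dart_range[of a b] t(1,2) unfolding set_darts by blast+
    then have "(a, b) \<in> joined ?G" using t(3,4) e by (intro joined_adjacent) (simp_all add: verts)
    then show "f a = f b" unfolding f_def by (rule equiv_class_eq[OF equiv_joined])
  qed
  have "3 * card (graph_components ?G) \<le> 2 * card S"
    using component_bound_tough two unfolding num_components_def comps by simp
  then show "3 / 2 * real (num_components ?G) \<le> real (card S)"
    unfolding num_components_def by simp
qed

section \<open>The embedding\<close>

definition place_at :: "nat \<Rightarrow> complex" where
  "place_at v = (case pos v of (x, y) \<Rightarrow> Complex (real_of_int x) (real_of_int y))"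

lemma cross_place_at: "cross (place_at a) (place_at b) (place_at c) = real_of_int (orient (pos a) (pos b) (pos c))"
  by (cases "pos a"; cases "pos b"; cases "pos c") (simp add: place_at_def cross_def)

lemma inj_place_at: "inj_on place_at {..<429}"
proof (rule inj_onI)
  fix u v :: nat assume uv: "u \<in> {..<429}" "v \<in> {..<429}" "place_at u = place_at v"
  have "pos u = pos v" using uv(3) by (simp add: place_at_def split: prod.splits)
  then show "u = v" by (rule inj_onD[OF inj_pos _ uv(1,2)])
qed

lemma set_inner_facets: "set inner_facets = set facets - {(372, 8, 416)}"
  unfolding inner_facets_def by auto

lemma sides_inner:
  assumes "(a, b) \<in> set darts" "(a, b) \<notin> sides (372, 8, 416)"
  shows "(a, b) \<in> \<Union> (sides ` set inner_facets)"
proof -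
  obtain t where "t \<in> set facets" "(a, b) \<in> sides t" using assms(1) unfolding set_darts by blast
  moreover have "t \<noteq> (372, 8, 416)" using assms(2) calculation(2) by blast
  ultimately show ?thesis unfolding set_inner_facets by blast
qed

lemma inner_darts: "\<Union> (sides ` set inner_facets) \<subseteq> set darts"
  unfolding set_darts set_inner_facets by blast

lemma sides_outer: "sides (372, 8, 416) = {(372::nat, 8), (8, 416), (416, 372)}"
  "sides (8, 372, 416) = {(8::nat, 372), (372, 416), (416, 8)}"
  by (simp_all add: sides_def)

lemma outer_darts: "(a, b) \<in> sides (372, 8, 416) \<Longrightarrow> (b, a) \<in> \<Union> (sides ` set inner_facets)"
proof -
  assume ab: "(a, b) \<in> sides (372, 8, 416)"
  then have "(a, b) \<in> set darts" using outer_facet unfolding set_darts by blast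
  from sides_inner[OF dart_converse[OF this]] show ?thesis using ab by (auto simp: sides_outer)
qed

text \<open>Removing the outer facet (372, 8, 416) leaves exactly the converses of its sides without
  a partner, and these are the sides of the positively oriented triangle (8, 372, 416).\<close>

interpretation straight_triangulation place_at "set inner_facets" 8 372 416
proof
  show "finite (set inner_facets)" by simp
  note ok = orients_ok_sound[OF orient_check]
  show "cross (place_at a) (place_at b) (place_at c) > 0" if "(a, b, c) \<in> set inner_facets" for a b c
    using ok that unfolding cross_place_at by fastforce
  show "cross (place_at 8) (place_at 372) (place_at 416) > 0"
    unfolding cross_place_at outer_pos by simp
  show "(b, a) \<in> \<Union> (sides ` set inner_facets) \<or> (a, b) \<in> sides (8, 372, 416)"
    if "(a, b) \<in> \<Union> (sides ` set inner_facets)" for a b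
  proof (cases "(b, a) \<in> sides (372, 8, 416)")
    case True
    then show ?thesis by (auto simp: sides_outer)
  next
    case False
    then show ?thesis using sides_inner[OF dart_converse False] inner_darts that by blast
  qed
  show "sides (8, 372, 416) \<subseteq> \<Union> (sides ` set inner_facets)"
  proof
    fix d assume d: "d \<in> sides (8 :: nat, 372, 416)"
    obtain a b where "d = (a, b)" by (cases d)
    with d have "(b, a) \<in> sides (372, 8, 416)" by (auto simp: sides_outer)
    from outer_darts[OF this] show "d \<in> \<Union> (sides ` set inner_facets)" using \<open>d = (a, b)\<close> by simp
  qed
  have "(\<Sum>(a, b, c)\<in>set inner_facets. cross (place_at a) (place_at b) (place_at c)) =
      real_of_int (\<Sum>(a, b, c)\<in>set inner_facets. orient (pos a) (pos b) (pos c))"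
    unfolding of_int_sum cross_place_at by (intro sum.cong refl) (simp split: prod.split)
  also have "\<dots> \<le> real_of_int 181903" using ok by (simp only: of_int_le_iff)
  also have "\<dots> = cross (place_at 8) (place_at 372) (place_at 416)" unfolding cross_place_at outer_pos by simp
  finally show "(\<Sum>(a, b, c)\<in>set inner_facets. cross (place_at a) (place_at b) (place_at c)) \<le> cross (place_at 8) (place_at 372) (place_at 416)" .
  have "fst ` \<Union> (sides ` set inner_facets) \<subseteq> {..<429}" using inner_darts dart_range by fastforce
  then show "inj_on place_at (fst ` \<Union> (sides ` set inner_facets))" by (rule inj_on_subset[OF inj_place_at])
qed

lemma the_graph_plane: "plane_triangulation the_graph place_at drawn_edge"
proof (rule plane_triangulation_straight)
  let ?D = "\<Union> (sides ` set inner_facets)"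
  have either: "(a, b) \<in> ?D \<or> (b, a) \<in> ?D" if "(a, b) \<in> set darts" for a b
    using sides_inner[OF that] outer_darts by blast
  show "verts the_graph = fst ` ?D"
  proof
    show "verts the_graph \<subseteq> fst ` ?D"
    proof
      fix v assume "v \<in> verts the_graph"
      then obtain b where vb: "(v, b) \<in> set darts" using vertex_has_dart[of v] by (auto simp: the_graph_def)
      show "v \<in> fst ` ?D"
      proof (cases "(v, b) \<in> ?D")
        case True
        then show ?thesis by (rule rev_image_eqI) simp
      next
        case False
        then have "(v, b) \<in> sides (372, 8, 416)" using sides_inner[OF vb] by blast
        then obtain c where "(c, v) \<in> sides (372, 8, 416)" by (auto simp: sides_outer)
        then show ?thesis by (intro rev_image_eqI[OF outer_darts]) simp_all
      qed
    qed
    show "fst ` ?D \<subseteq> verts the_graph" using inner_darts dart_range by (fastforce simp: the_graph_def)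
  qed
  show "edges the_graph = (\<lambda>(a, b). {a, b}) ` ?D"
  proof
    show "edges the_graph \<subseteq> (\<lambda>(a, b). {a, b}) ` ?D"
    proof
      fix e assume "e \<in> edges the_graph"
      then obtain a b where ab: "e = {a, b}" "(a, b) \<in> set darts" unfolding edges_the_graph by auto
      from either[OF ab(2)] show "e \<in> (\<lambda>(a, b). {a, b}) ` ?D"
        by (elim disjE rev_image_eqI) (simp_all add: ab(1) insert_commute)
    qed
    show "(\<lambda>(a, b). {a, b}) ` ?D \<subseteq> edges the_graph" unfolding edges_the_graph by (rule image_mono[OF inner_darts])
  qed
qed

theorem theorem1p1:
  shows "\<exists>(G :: nat ugraph) p \<gamma>.
           plane_triangulation G p \<gamma> \<and> tough (3 / 2) G \<and> \<not> (\<exists>H. two_factor H G)"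
  using the_graph_plane the_graph_tough the_graph_no_two_factor by blast

end
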